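(* Let $\mathcal M$ be a $\mathbb Z$-graded manifold equipped with a homological vector field $\mathcal Q$ and a Poisson bracket $\{\cdot,\cdot\}_k$ of degree $k\in\mathbb Z$, and let $\pi^\sharp\colon\Omega^1(\mathcal M)\to\mathfrak X(\mathcal M)$ be the induced map. Then $(\mathcal M,\mathcal Q,\{\cdot,\cdot\}_k)$ is symplectic (i.e. it is a $\mathcal{PQ}$-manifold whose Poisson bracket is symplectic) if and only if $\pi^\sharp$ is an anti-isomorphism of left differential graded $\mathcal M$-modules from $(\Omega^1(\mathcal M),\pounds_{\mathcal Q})$ to $(\mathfrak X(\mathcal M),\pounds_{\mathcal Q})$, or equivalently if and only if it is an isomorphism of right differential graded $\mathcal M$-modules from $(\Omega^1(\mathcal M),-\pounds_{\mathcal Q})$ to $(\mathfrak X(\mathcal M),\pounds_{\mathcal Q})$; that is, if and only if $\pi^\sharp$ is bijective and $\pi^\sharp\circ\pounds_{\mathcal Q}=-\pounds_{\mathcal Q}\circ\pi^\sharp$.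
   Context: A $\mathbb Z$-graded manifold $\mathcal M$ over a smooth manifold $M$ is a sheaf $\mathcal C^\infty(\mathcal M)$ on $M$ of $\mathbb Z$-graded, graded commutative, unital $C^\infty(M)$-algebras locally isomorphic to $C^\infty(U)\otimes \underline S(\underline V)$, with $\underline V$ a fixed finite-dimensional $\mathbb Z$-graded vector space and $\underline S$ the graded symmetric algebra. $\mathfrak X(\mathcal M)$ is the $\mathcal C^\infty(\mathcal M)$-module (sheaf) of graded derivations of $\mathcal C^\infty(\mathcal M)$, with graded commutator $[\cdot,\cdot]$; $|\cdot|$ denotes degree. A homological vector field is $\mathcal Q\in\mathfrak X(\mathcal M)$ of degree $1$ with $\mathcal Q^2=0$. A Poisson bracket of degree $k$ is an $\mathbb R$-bilinear map $\{\cdot,\cdot\}_k$ on $\mathcal C^\infty(\mathcal M)$ with $|\{\xi_1,\xi_2\}_k|=|\xi_1|+|\xi_2|+k$ such that, for homogeneous elements, $\{\xi_1,\xi_2\}_k=-(-1)^{(|\xi_1|+k)(|\xi_2|+k)}\{\xi_2,\xi_1\}_k$, $\{\xi_1,\xi_2\xi_3\}_k=\{\xi_1,\xi_2\}_k\xi_3+(-1)^{(|\xi_1|+k)|\xi_2|}\xi_2\{\xi_1,\xi_3\}_k$, and $\{\xi_1,\{\xi_2,\xi_3\}_k\}_k=\{\{\xi_1,\xi_2\}_k,\xi_3\}_k+(-1)^{(|\xi_1|+k)(|\xi_2|+k)}\{\xi_2,\{\xi_1,\xi_3\}_k\}_k$. The Hamiltonian vector field of $\xi$ is $\mathcal X_\xi=\{\xi,\cdot\}_k$;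 the bracket is symplectic if the Hamiltonian vector fields generate $\mathfrak X(\mathcal M)$ as a $\mathcal C^\infty(\mathcal M)$-module. $(\mathcal M,\mathcal Q,\{\cdot,\cdot\}_k)$ is a $\mathcal{PQ}$-manifold if $\mathcal Q\{\xi_1,\xi_2\}_k=\{\mathcal Q(\xi_1),\xi_2\}_k+(-1)^{|\xi_1|+k}\{\xi_1,\mathcal Q(\xi_2)\}_k$ for all homogeneous $\xi_1,\xi_2$. $\Omega^1(\mathcal M)$ is the module of $1$-forms, generated over $\mathcal C^\infty(\mathcal M)$ by the $\mathrm d\xi$, with $\mathrm d(\xi_1\xi_2)=(\mathrm d\xi_1)\xi_2+(-1)^{|\xi_1|}\xi_1\mathrm d\xi_2$ and $(\mathrm d\xi_1)\xi_2=(-1)^{(|\xi_1|+1)|\xi_2|}\xi_2\,\mathrm d\xi_1$. On $\mathfrak X(\mathcal M)$, $\pounds_{\mathcal Q}=[\mathcal Q,\cdot]$ (adjoint module). On $\Omega^1(\mathcal M)$, $\pounds_{\mathcal Q}(\mathrm d\xi)=-\mathrm d(\mathcal Q(\xi))$ and $\pounds_{\mathcal Q}(\xi\eta)=\mathcal Q(\xi)\eta+(-1)^{|\xi|}\xi\pounds_{\mathcal Q}(\eta)$ (left coadjoint module); the right coadjoint module is $\Omega^1(\mathcal M)$ with differential $-\pounds_{\mathcal Q}$. The map $\pi^\sharp$, of degree $k$, is defined by $\pi^\sharp(\mathrm d\xi_1)(\xi_2)=\{\xi_1,\xi_2\}_k$ and extended by $\pi^\sharp(\xi_1\mathrm d\xi_2)=(-1)^{|\xi_1|}\xi_1\,\pi^\sharp(\mathrm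 d\xi_2)$, $\pi^\sharp((\mathrm d\xi_1)\xi_2)=(-1)^{|\xi_2|}\pi^\sharp(\mathrm d\xi_1)\,\xi_2$, where in the target the right multiplication is $\mathcal X\xi=(-1)^{|\xi|(|\mathcal X|+1-k)}\xi\mathcal X$. *)

theory Defs
  imports "HOL-Analysis.Analysis" "HOL-Library.Function_Algebras"
begin

text \<open>
  Functions carry pointwise addition and multiplication throughout.
  Graded objects are given by their homogeneous parts: a graded sheaf is a family of sheaves
  indexed by the degree, and a graded linear map is given on homogeneous elements.
\<close>

text \<open>The Koszul sign \<open>(-1)\<^sup>i x\<close>.\<close>

definition kos :: "int \<Rightarrow> 'b::ab_group_add \<Rightarrow> 'b"
  where "kos i x = (if even i then x else - x)"


section \<open>Smooth manifolds\<close>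

text \<open>\<open>C\<^sup>k\<close> functions on an open subset of \<open>\<real>\<^sup>n\<close>: all iterated partial derivatives
  of order at most \<open>k\<close> exist and are continuous.  The case \<open>n = 0\<close> is included.\<close>

primrec Ck_on :: "nat \<Rightarrow> nat \<Rightarrow> (nat \<Rightarrow> real) set \<Rightarrow> ((nat \<Rightarrow> real) \<Rightarrow> real) \<Rightarrow> bool"
  where
    "Ck_on n 0 W f \<longleftrightarrow> continuous_map (subtopology (Euclidean_space n) W) euclideanreal f"
  | "Ck_on n (Suc k) W f \<longleftrightarrow>
       continuous_map (subtopology (Euclidean_space n) W) euclideanreal f \<and>
       (\<forall>i<n. (\<forall>x\<in>W. (\<lambda>t. f (x(i := t))) differentiable (at (x i))) \<and>
              Ck_on n k W (\<lambda>x. deriv (\<lambda>t. f (x(i := t))) (x i)))"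

definition smooth_on :: "nat \<Rightarrow> (nat \<Rightarrow> real) set \<Rightarrow> ((nat \<Rightarrow> real) \<Rightarrow> real) \<Rightarrow> bool"
  where "smooth_on n W f \<longleftrightarrow> (\<forall>k. Ck_on n k W f)"

record 'm mfd =
  base :: "'m topology"
  mdim :: nat
  atlas :: "('m set \<times> ('m \<Rightarrow> nat \<Rightarrow> real)) set"

definition smooth_manifold :: "('m, 'z) mfd_scheme \<Rightarrow> bool"
  where "smooth_manifold M \<longleftrightarrow>
    Hausdorff_space (base M) \<and> second_countable (base M) \<and>
    \<Union> (fst ` atlas M) = topspace (base M) \<and>
    (\<forall>(U, \<phi>)\<in>atlas M. openin (base M) U \<and> openin (Euclidean_space (mdim M)) (\<phi> ` U) \<and>
       homeomorphic_map (subtopology (base M) U)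
         (subtopology (Euclidean_space (mdim M)) (\<phi> ` U)) \<phi>) \<and>
    (\<forall>(U, \<phi>)\<in>atlas M. \<forall>(V, \<psi>)\<in>atlas M. \<forall>i<mdim M.
       smooth_on (mdim M) (\<phi> ` (U \<inter> V)) (\<lambda>x. \<psi> (inv_into U \<phi> x) i))"

text \<open>Smooth functions on an open set \<open>U\<close>; their values outside \<open>U\<close> are irrelevant.\<close>

definition smooth_fun :: "('m, 'z) mfd_scheme \<Rightarrow> 'm set \<Rightarrow> ('m \<Rightarrow> real) set"
  where "smooth_fun M U =
    {f. \<forall>(V, \<phi>)\<in>atlas M. smooth_on (mdim M) (\<phi> ` (U \<inter> V)) (\<lambda>x. f (inv_into V \<phi> x))}"


section \<open>The model \<open>C\<^sup>\<infinity>(U) \<otimes> S(V)\<close>\<close>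

text \<open>
  A finite-dimensional graded vector space \<open>V\<close> is given by a homogeneous basis
  \<open>v\<^sub>0, \<dots>, v\<^bsub>r-1\<^esub>\<close> with degrees \<open>w 0, \<dots>, w (r - 1)\<close>.  As \<open>v\<^sub>i v\<^sub>j = (-1)\<^bsup>w i w j\<^esup> v\<^sub>j v\<^sub>i\<close>
  in \<open>S(V)\<close>, the ordered monomials whose odd generators have exponent at most \<open>1\<close> form a basis of
  \<open>S(V)\<close>.
\<close>

definition monomials :: "nat \<Rightarrow> (nat \<Rightarrow> int) \<Rightarrow> (nat \<Rightarrow> nat) set"
  where "monomials r w = {\<alpha>. (\<forall>i\<ge>r. \<alpha> i = 0) \<and> (\<forall>i<r. odd (w i) \<longrightarrow> \<alpha> i \<le> 1)}"

definition mono_deg :: "nat \<Rightarrow> (nat \<Rightarrow> int) \<Rightarrow> (nat \<Rightarrow> nat) \<Rightarrow> int"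
  where "mono_deg r w \<alpha> = (\<Sum>i<r. int (\<alpha> i) * w i)"

text \<open>
  Sections of degree \<open>d\<close> over \<open>U\<close>, as families of coefficient functions (extended by \<open>0\<close> outside
  \<open>U\<close>).  If \<open>S(V)\<close> is infinite-dimensional in degree \<open>d\<close>, then \<open>U \<mapsto> C\<^sup>\<infinity>(U) \<otimes> S(V)\<^sub>d\<close> is only a
  presheaf; locally finite families are the sections of the associated sheaf.
\<close>

definition model_sec ::
  "('m, 'z) mfd_scheme \<Rightarrow> nat \<Rightarrow> (nat \<Rightarrow> int) \<Rightarrow> 'm set \<Rightarrow> int \<Rightarrow> ((nat \<Rightarrow> nat) \<Rightarrow> 'm \<Rightarrow> real) set"
  where "model_sec M r w U d =
    {F. (\<forall>\<alpha>. F \<alpha> \<in> smooth_fun M U \<and> (\<forall>x. x \<notin> U \<longrightarrow> F \<alpha> x = 0)) \<and>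
        (\<forall>\<alpha>. F \<alpha> \<noteq> 0 \<longrightarrow> \<alpha> \<in> monomials r w \<and> mono_deg r w \<alpha> = d) \<and>
        (\<forall>p\<in>U. \<exists>N. openin (base M) N \<and> p \<in> N \<and> N \<subseteq> U \<and> finite {\<alpha>. \<exists>x\<in>N. F \<alpha> x \<noteq> 0})}"

text \<open>The sign is that of reordering \<open>v\<^sup>\<alpha> v\<^sup>\<beta>\<close> into \<open>v\<^bsup>\<alpha>+\<beta>\<^esup>\<close>.\<close>

definition model_mult ::
  "nat \<Rightarrow> (nat \<Rightarrow> int) \<Rightarrow> ((nat \<Rightarrow> nat) \<Rightarrow> 'm \<Rightarrow> real) \<Rightarrow> ((nat \<Rightarrow> nat) \<Rightarrow> 'm \<Rightarrow> real)
    \<Rightarrow> (nat \<Rightarrow> nat) \<Rightarrow> 'm \<Rightarrow> real"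
  where "model_mult r w F G = (\<lambda>\<gamma> x.
    if \<gamma> \<in> monomials r w
    then \<Sum>(\<alpha>, \<beta>) | \<alpha> + \<beta> = \<gamma>.
           kos (\<Sum>i<r. \<Sum>j<i. int (\<alpha> i) * w i * (int (\<beta> j) * w j)) (F \<alpha> x * G \<beta> x)
    else 0)"

definition model_const :: "'m set \<Rightarrow> ('m \<Rightarrow> real) \<Rightarrow> (nat \<Rightarrow> nat) \<Rightarrow> 'm \<Rightarrow> real"
  where "model_const U f = (\<lambda>\<alpha> x. if \<alpha> = 0 \<and> x \<in> U then f x else 0)"

definition model_restrict ::
  "'m set \<Rightarrow> ((nat \<Rightarrow> nat) \<Rightarrow> 'm \<Rightarrow> real) \<Rightarrow> (nat \<Rightarrow> nat) \<Rightarrow> 'm \<Rightarrow> real"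
  where "model_restrict W F = (\<lambda>\<alpha> x. if x \<in> W then F \<alpha> x else 0)"


section \<open>Graded manifolds\<close>

text \<open>
  \<open>sec G U d\<close> are the sections of degree \<open>d\<close> over \<open>U\<close>, \<open>res G U V\<close> is restriction from \<open>U\<close> to
  \<open>V\<close>, and \<open>emb G U\<close> is the structure map \<open>C\<^sup>\<infinity>(U) \<rightarrow> sec G U 0\<close>; in particular \<open>emb G U 1\<close> is the
  unit over \<open>U\<close>.  \<open>V\<close> is encoded by \<open>vdim\<close> and \<open>vdeg\<close>.  The sections over all open sets live in one
  ambient (nonunital) algebra, such as the product over \<open>U\<close> of the algebras of sections, with
  the homogeneous parts as linear subspaces.
\<close>

record ('m, 'a) gmfd = "'m mfd" +
  vdim :: nat
  vdeg :: "nat \<Rightarrow> int"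
  sec :: "'m set \<Rightarrow> int \<Rightarrow> 'a set"
  res :: "'m set \<Rightarrow> 'm set \<Rightarrow> 'a \<Rightarrow> 'a"
  emb :: "'m set \<Rightarrow> ('m \<Rightarrow> real) \<Rightarrow> 'a"

definition opn :: "('m, 'z) mfd_scheme \<Rightarrow> 'm set \<Rightarrow> bool"
  where "opn M U \<longleftrightarrow> openin (base M) U"

definition graded_comm_algebras :: "('m, 'a::real_algebra) gmfd \<Rightarrow> bool"
  where "graded_comm_algebras G \<longleftrightarrow> (\<forall>U. opn G U \<longrightarrow>
    (\<forall>d. subspace (sec G U d)) \<and>
    (\<forall>D f. finite D \<and> (\<forall>d\<in>D. f d \<in> sec G U d) \<and> (\<Sum>d\<in>D. f d) = 0 \<longrightarrow> (\<forall>d\<in>D. f d = 0)) \<and>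
    (\<forall>i j. \<forall>\<xi>\<in>sec G U i. \<forall>\<zeta>\<in>sec G U j.
       \<xi> * \<zeta> \<in> sec G U (i + j) \<and> \<xi> * \<zeta> = kos (i * j) (\<zeta> * \<xi>)))"

definition presheaf :: "('m, 'a::real_algebra) gmfd \<Rightarrow> bool"
  where "presheaf G \<longleftrightarrow>
    (\<forall>U V. opn G U \<and> opn G V \<and> V \<subseteq> U \<longrightarrow>
      (\<forall>d. \<forall>\<xi>\<in>sec G U d. res G U V \<xi> \<in> sec G V d) \<and>
      (\<forall>d. \<forall>\<xi>\<in>sec G U d. \<forall>\<zeta>\<in>sec G U d. \<forall>c.
         res G U V (c *\<^sub>R \<xi> + \<zeta>) = c *\<^sub>R res G U V \<xi> + res G U V \<zeta>) \<and>
      (\<forall>i j. \<forall>\<xi>\<in>sec G U i. \<forall>\<zeta>\<in>sec G U j. res G U V (\<xi> * \<zeta>) = res G U V \<xi> * res G U V \<zeta>)) \<and>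
    (\<forall>U d. opn G U \<longrightarrow> (\<forall>\<xi>\<in>sec G U d. res G U U \<xi> = \<xi>)) \<and>
    (\<forall>U V W d. opn G U \<and> opn G V \<and> opn G W \<and> W \<subseteq> V \<and> V \<subseteq> U \<longrightarrow>
      (\<forall>\<xi>\<in>sec G U d. res G V W (res G U V \<xi>) = res G U W \<xi>))"

definition sheaf_gluing :: "('m, 'a::real_algebra) gmfd \<Rightarrow> bool"
  where "sheaf_gluing G \<longleftrightarrow> (\<forall>\<U> d. (\<forall>V\<in>\<U>. opn G V) \<longrightarrow>
    (\<forall>\<xi>\<in>sec G (\<Union>\<U>) d. (\<forall>V\<in>\<U>. res G (\<Union>\<U>) V \<xi> = 0) \<longrightarrow> \<xi> = 0) \<and>
    (\<forall>s. (\<forall>V\<in>\<U>. s V \<in> sec G V d) \<and>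
         (\<forall>V\<in>\<U>. \<forall>W\<in>\<U>. res G V (V \<inter> W) (s V) = res G W (V \<inter> W) (s W)) \<longrightarrow>
         (\<exists>\<xi>\<in>sec G (\<Union>\<U>) d. \<forall>V\<in>\<U>. res G (\<Union>\<U>) V \<xi> = s V)))"

text \<open>A unital \<open>C\<^sup>\<infinity>(U)\<close>-algebra structure is a unital homomorphism into the part of degree \<open>0\<close>
  (which is central by graded commutativity).\<close>

definition smooth_algebra_structure :: "('m, 'a::real_algebra) gmfd \<Rightarrow> bool"
  where "smooth_algebra_structure G \<longleftrightarrow> (\<forall>U. opn G U \<longrightarrow>
    (\<forall>d. \<forall>\<xi>\<in>sec G U d. emb G U 1 * \<xi> = \<xi>) \<and>
    (\<forall>c. emb G U (\<lambda>_. c) = c *\<^sub>R emb G U 1) \<and>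
    (\<forall>f\<in>smooth_fun G U. emb G U f \<in> sec G U 0 \<and>
      (\<forall>g\<in>smooth_fun G U.
         emb G U (f + g) = emb G U f + emb G U g \<and>
         emb G U (f * g) = emb G U f * emb G U g \<and>
         ((\<forall>x\<in>U. f x = g x) \<longrightarrow> emb G U f = emb G U g)) \<and>
      (\<forall>V. opn G V \<and> V \<subseteq> U \<longrightarrow> res G U V (emb G U f) = emb G V f)))"

text \<open>An isomorphism of sheaves of graded \<open>C\<^sup>\<infinity>\<close>-algebras over \<open>U\<close> between \<open>G\<close> and the model.\<close>

definition local_trivialization ::
  "('m, 'a::real_algebra) gmfd \<Rightarrow> 'm set \<Rightarrow> ('m set \<Rightarrow> 'a \<Rightarrow> (nat \<Rightarrow> nat) \<Rightarrow> 'm \<Rightarrow> real) \<Rightarrow> bool"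
  where "local_trivialization G U \<Phi> \<longleftrightarrow> (\<forall>W. opn G W \<and> W \<subseteq> U \<longrightarrow>
    (\<forall>d. bij_betw (\<Phi> W) (sec G W d) (model_sec G (vdim G) (vdeg G) W d)) \<and>
    (\<forall>d. \<forall>\<xi>\<in>sec G W d. \<forall>\<zeta>\<in>sec G W d. \<Phi> W (\<xi> + \<zeta>) = \<Phi> W \<xi> + \<Phi> W \<zeta>) \<and>
    (\<forall>i j. \<forall>\<xi>\<in>sec G W i. \<forall>\<zeta>\<in>sec G W j.
       \<Phi> W (\<xi> * \<zeta>) = model_mult (vdim G) (vdeg G) (\<Phi> W \<xi>) (\<Phi> W \<zeta>)) \<and>
    (\<forall>f\<in>smooth_fun G W. \<Phi> W (emb G W f) = model_const W f) \<and>
    (\<forall>W' d. opn G W' \<and> W' \<subseteq> W \<longrightarrow>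
       (\<forall>\<xi>\<in>sec G W d. \<Phi> W' (res G W W' \<xi>) = model_restrict W' (\<Phi> W \<xi>))))"

definition graded_manifold :: "('m, 'a::real_algebra) gmfd \<Rightarrow> bool"
  where "graded_manifold G \<longleftrightarrow>
    smooth_manifold G \<and> graded_comm_algebras G \<and> presheaf G \<and> sheaf_gluing G \<and>
    smooth_algebra_structure G \<and>
    (\<forall>p\<in>topspace (base G). \<exists>U \<Phi>. opn G U \<and> p \<in> U \<and> local_trivialization G U \<Phi>)"


section \<open>Vector fields\<close>

text \<open>
  A vector field of degree \<open>j\<close> over \<open>U\<close> is a derivation of the sheaf over \<open>U\<close>, i.e. a family
  of derivations for the open \<open>V \<subseteq> U\<close> that is compatible with restriction.  It is extended by
  \<open>0\<close>, so that equality of vector fields is equality of functions.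
\<close>

type_synonym ('m, 'a) vf = "'m set \<Rightarrow> 'a \<Rightarrow> 'a"

definition vector_fields :: "('m, 'a::real_algebra) gmfd \<Rightarrow> 'm set \<Rightarrow> int \<Rightarrow> ('m, 'a) vf set"
  where "vector_fields G U j = {X.
    (\<forall>V \<xi>. X V \<xi> \<noteq> 0 \<longrightarrow> opn G V \<and> V \<subseteq> U \<and> (\<exists>i. \<xi> \<in> sec G V i)) \<and>
    (\<forall>V. opn G V \<and> V \<subseteq> U \<longrightarrow>
      (\<forall>i. \<forall>\<xi>\<in>sec G V i. X V \<xi> \<in> sec G V (i + j)) \<and>
      (\<forall>i. \<forall>\<xi>\<in>sec G V i. \<forall>\<zeta>\<in>sec G V i. \<forall>c. X V (c *\<^sub>R \<xi> + \<zeta>) = c *\<^sub>R X V \<xi> + X V \<zeta>) \<and>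
      (\<forall>i i'. \<forall>\<xi>\<in>sec G V i. \<forall>\<zeta>\<in>sec G V i'.
         X V (\<xi> * \<zeta>) = X V \<xi> * \<zeta> + kos (j * i) (\<xi> * X V \<zeta>)) \<and>
      (\<forall>W i. opn G W \<and> W \<subseteq> V \<longrightarrow>
         (\<forall>\<xi>\<in>sec G V i. res G V W (X V \<xi>) = X W (res G V W \<xi>))))}"

definition vf_restrict :: "'m set \<Rightarrow> ('m, 'a::real_algebra) vf \<Rightarrow> ('m, 'a) vf"
  where "vf_restrict W X = (\<lambda>V \<xi>. if V \<subseteq> W then X V \<xi> else 0)"

definition vf_smul ::
  "('m, 'a::real_algebra) gmfd \<Rightarrow> 'm set \<Rightarrow> 'a \<Rightarrow> ('m, 'a) vf \<Rightarrow> ('m, 'a) vf"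
  where "vf_smul G U f X = (\<lambda>V \<xi>. res G U V f * X V \<xi>)"

text \<open>Graded commutator of fields of degrees \<open>i\<close> and \<open>j\<close>.\<close>

definition vf_bracket ::
  "int \<Rightarrow> int \<Rightarrow> ('m, 'a::real_algebra) vf \<Rightarrow> ('m, 'a) vf \<Rightarrow> ('m, 'a) vf"
  where "vf_bracket i j X Y = (\<lambda>V \<xi>. X V (Y V \<xi>) - kos (i * j) (Y V (X V \<xi>)))"

definition homological :: "('m, 'a::real_algebra) gmfd \<Rightarrow> ('m, 'a) vf \<Rightarrow> bool"
  where "homological G Q \<longleftrightarrow> Q \<in> vector_fields G (topspace (base G)) 1 \<and>
    (\<forall>U i. opn G U \<longrightarrow> (\<forall>\<xi>\<in>sec G U i. Q U (Q U \<xi>) = 0))"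

definition lie_vf :: "('m, 'a::real_algebra) vf \<Rightarrow> 'm set \<Rightarrow> int \<Rightarrow> ('m, 'a) vf \<Rightarrow> ('m, 'a) vf"
  where "lie_vf Q U j X = vf_bracket 1 j Q X"


section \<open>Poisson brackets\<close>

definition poisson_bracket ::
  "('m, 'a::real_algebra) gmfd \<Rightarrow> int \<Rightarrow> ('m set \<Rightarrow> 'a \<Rightarrow> 'a \<Rightarrow> 'a) \<Rightarrow> bool"
  where "poisson_bracket G k B \<longleftrightarrow> (\<forall>U. opn G U \<longrightarrow>
    (\<forall>i j. \<forall>\<xi>\<in>sec G U i. \<forall>\<zeta>\<in>sec G U j. B U \<xi> \<zeta> \<in> sec G U (i + j + k)) \<and>
    (\<forall>i j. \<forall>\<xi>\<in>sec G U i. \<forall>\<xi>'\<in>sec G U i. \<forall>\<zeta>\<in>sec G U j. \<forall>c.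
       B U (c *\<^sub>R \<xi> + \<xi>') \<zeta> = c *\<^sub>R B U \<xi> \<zeta> + B U \<xi>' \<zeta>) \<and>
    (\<forall>i j. \<forall>\<xi>\<in>sec G U i. \<forall>\<zeta>\<in>sec G U j. \<forall>\<zeta>'\<in>sec G U j. \<forall>c.
       B U \<xi> (c *\<^sub>R \<zeta> + \<zeta>') = c *\<^sub>R B U \<xi> \<zeta> + B U \<xi> \<zeta>') \<and>
    (\<forall>V i j. opn G V \<and> V \<subseteq> U \<longrightarrow> (\<forall>\<xi>\<in>sec G U i. \<forall>\<zeta>\<in>sec G U j.
       res G U V (B U \<xi> \<zeta>) = B V (res G U V \<xi>) (res G U V \<zeta>))) \<and>
    (\<forall>i\<^sub>1 i\<^sub>2. \<forall>\<xi>\<^sub>1\<in>sec G U i\<^sub>1. \<forall>\<xi>\<^sub>2\<in>sec G U i\<^sub>2.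
       B U \<xi>\<^sub>1 \<xi>\<^sub>2 = - kos ((i\<^sub>1 + k) * (i\<^sub>2 + k)) (B U \<xi>\<^sub>2 \<xi>\<^sub>1)) \<and>
    (\<forall>i\<^sub>1 i\<^sub>2 i\<^sub>3. \<forall>\<xi>\<^sub>1\<in>sec G U i\<^sub>1. \<forall>\<xi>\<^sub>2\<in>sec G U i\<^sub>2. \<forall>\<xi>\<^sub>3\<in>sec G U i\<^sub>3.
       B U \<xi>\<^sub>1 (\<xi>\<^sub>2 * \<xi>\<^sub>3) = B U \<xi>\<^sub>1 \<xi>\<^sub>2 * \<xi>\<^sub>3 + kos ((i\<^sub>1 + k) * i\<^sub>2) (\<xi>\<^sub>2 * B U \<xi>\<^sub>1 \<xi>\<^sub>3)) \<and>
    (\<forall>i\<^sub>1 i\<^sub>2 i\<^sub>3. \<forall>\<xi>\<^sub>1\<in>sec G U i\<^sub>1. \<forall>\<xi>\<^sub>2\<in>sec G U i\<^sub>2. \<forall>\<xi>\<^sub>3\<in>sec G U i\<^sub>3.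
       B U \<xi>\<^sub>1 (B U \<xi>\<^sub>2 \<xi>\<^sub>3) =
         B U (B U \<xi>\<^sub>1 \<xi>\<^sub>2) \<xi>\<^sub>3 + kos ((i\<^sub>1 + k) * (i\<^sub>2 + k)) (B U \<xi>\<^sub>2 (B U \<xi>\<^sub>1 \<xi>\<^sub>3))))"

definition hamiltonian ::
  "('m, 'a::real_algebra) gmfd \<Rightarrow> ('m set \<Rightarrow> 'a \<Rightarrow> 'a \<Rightarrow> 'a) \<Rightarrow> 'm set \<Rightarrow> 'a \<Rightarrow> ('m, 'a) vf"
  where "hamiltonian G B U \<xi> = (\<lambda>V \<zeta>.
    if opn G V \<and> V \<subseteq> U \<and> (\<exists>i. \<zeta> \<in> sec G V i) then B V (res G U V \<xi>) \<zeta> else 0)"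

text \<open>The Hamiltonian vector fields generate the sheaf of vector fields as a module.\<close>

definition symplectic_bracket ::
  "('m, 'a::real_algebra) gmfd \<Rightarrow> int \<Rightarrow> ('m set \<Rightarrow> 'a \<Rightarrow> 'a \<Rightarrow> 'a) \<Rightarrow> bool"
  where "symplectic_bracket G k B \<longleftrightarrow>
    (\<forall>U j. opn G U \<longrightarrow> (\<forall>X\<in>vector_fields G U j. \<forall>p\<in>U.
      \<exists>V n a f z. opn G V \<and> p \<in> V \<and> V \<subseteq> U \<and>
        (\<forall>l<n. f l \<in> sec G V (a l) \<and> z l \<in> sec G V (j - a l - k)) \<and>
        vf_restrict V X = (\<Sum>l<(n::nat). vf_smul G V (f l) (hamiltonian G B V (z l)))))"

definition PQ_manifold ::
  "('m, 'a::real_algebra) gmfd \<Rightarrow> ('m, 'a) vf \<Rightarrow> int \<Rightarrow> ('m set \<Rightarrow> 'a \<Rightarrow> 'a \<Rightarrow> 'a) \<Rightarrow> bool"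
  where "PQ_manifold G Q k B \<longleftrightarrow>
    graded_manifold G \<and> homological G Q \<and> poisson_bracket G k B \<and>
    (\<forall>U i j. opn G U \<longrightarrow> (\<forall>\<xi>\<in>sec G U i. \<forall>\<zeta>\<in>sec G U j.
      Q U (B U \<xi> \<zeta>) = B U (Q U \<xi>) \<zeta> + kos (i + k) (B U \<xi> (Q U \<zeta>))))"

definition symplectic_PQ_manifold ::
  "('m, 'a::real_algebra) gmfd \<Rightarrow> ('m, 'a) vf \<Rightarrow> int \<Rightarrow> ('m set \<Rightarrow> 'a \<Rightarrow> 'a \<Rightarrow> 'a) \<Rightarrow> bool"
  where "symplectic_PQ_manifold G Q k B \<longleftrightarrow> PQ_manifold G Q k B \<and> symplectic_bracket G k B"


section \<open>One-forms\<close>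

text \<open>
  A \<open>1\<close>-form \<open>\<eta>\<close> over \<open>U\<close> is encoded by its contractions: \<open>\<eta> V j X\<close> is the contraction of \<open>\<eta>\<close> with
  the vector field \<open>X\<close> of degree \<open>j\<close> over \<open>V \<subseteq> U\<close>.  Thus \<open>d\<xi>\<close> sends \<open>X\<close> to \<open>X(\<xi>)\<close>, and as
  contraction with \<open>X\<close> has degree \<open>|X| - 1\<close>, the form \<open>f \<eta>\<close> sends \<open>X\<close> to
  \<open>(-1)\<^bsup>|f|(|X|+1)\<^esup> f \<eta>(X)\<close>.  (The abstract Kaehler differentials of the algebras of sections
  would be too large: they do not satisfy the chain rule for smooth functions.)

  Degrees of forms are those induced by the algebra, i.e. \<open>d\<xi>\<close> is placed in degree \<open>|\<xi>|\<close>; the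
  additional \<open>1\<close> contributed by the symbol \<open>d\<close> enters the commutation sign in \<open>form_rmul\<close>.
\<close>

type_synonym ('m, 'a) form = "'m set \<Rightarrow> int \<Rightarrow> ('m, 'a) vf \<Rightarrow> 'a"

definition dform :: "('m, 'a::real_algebra) gmfd \<Rightarrow> 'm set \<Rightarrow> 'a \<Rightarrow> ('m, 'a) form"
  where "dform G U \<xi> = (\<lambda>V j X.
    if opn G V \<and> V \<subseteq> U \<and> X \<in> vector_fields G V j then X V (res G U V \<xi>) else 0)"

definition form_restrict :: "'m set \<Rightarrow> ('m, 'a::real_algebra) form \<Rightarrow> ('m, 'a) form"
  where "form_restrict W \<eta> = (\<lambda>V j X. if V \<subseteq> W then \<eta> V j X else 0)"

definition form_smul ::
  "('m, 'a::real_algebra) gmfd \<Rightarrow> 'm set \<Rightarrow> int \<Rightarrow> 'a \<Rightarrow> ('m, 'a) form \<Rightarrow> ('m, 'a) form"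
  where "form_smul G U i f \<eta> = (\<lambda>V j X. kos (i * (j + 1)) (res G U V f * \<eta> V j X))"

text \<open>The expressions \<open>\<Sum> f\<^sub>l dz\<^sub>l\<close> of degree \<open>e\<close> over \<open>U\<close>, where \<open>a l\<close> is the degree of \<open>f\<^sub>l\<close>.\<close>

definition form_terms ::
  "('m, 'a::real_algebra) gmfd \<Rightarrow> 'm set \<Rightarrow> int \<Rightarrow> nat \<Rightarrow> (nat \<Rightarrow> int) \<Rightarrow> (nat \<Rightarrow> 'a) \<Rightarrow> (nat \<Rightarrow> 'a)
    \<Rightarrow> bool"
  where "form_terms G U e n a f z \<longleftrightarrow>
    (\<forall>l<n. f l \<in> sec G U (a l) \<and> z l \<in> sec G U (e - a l))"

definition form_comb ::
  "('m, 'a::real_algebra) gmfd \<Rightarrow> 'm set \<Rightarrow> nat \<Rightarrow> (nat \<Rightarrow> int) \<Rightarrow> (nat \<Rightarrow> 'a) \<Rightarrow> (nat \<Rightarrow> 'a)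
    \<Rightarrow> ('m, 'a) form"
  where "form_comb G U n a f z = (\<Sum>l<n. form_smul G U (a l) (f l) (dform G U (z l)))"

text \<open>The sheaf of \<open>1\<close>-forms is generated by the \<open>d\<xi>\<close>.\<close>

definition one_forms :: "('m, 'a::real_algebra) gmfd \<Rightarrow> 'm set \<Rightarrow> int \<Rightarrow> ('m, 'a) form set"
  where "one_forms G U e = {\<eta>.
    (\<forall>V j X. \<eta> V j X \<noteq> 0 \<longrightarrow> opn G V \<and> V \<subseteq> U \<and> X \<in> vector_fields G V j) \<and>
    (\<forall>V j. opn G V \<and> V \<subseteq> U \<longrightarrow> (\<forall>X\<in>vector_fields G V j.
      \<eta> V j X \<in> sec G V (e + j) \<and>
      (\<forall>W. opn G W \<and> W \<subseteq> V \<longrightarrow> res G V W (\<eta> V j X) = \<eta> W j (vf_restrict W X)))) \<and>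
    (\<forall>p\<in>U. \<exists>V n a f z. opn G V \<and> p \<in> V \<and> V \<subseteq> U \<and> form_terms G V e n a f z \<and>
      form_restrict V \<eta> = form_comb G V n a f z)}"

text \<open>The operator determined by \<open>d\<xi> \<mapsto> - d(Q \<xi>)\<close> and \<open>f \<eta> \<mapsto> Q(f) \<eta> + (-1)\<^bsup>|f|\<^esup> f \<pounds>\<^sub>Q \<eta>\<close>.\<close>

definition lie_form ::
  "('m, 'a::real_algebra) gmfd \<Rightarrow> ('m, 'a) vf \<Rightarrow> 'm set \<Rightarrow> int \<Rightarrow> ('m, 'a) form \<Rightarrow> ('m, 'a) form"
  where "lie_form G Q U e \<eta> = (THE \<theta>. \<theta> \<in> one_forms G U (e + 1) \<and>
    (\<forall>V n a f z. opn G V \<and> V \<subseteq> U \<and> form_terms G V e n a f z \<and>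
        form_restrict V \<eta> = form_comb G V n a f z \<longrightarrow>
      form_restrict V \<theta> = (\<Sum>l<n. form_smul G V (a l + 1) (Q V (f l)) (dform G V (z l)) +
        kos (a l) (form_smul G V (a l) (f l) (- dform G V (Q V (z l)))))))"

text \<open>The map determined by \<open>f d\<xi> \<mapsto> (-1)\<^bsup>|f|\<^esup> f {\<xi>, \<cdot>}\<close>.  The rule for right multiples
  is a consequence of this one.\<close>

definition pi_sharp ::
  "('m, 'a::real_algebra) gmfd \<Rightarrow> int \<Rightarrow> ('m set \<Rightarrow> 'a \<Rightarrow> 'a \<Rightarrow> 'a)
    \<Rightarrow> 'm set \<Rightarrow> int \<Rightarrow> ('m, 'a) form \<Rightarrow> ('m, 'a) vf"
  where "pi_sharp G k B U e \<eta> = (THE X. X \<in> vector_fields G U (e + k) \<and>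
    (\<forall>V n a f z. opn G V \<and> V \<subseteq> U \<and> form_terms G V e n a f z \<and>
        form_restrict V \<eta> = form_comb G V n a f z \<longrightarrow>
      vf_restrict V X = (\<Sum>l<n. kos (a l) (vf_smul G V (f l) (hamiltonian G B V (z l))))))"


section \<open>Differential graded modules\<close>

text \<open>
  \<open>lmul E U i f x\<close> is the product \<open>f x\<close> for \<open>|f| = i\<close>, and \<open>rmul E U d i x f\<close> is \<open>x f\<close> for
  \<open>|x| = d\<close>, \<open>|f| = i\<close>.
\<close>

record ('m, 'a, 'b) gmodule =
  msec :: "'m set \<Rightarrow> int \<Rightarrow> 'b set"
  mres :: "'m set \<Rightarrow> 'b \<Rightarrow> 'b"
  lmul :: "'m set \<Rightarrow> int \<Rightarrow> 'a \<Rightarrow> 'b \<Rightarrow> 'b"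
  rmul :: "'m set \<Rightarrow> int \<Rightarrow> int \<Rightarrow> 'b \<Rightarrow> 'a \<Rightarrow> 'b"

definition form_module :: "('m, 'a::real_algebra) gmfd \<Rightarrow> ('m, 'a, ('m, 'a) form) gmodule"
  where "form_module G = \<lparr> msec = one_forms G, mres = form_restrict, lmul = form_smul G,
    rmul = (\<lambda>U e i \<eta> f. kos ((e + 1) * i) (form_smul G U i f \<eta>)) \<rparr>"

text \<open>The right multiplication \<open>X f = (-1)\<^bsup>|f|(|X|+1-k)\<^esup> f X\<close> depends on the degree \<open>k\<close> of the
  bracket.\<close>

definition vf_module :: "('m, 'a::real_algebra) gmfd \<Rightarrow> int \<Rightarrow> ('m, 'a, ('m, 'a) vf) gmodule"
  where "vf_module G k = \<lparr> msec = vector_fields G, mres = vf_restrict,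
    lmul = (\<lambda>U i f X. vf_smul G U f X),
    rmul = (\<lambda>U j i X f. kos (i * (j + 1 - k)) (vf_smul G U f X)) \<rparr>"

definition differential ::
  "('m, 'a::real_algebra) gmfd \<Rightarrow> ('m, 'a, 'b::ab_group_add) gmodule
    \<Rightarrow> ('m set \<Rightarrow> int \<Rightarrow> 'b \<Rightarrow> 'b) \<Rightarrow> bool"
  where "differential G E D \<longleftrightarrow> (\<forall>U d. opn G U \<longrightarrow> (\<forall>x\<in>msec E U d.
    D U d x \<in> msec E U (d + 1) \<and>
    (\<forall>y\<in>msec E U d. D U d (x + y) = D U d x + D U d y) \<and>
    (\<forall>V. opn G V \<and> V \<subseteq> U \<longrightarrow> mres E V (D U d x) = D V d (mres E V x)) \<and>
    D U (d + 1) (D U d x) = 0))"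

definition left_dg_module ::
  "('m, 'a::real_algebra) gmfd \<Rightarrow> ('m, 'a) vf \<Rightarrow> ('m, 'a, 'b::ab_group_add) gmodule
    \<Rightarrow> ('m set \<Rightarrow> int \<Rightarrow> 'b \<Rightarrow> 'b) \<Rightarrow> bool"
  where "left_dg_module G Q E D \<longleftrightarrow> differential G E D \<and>
    (\<forall>U i d. opn G U \<longrightarrow> (\<forall>f\<in>sec G U i. \<forall>x\<in>msec E U d.
      D U (i + d) (lmul E U i f x) =
        lmul E U (i + 1) (Q U f) x + kos i (lmul E U i f (D U d x))))"

text \<open>The Leibniz rule of a right module is \<open>D(x f) = D(x) f + (-1)\<^bsup>|x|+s\<^esup> x Q(f)\<close>, where \<open>s\<close> is
  the degree shift of the module.\<close>

definition right_dg_module ::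
  "('m, 'a::real_algebra) gmfd \<Rightarrow> ('m, 'a) vf \<Rightarrow> int \<Rightarrow> ('m, 'a, 'b::ab_group_add) gmodule
    \<Rightarrow> ('m set \<Rightarrow> int \<Rightarrow> 'b \<Rightarrow> 'b) \<Rightarrow> bool"
  where "right_dg_module G Q s E D \<longleftrightarrow> differential G E D \<and>
    (\<forall>U i d. opn G U \<longrightarrow> (\<forall>f\<in>sec G U i. \<forall>x\<in>msec E U d.
      D U (d + i) (rmul E U d i x f) =
        rmul E U (d + 1) i (D U d x) f + kos (d + s) (rmul E U d (i + 1) x (Q U f))))"

text \<open>Bijective maps of sheaves of degree \<open>k\<close>.\<close>

definition graded_bijection ::
  "('m, 'a::real_algebra) gmfd \<Rightarrow> int \<Rightarrow> ('m, 'a, 'b) gmodule \<Rightarrow> ('m, 'a, 'c) gmodule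
    \<Rightarrow> ('m set \<Rightarrow> int \<Rightarrow> 'b \<Rightarrow> 'c) \<Rightarrow> bool"
  where "graded_bijection G k E F \<phi> \<longleftrightarrow>
    (\<forall>U d. opn G U \<longrightarrow> bij_betw (\<phi> U d) (msec E U d) (msec F U (d + k)))"

definition graded_additive ::
  "('m, 'a::real_algebra) gmfd \<Rightarrow> int \<Rightarrow> ('m, 'a, 'b::ab_group_add) gmodule
    \<Rightarrow> ('m, 'a, 'c::ab_group_add) gmodule \<Rightarrow> ('m set \<Rightarrow> int \<Rightarrow> 'b \<Rightarrow> 'c) \<Rightarrow> bool"
  where "graded_additive G k E F \<phi> \<longleftrightarrow> (\<forall>U d. opn G U \<longrightarrow> (\<forall>x\<in>msec E U d.
    \<phi> U d x \<in> msec F U (d + k) \<and>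
    (\<forall>y\<in>msec E U d. \<phi> U d (x + y) = \<phi> U d x + \<phi> U d y) \<and>
    (\<forall>V. opn G V \<and> V \<subseteq> U \<longrightarrow> mres F V (\<phi> U d x) = \<phi> V d (mres E V x))))"

text \<open>
  Linearity carries the signs of \<open>\<pi>\<^sup>\<sharp>\<close>: \<open>\<phi>(f x) = (-1)\<^bsup>|f|\<^esup> f \<phi>(x)\<close> for left modules and
  \<open>\<phi>(x f) = (-1)\<^bsup>|f|\<^esup> \<phi>(x) f\<close> for right modules.  An anti-isomorphism anticommutes with the
  differentials.
\<close>

definition left_dg_anti_isomorphism ::
  "('m, 'a::real_algebra) gmfd \<Rightarrow> ('m, 'a) vf \<Rightarrow> int
    \<Rightarrow> ('m, 'a, 'b::ab_group_add) gmodule \<Rightarrow> ('m set \<Rightarrow> int \<Rightarrow> 'b \<Rightarrow> 'b)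
    \<Rightarrow> ('m, 'a, 'c::ab_group_add) gmodule \<Rightarrow> ('m set \<Rightarrow> int \<Rightarrow> 'c \<Rightarrow> 'c)
    \<Rightarrow> ('m set \<Rightarrow> int \<Rightarrow> 'b \<Rightarrow> 'c) \<Rightarrow> bool"
  where "left_dg_anti_isomorphism G Q k E D F D' \<phi> \<longleftrightarrow>
    left_dg_module G Q E D \<and> left_dg_module G Q F D' \<and>
    graded_additive G k E F \<phi> \<and> graded_bijection G k E F \<phi> \<and>
    (\<forall>U i d. opn G U \<longrightarrow> (\<forall>f\<in>sec G U i. \<forall>x\<in>msec E U d.
      \<phi> U (i + d) (lmul E U i f x) = kos i (lmul F U i f (\<phi> U d x)))) \<and>
    (\<forall>U d. opn G U \<longrightarrow> (\<forall>x\<in>msec E U d. \<phi> U (d + 1) (D U d x) = - D' U (d + k) (\<phi> U d x)))"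

definition right_dg_isomorphism ::
  "('m, 'a::real_algebra) gmfd \<Rightarrow> ('m, 'a) vf \<Rightarrow> int
    \<Rightarrow> int \<Rightarrow> ('m, 'a, 'b::ab_group_add) gmodule \<Rightarrow> ('m set \<Rightarrow> int \<Rightarrow> 'b \<Rightarrow> 'b)
    \<Rightarrow> int \<Rightarrow> ('m, 'a, 'c::ab_group_add) gmodule \<Rightarrow> ('m set \<Rightarrow> int \<Rightarrow> 'c \<Rightarrow> 'c)
    \<Rightarrow> ('m set \<Rightarrow> int \<Rightarrow> 'b \<Rightarrow> 'c) \<Rightarrow> bool"
  where "right_dg_isomorphism G Q k s E D t F D' \<phi> \<longleftrightarrow>
    right_dg_module G Q s E D \<and> right_dg_module G Q t F D' \<and>
    graded_additive G k E F \<phi> \<and> graded_bijection G k E F \<phi> \<and>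
    (\<forall>U i d. opn G U \<longrightarrow> (\<forall>f\<in>sec G U i. \<forall>x\<in>msec E U d.
      \<phi> U (d + i) (rmul E U d i x f) = kos i (rmul F U (d + k) i (\<phi> U d x) f))) \<and>
    (\<forall>U d. opn G U \<longrightarrow> (\<forall>x\<in>msec E U d. \<phi> U (d + 1) (D U d x) = D' U (d + k) (\<phi> U d x)))"

end

theory Submission
  imports Defs
begin

text \<open>
  No local coordinates are needed, because both operators on one-forms have closed formulas in terms
  of contractions.  By Cartan's formula,
  \<open>(\<pounds>\<^sub>Q \<eta>)(X) = (-1)\<^bsup>|X|\<^esup> (\<eta>([Q, X]) - Q(\<eta>(X)))\<close>, and by skew symmetry of the bracket
  \<open>\<pi>\<^sup>\<sharp>(\<eta>)(\<zeta>) = -(-1)\<^bsup>(|\<eta>|+k)(|\<zeta>|+k)\<^esup> \<eta>(X\<^sub>\<zeta>)\<close>, where \<open>X\<^sub>\<zeta>\<close> is the Hamiltonian vector field.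
  As \<open>\<eta>(f X) = f \<eta>(X)\<close>, a form that vanishes on generators of the vector fields is \<open>0\<close>; so \<open>\<pi>\<^sup>\<sharp>\<close> is
  injective if the bracket is symplectic, and the local preimages that generation provides then
  glue.  Finally \<open>\<pi>\<^sup>\<sharp> \<circ> \<pounds>\<^sub>Q = -\<pounds>\<^sub>Q \<circ> \<pi>\<^sup>\<sharp>\<close> holds at \<open>\<eta>\<close> iff \<open>\<eta>([Q, X\<^sub>\<zeta>]) = \<eta>(X\<^bsub>Q\<zeta>\<^esub>)\<close> for all
  \<open>\<zeta>\<close>, and \<open>[Q, X\<^sub>\<zeta>] = X\<^bsub>Q\<zeta>\<^esub>\<close> is the compatibility of \<open>Q\<close> with the bracket.
\<close>

text \<open>The obstacle is that \<open>lie_form\<close> and \<open>pi_sharp\<close> are definite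
  descriptions that quantify over all presentations of a form as \<Sum> f dz. Such presentations
  exist only locally and are far from unique, so building the operators from them would require
  independence of the choice and a gluing argument. The closed formulas avoid both: they mention
  only the contractions of the form and are therefore global, and that they obey the prescribed rule
  for every presentation is a termwise sign computation. Uniqueness in the descriptions is then
  locality of the sheaves.

  The three characterisations collapse to the last one because both modules are differential graded,
  and \<open>pi_sharp\<close> is linear, for every homological field and every Poisson bracket; only
  bijectivity and anticommutation relate the two structures. Generation follows from surjectivity
  because the image of a local \<Sum> f dz is the sum of the (-1)^|f| f X_z. All signs depend on
  parities of degrees only, so each sign identity is settled by splitting on the parities
  involved.\<close>

section \<open>Calculus of the Koszul sign\<close>

lemma kos_kos: "kos i (kos j x) = kos (i + j) x"
  by (simp add: kos_def)

lemma kos_add: "kos i (x + y) = kos i x + kos i y"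
  by (simp add: kos_def)

lemma kos_diff: "kos i (x - y) = kos i x - kos i y"
  by (simp add: kos_def)

lemma kos_minus: "kos i (- x) = - kos i x"
  by (simp add: kos_def)

lemma kos_zero [simp]: "kos i 0 = 0"
  by (simp add: kos_def)

lemma kos_mult_left: "kos i x * y = kos i (x * y)" for x y :: "'a::ring"
  by (simp add: kos_def)

lemma kos_mult_right: "x * kos i y = kos i (x * y)" for x y :: "'a::ring"
  by (simp add: kos_def)

lemma kos_scaleR: "c *\<^sub>R kos i x = kos i (c *\<^sub>R x)" for x :: "'a::real_vector"
  by (simp add: kos_def)

lemma kos_sum: "kos i (sum f A) = (\<Sum>x\<in>A. kos i (f x))"
  by (simp add: kos_def sum_negf)

lemma kos_cong: "even (i - j) \<Longrightarrow> kos i x = kos j x"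
  by (auto simp: kos_def)

lemma kos_even: "even i \<Longrightarrow> kos i x = x"
  by (simp add: kos_def)

lemma kos_apply: "kos i f x = kos i (f x)"
  by (simp add: kos_def)

lemma sum_apply1: "(\<Sum>l\<in>A. F l) x = (\<Sum>l\<in>A. F l x)"
  by (induction A rule: infinite_finite_induct) auto

section \<open>Sections and vector fields\<close>

locale graded_sheaf =
  fixes G :: "('m, 'a::real_algebra) gmfd"
  assumes algs: "graded_comm_algebras G"
    and pre: "presheaf G"
    and glue: "sheaf_gluing G"
begin

lemma opn_Int: "opn G U \<Longrightarrow> opn G V \<Longrightarrow> opn G (U \<inter> V)"
  by (simp add: opn_def openin_Int)

lemma sec_subspace: "opn G U \<Longrightarrow> subspace (sec G U d)"
  using algs[unfolded graded_comm_algebras_def, rule_format, of U] by simp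

lemma sec_zero: "opn G U \<Longrightarrow> 0 \<in> sec G U d"
  by (simp add: sec_subspace subspace_0)

lemma sec_add: "opn G U \<Longrightarrow> x \<in> sec G U d \<Longrightarrow> y \<in> sec G U d \<Longrightarrow> x + y \<in> sec G U d"
  by (simp add: sec_subspace subspace_add)

lemma sec_diff: "opn G U \<Longrightarrow> x \<in> sec G U d \<Longrightarrow> y \<in> sec G U d \<Longrightarrow> x - y \<in> sec G U d"
  by (simp add: sec_subspace subspace_diff)

lemma sec_scaleR: "opn G U \<Longrightarrow> x \<in> sec G U d \<Longrightarrow> c *\<^sub>R x \<in> sec G U d"
  by (simp add: sec_subspace subspace_scale)

lemma sec_minus: "opn G U \<Longrightarrow> x \<in> sec G U d \<Longrightarrow> - x \<in> sec G U d"
  by (simp add: sec_subspace subspace_neg)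

lemma sec_kos: "opn G U \<Longrightarrow> x \<in> sec G U d \<Longrightarrow> kos i x \<in> sec G U d"
  by (simp add: kos_def sec_minus)

lemma sec_sum: "opn G U \<Longrightarrow> (\<And>l. l \<in> A \<Longrightarrow> f l \<in> sec G U d) \<Longrightarrow> sum f A \<in> sec G U d"
  by (simp add: sec_subspace subspace_sum)

lemma sec_mult: "opn G U \<Longrightarrow> x \<in> sec G U i \<Longrightarrow> y \<in> sec G U j \<Longrightarrow> x * y \<in> sec G U (i + j)"
  by (rule algs[unfolded graded_comm_algebras_def, rule_format, THEN conjunct2, THEN conjunct2,
      rule_format, THEN conjunct1])

lemma sec_comm:
  "opn G U \<Longrightarrow> x \<in> sec G U i \<Longrightarrow> y \<in> sec G U j \<Longrightarrow> x * y = kos (i * j) (y * x)"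
  by (rule algs[unfolded graded_comm_algebras_def, rule_format, THEN conjunct2, THEN conjunct2,
      rule_format, THEN conjunct2])

text \<open>The homogeneous parts of one open set are independent; this is applied to
  \<open>x\<close> placed in degree \<open>i\<close> and \<open>- x\<close> placed in degree
  \<open>j\<close>. It allows a degree to be recovered from a nonzero section.\<close>

lemma sec_degree_unique:
  assumes "opn G U" "x \<in> sec G U i" "x \<in> sec G U j" "x \<noteq> 0"
  shows "i = j"
proof (rule ccontr)
  assume ij: "i \<noteq> j"
  let ?f = "\<lambda>d. if d = i then x else - x"
  have "(\<Sum>d\<in>{i, j}. ?f d) = 0"
    using ij by simp
  moreover have "\<forall>d\<in>{i, j}. ?f d \<in> sec G U d"
    using assms ij by (auto simp: sec_minus)
  ultimately have "finite {i, j} \<and> (\<forall>d\<in>{i, j}. ?f d \<in> sec G U d) \<and> (\<Sum>d\<in>{i, j}. ?f d) = 0"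
    by simp
  from algs[unfolded graded_comm_algebras_def, rule_format, OF assms(1), THEN conjunct2,
      THEN conjunct1, rule_format, OF this, of i]
  show False
    using assms by simp
qed

section \<open>Restriction of sections and locality\<close>

lemma res_sec: "opn G U \<Longrightarrow> opn G V \<Longrightarrow> V \<subseteq> U \<Longrightarrow> x \<in> sec G U d \<Longrightarrow> res G U V x \<in> sec G V d"
  using pre[unfolded presheaf_def, THEN conjunct1, rule_format, of U V, THEN conjunct1, rule_format] by blast

lemma res_lin:
  "opn G U \<Longrightarrow> opn G V \<Longrightarrow> V \<subseteq> U \<Longrightarrow> x \<in> sec G U d \<Longrightarrow> y \<in> sec G U d \<Longrightarrow>
    res G U V (c *\<^sub>R x + y) = c *\<^sub>R res G U V x + res G U V y"
  using pre[unfolded presheaf_def, THEN conjunct1, rule_format, of U V, THEN conjunct2, THEN conjunct1, rule_format] by blast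

lemma res_mult:
  "opn G U \<Longrightarrow> opn G V \<Longrightarrow> V \<subseteq> U \<Longrightarrow> x \<in> sec G U i \<Longrightarrow> y \<in> sec G U j \<Longrightarrow>
    res G U V (x * y) = res G U V x * res G U V y"
  using pre[unfolded presheaf_def, THEN conjunct1, rule_format, of U V, THEN conjunct2, THEN conjunct2, rule_format] by blast

lemma res_id: "opn G U \<Longrightarrow> x \<in> sec G U d \<Longrightarrow> res G U U x = x"
  using pre[unfolded presheaf_def, THEN conjunct2, THEN conjunct1, rule_format] by blast

lemma res_res:
  "opn G U \<Longrightarrow> opn G V \<Longrightarrow> opn G W \<Longrightarrow> W \<subseteq> V \<Longrightarrow> V \<subseteq> U \<Longrightarrow> x \<in> sec G U d \<Longrightarrow>
    res G V W (res G U V x) = res G U W x"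
  using pre[unfolded presheaf_def, THEN conjunct2, THEN conjunct2, rule_format, of U V W] by blast

lemma res_add:
  "opn G U \<Longrightarrow> opn G V \<Longrightarrow> V \<subseteq> U \<Longrightarrow> x \<in> sec G U d \<Longrightarrow> y \<in> sec G U d \<Longrightarrow>
    res G U V (x + y) = res G U V x + res G U V y"
  using res_lin[of U V x d y 1] by simp

text \<open>Additivity at 0 + 0. As 0 lies in every homogeneous part, \<open>undefined\<close>
  serves as an arbitrary degree.\<close>

lemma res_zero: "opn G U \<Longrightarrow> opn G V \<Longrightarrow> V \<subseteq> U \<Longrightarrow> res G U V 0 = 0"
  using res_add[of U V 0 undefined 0] by (simp add: sec_zero)

lemma res_minus:
  "opn G U \<Longrightarrow> opn G V \<Longrightarrow> V \<subseteq> U \<Longrightarrow> x \<in> sec G U d \<Longrightarrow> res G U V (- x) = - res G U V x"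
  using res_lin[of U V x d 0 "- 1"] by (simp add: sec_zero res_zero)

lemma res_diff:
  "opn G U \<Longrightarrow> opn G V \<Longrightarrow> V \<subseteq> U \<Longrightarrow> x \<in> sec G U d \<Longrightarrow> y \<in> sec G U d \<Longrightarrow>
    res G U V (x - y) = res G U V x - res G U V y"
  using res_add[of U V x d "- y"] by (simp add: sec_minus res_minus)

lemma res_kos:
  "opn G U \<Longrightarrow> opn G V \<Longrightarrow> V \<subseteq> U \<Longrightarrow> x \<in> sec G U d \<Longrightarrow> res G U V (kos i x) = kos i (res G U V x)"
  by (simp add: kos_def res_minus)

lemma res_sum:
  assumes V: "opn G U" "opn G V" "V \<subseteq> U" and F: "\<And>l. l \<in> A \<Longrightarrow> F l \<in> sec G U d"
  shows "res G U V (sum F A) = (\<Sum>l\<in>A. res G U V (F l))"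
  using F
proof (induction A rule: infinite_finite_induct)
  case (insert x A)
  then show ?case
    using res_add[OF V, of "F x" d "sum F A"] sec_sum[OF V(1), of A F d] by simp
qed (simp_all add: res_zero V)

text \<open>Locality of the sheaf for the difference \<open>x - y\<close>. The cover consists of all
  open sets on which the two restrictions agree, which avoids choosing a neighbourhood for each
  point.\<close>

lemma sec_eqI:
  assumes U: "opn G U" and xy: "x \<in> sec G U d" "y \<in> sec G U d"
    and loc: "\<And>p. p \<in> U \<Longrightarrow> \<exists>V. opn G V \<and> p \<in> V \<and> V \<subseteq> U \<and> res G U V x = res G U V y"
  shows "x = y"
proof -
  let ?C = "{V. opn G V \<and> V \<subseteq> U \<and> res G U V x = res G U V y}"
  have UC: "\<Union> ?C = U"
    using loc by blast
  have "\<forall>V\<in>?C. opn G V"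
    by blast
  from glue[unfolded sheaf_gluing_def, rule_format, OF this[rule_format], THEN conjunct1]
  have "\<forall>\<xi>\<in>sec G (\<Union> ?C) d. (\<forall>V\<in>?C. res G (\<Union> ?C) V \<xi> = 0) \<longrightarrow> \<xi> = 0" .
  moreover have "\<forall>V\<in>?C. res G U V (x - y) = 0"
    using U xy by (auto simp: res_diff)
  moreover have "x - y \<in> sec G U d"
    using U xy by (simp add: sec_diff)
  ultimately have "x - y = 0"
    unfolding UC by blast
  then show ?thesis by simp
qed

section \<open>Vector fields as compatible families of derivations\<close>

lemma vector_fieldsI:
  assumes "\<And>V \<xi>. X V \<xi> \<noteq> 0 \<Longrightarrow> opn G V \<and> V \<subseteq> U \<and> (\<exists>i. \<xi> \<in> sec G V i)"
    and "\<And>V i \<xi>. opn G V \<Longrightarrow> V \<subseteq> U \<Longrightarrow> \<xi> \<in> sec G V i \<Longrightarrow> X V \<xi> \<in> sec G V (i + j)"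
    and "\<And>V i \<xi> \<zeta> c. opn G V \<Longrightarrow> V \<subseteq> U \<Longrightarrow> \<xi> \<in> sec G V i \<Longrightarrow> \<zeta> \<in> sec G V i \<Longrightarrow>
      X V (c *\<^sub>R \<xi> + \<zeta>) = c *\<^sub>R X V \<xi> + X V \<zeta>"
    and "\<And>V i i' \<xi> \<zeta>. opn G V \<Longrightarrow> V \<subseteq> U \<Longrightarrow> \<xi> \<in> sec G V i \<Longrightarrow> \<zeta> \<in> sec G V i' \<Longrightarrow>
      X V (\<xi> * \<zeta>) = X V \<xi> * \<zeta> + kos (j * i) (\<xi> * X V \<zeta>)"
    and "\<And>V W i \<xi>. opn G V \<Longrightarrow> V \<subseteq> U \<Longrightarrow> opn G W \<Longrightarrow> W \<subseteq> V \<Longrightarrow> \<xi> \<in> sec G V i \<Longrightarrow>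
      res G V W (X V \<xi>) = X W (res G V W \<xi>)"
  shows "X \<in> vector_fields G U j"
  unfolding vector_fields_def mem_Collect_eq
proof (intro conjI allI impI ballI)
  show "opn G V" "V \<subseteq> U" "\<exists>i. \<xi> \<in> sec G V i" if "X V \<xi> \<noteq> 0" for V \<xi>
    using assms(1)[OF that] by blast+
qed (use assms(2-) in \<open>(elim conjE; simp only:)+\<close>)

context
  fixes X U j
  assumes X: "X \<in> vector_fields G U j"
begin

lemma vf_suppD: "X V \<xi> \<noteq> 0 \<Longrightarrow> opn G V \<and> V \<subseteq> U \<and> (\<exists>i. \<xi> \<in> sec G V i)"
  by (rule X[unfolded vector_fields_def mem_Collect_eq, THEN conjunct1, rule_format])

lemma vf_supp: "\<not> (opn G V \<and> V \<subseteq> U \<and> (\<exists>i. \<xi> \<in> sec G V i)) \<Longrightarrow> X V \<xi> = 0"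
  using vf_suppD by blast

context
  fixes V
  assumes V: "opn G V" "V \<subseteq> U"
begin

lemma vf_sec: "\<xi> \<in> sec G V i \<Longrightarrow> X V \<xi> \<in> sec G V (i + j)"
  by (rule X[unfolded vector_fields_def mem_Collect_eq, THEN conjunct2, rule_format, OF conjI[OF V], THEN conjunct1, rule_format])

lemma vf_lin:
  "\<xi> \<in> sec G V i \<Longrightarrow> \<zeta> \<in> sec G V i \<Longrightarrow> X V (c *\<^sub>R \<xi> + \<zeta>) = c *\<^sub>R X V \<xi> + X V \<zeta>"
  by (rule X[unfolded vector_fields_def mem_Collect_eq, THEN conjunct2, rule_format, OF conjI[OF V], THEN conjunct2, THEN conjunct1, rule_format])

lemma vf_leibniz:
  "\<xi> \<in> sec G V i \<Longrightarrow> \<zeta> \<in> sec G V i' \<Longrightarrow> X V (\<xi> * \<zeta>) = X V \<xi> * \<zeta> + kos (j * i) (\<xi> * X V \<zeta>)"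
  by (rule X[unfolded vector_fields_def mem_Collect_eq, THEN conjunct2, rule_format, OF conjI[OF V], THEN conjunct2, THEN conjunct2, THEN conjunct1,
      rule_format])

lemma vf_res:
  "opn G W \<Longrightarrow> W \<subseteq> V \<Longrightarrow> \<xi> \<in> sec G V i \<Longrightarrow> res G V W (X V \<xi>) = X W (res G V W \<xi>)"
  by (rule X[unfolded vector_fields_def mem_Collect_eq, THEN conjunct2, rule_format, OF conjI[OF V], THEN conjunct2, THEN conjunct2, THEN conjunct2,
      rule_format, OF conjI])

lemma vf_add: "\<xi> \<in> sec G V i \<Longrightarrow> \<zeta> \<in> sec G V i \<Longrightarrow> X V (\<xi> + \<zeta>) = X V \<xi> + X V \<zeta>"
  using vf_lin[of \<xi> i \<zeta> 1] by simp

end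

text \<open>Inside \<open>U\<close> this is additivity, outside \<open>U\<close> the convention of
  extending by 0. Without side conditions on \<open>V\<close> it can be used as a plain rewrite
  rule.\<close>

lemma vf_zero: "X V 0 = 0"
proof (cases "opn G V \<and> V \<subseteq> U")
  case True
  then show ?thesis
    using vf_add[of V 0 undefined 0] by (simp add: sec_zero)
next
  case False
  then show ?thesis
    using vf_supp by blast
qed

context
  fixes V
  assumes V: "opn G V" "V \<subseteq> U"
begin

lemma vf_minus: "\<xi> \<in> sec G V i \<Longrightarrow> X V (- \<xi>) = - X V \<xi>"
  using vf_lin[OF V, of \<xi> i 0 "- 1"] V by (simp add: sec_zero vf_zero)

lemma vf_diff: "\<xi> \<in> sec G V i \<Longrightarrow> \<zeta> \<in> sec G V i \<Longrightarrow> X V (\<xi> - \<zeta>) = X V \<xi> - X V \<zeta>"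
  using vf_add[OF V, of \<xi> i "- \<zeta>"] V by (simp add: sec_minus vf_minus)

lemma vf_kos: "\<xi> \<in> sec G V i \<Longrightarrow> X V (kos n \<xi>) = kos n (X V \<xi>)"
  using V by (simp add: kos_def vf_minus)

end

lemma vf_sum:
  assumes V: "opn G V" "V \<subseteq> U" and F: "\<And>l. l \<in> A \<Longrightarrow> F l \<in> sec G V i"
  shows "X V (sum F A) = (\<Sum>l\<in>A. X V (F l))"
  using F
proof (induction A rule: infinite_finite_induct)
  case (insert x A)
  then show ?case
    using vf_add[OF V, of "F x" i "sum F A"] sec_sum[OF V(1), of A F i] by simp
qed (simp_all add: vf_zero)

lemma vf_restrict_mem:
  assumes "W \<subseteq> U"
  shows "vf_restrict W X \<in> vector_fields G W j"
proof (rule vector_fieldsI)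
  fix V \<xi> assume "vf_restrict W X V \<xi> \<noteq> 0"
  then show "opn G V \<and> V \<subseteq> W \<and> (\<exists>i. \<xi> \<in> sec G V i)"
    using vf_suppD[of V \<xi>] by (simp add: vf_restrict_def split: if_splits)
next
  fix V i \<xi> assume "opn G V" "V \<subseteq> W" "\<xi> \<in> sec G V i"
  then show "vf_restrict W X V \<xi> \<in> sec G V (i + j)"
    using assms vf_sec[of V \<xi> i] by (auto simp: vf_restrict_def)
next
  fix V i \<xi> \<zeta> c assume "opn G V" "V \<subseteq> W" "\<xi> \<in> sec G V i" "\<zeta> \<in> sec G V i"
  then show "vf_restrict W X V (c *\<^sub>R \<xi> + \<zeta>) = c *\<^sub>R vf_restrict W X V \<xi> + vf_restrict W X V \<zeta>"
    using assms vf_lin[of V \<xi> i \<zeta> c] by (auto simp: vf_restrict_def)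
next
  fix V i i' \<xi> \<zeta> assume "opn G V" "V \<subseteq> W" "\<xi> \<in> sec G V i" "\<zeta> \<in> sec G V i'"
  then show "vf_restrict W X V (\<xi> * \<zeta>) =
      vf_restrict W X V \<xi> * \<zeta> + kos (j * i) (\<xi> * vf_restrict W X V \<zeta>)"
    using assms vf_leibniz[of V \<xi> i \<zeta> i'] by (auto simp: vf_restrict_def)
next
  fix V V' i \<xi> assume "opn G V" "V \<subseteq> W" "opn G V'" "V' \<subseteq> V" "\<xi> \<in> sec G V i"
  then show "res G V V' (vf_restrict W X V \<xi>) = vf_restrict W X V' (res G V V' \<xi>)"
    using assms vf_res[of V V' \<xi> i] by (auto simp: vf_restrict_def)
qed

text \<open>An equality of functions thanks to the extension by 0; it lets results about
  restrictions be used over the whole domain.\<close>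

lemma vf_restrict_self: "vf_restrict U X = X"
proof (intro ext)
  fix V \<xi>
  show "vf_restrict U X V \<xi> = X V \<xi>"
    using vf_supp[of V \<xi>] by (auto simp: vf_restrict_def)
qed

end

section \<open>The sheaf of vector fields as a graded module\<close>

lemma vf_restrict_restrict:
  "V \<subseteq> W \<Longrightarrow> vf_restrict V (vf_restrict W X) = vf_restrict V X"
  by (auto simp: vf_restrict_def fun_eq_iff)

lemma vf_restrict_add: "vf_restrict W (X + Y) = vf_restrict W X + vf_restrict W Y"
  by (auto simp: vf_restrict_def fun_eq_iff)

lemma vf_zero_mem: "0 \<in> vector_fields G U j"
  by (rule vector_fieldsI) (auto simp: sec_zero res_zero)

lemma vf_add_mem:
  assumes X: "X \<in> vector_fields G U j" and Y: "Y \<in> vector_fields G U j"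
  shows "X + Y \<in> vector_fields G U j"
proof (rule vector_fieldsI)
  fix V \<xi> assume "(X + Y) V \<xi> \<noteq> 0"
  then show "opn G V \<and> V \<subseteq> U \<and> (\<exists>i. \<xi> \<in> sec G V i)"
    using vf_suppD[OF X, of V \<xi>] vf_suppD[OF Y, of V \<xi>]
    by (cases "X V \<xi> = 0") simp_all
next
  fix V i \<xi> assume "opn G V" "V \<subseteq> U" "\<xi> \<in> sec G V i"
  then show "(X + Y) V \<xi> \<in> sec G V (i + j)"
    by (simp add: sec_add vf_sec[OF X] vf_sec[OF Y])
next
  fix V i \<xi> \<zeta> c assume "opn G V" "V \<subseteq> U" "\<xi> \<in> sec G V i" "\<zeta> \<in> sec G V i"
  then show "(X + Y) V (c *\<^sub>R \<xi> + \<zeta>) = c *\<^sub>R (X + Y) V \<xi> + (X + Y) V \<zeta>"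
    by (simp add: vf_lin[OF X] vf_lin[OF Y] scaleR_add_right)
next
  fix V i i' \<xi> \<zeta> assume "opn G V" "V \<subseteq> U" "\<xi> \<in> sec G V i" "\<zeta> \<in> sec G V i'"
  then show "(X + Y) V (\<xi> * \<zeta>) = (X + Y) V \<xi> * \<zeta> + kos (j * i) (\<xi> * (X + Y) V \<zeta>)"
    by (simp add: vf_leibniz[OF X] vf_leibniz[OF Y] kos_add distrib_left distrib_right)
next
  fix V V' i \<xi> assume *: "opn G V" "V \<subseteq> U" "opn G V'" "V' \<subseteq> V" "\<xi> \<in> sec G V i"
  then show "res G V V' ((X + Y) V \<xi>) = (X + Y) V' (res G V V' \<xi>)"
    using res_add[OF *(1,3,4) vf_sec[OF X *(1,2,5)] vf_sec[OF Y *(1,2,5)]]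
    by (simp add: vf_res[OF X *] vf_res[OF Y *])
qed

lemma vf_sum_mem:
  "(\<And>l. l \<in> A \<Longrightarrow> F l \<in> vector_fields G U j) \<Longrightarrow> sum F A \<in> vector_fields G U j"
  by (induction A rule: infinite_finite_induct) (simp_all add: vf_zero_mem vf_add_mem)

lemma vf_smul_mem:
  assumes X: "X \<in> vector_fields G U j" and f: "f \<in> sec G U c" and U: "opn G U"
  shows "vf_smul G U f X \<in> vector_fields G U (c + j)"
proof (rule vector_fieldsI)
  fix V \<xi> assume "vf_smul G U f X V \<xi> \<noteq> 0"
  then show "opn G V \<and> V \<subseteq> U \<and> (\<exists>i. \<xi> \<in> sec G V i)"
    using vf_suppD[OF X, of V \<xi>] by (cases "X V \<xi> = 0") (simp_all add: vf_smul_def)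
next
  fix V i \<xi> assume *: "opn G V" "V \<subseteq> U" "\<xi> \<in> sec G V i"
  show "vf_smul G U f X V \<xi> \<in> sec G V (i + (c + j))"
    using sec_mult[OF *(1) res_sec[OF U *(1,2) f] vf_sec[OF X *]]
    by (simp add: vf_smul_def algebra_simps)
next
  fix V i \<xi> \<zeta> r assume "opn G V" "V \<subseteq> U" "\<xi> \<in> sec G V i" "\<zeta> \<in> sec G V i"
  then show "vf_smul G U f X V (r *\<^sub>R \<xi> + \<zeta>) = r *\<^sub>R vf_smul G U f X V \<xi> + vf_smul G U f X V \<zeta>"
    by (simp add: vf_smul_def vf_lin[OF X] distrib_left)
next
  fix V i i' \<xi> \<zeta> assume *: "opn G V" "V \<subseteq> U" "\<xi> \<in> sec G V i" "\<zeta> \<in> sec G V i'"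
  let ?f = "res G U V f"
  \<comment> \<open>Commuting the coefficient past \<xi> contributes c i to the exponent, which
    turns the Leibniz sign j i of \<open>X\<close> into the sign (c + j) i of the product.\<close>
  have "?f * (\<xi> * X V \<zeta>) = kos (c * i) (\<xi> * (?f * X V \<zeta>))"
    using sec_comm[OF *(1) res_sec[OF U *(1,2) f] *(3)]
    by (simp add: kos_mult_left flip: mult.assoc)
  then show "vf_smul G U f X V (\<xi> * \<zeta>) =
      vf_smul G U f X V \<xi> * \<zeta> + kos ((c + j) * i) (\<xi> * vf_smul G U f X V \<zeta>)"
    using * by (simp add: vf_smul_def vf_leibniz[OF X *] distrib_left kos_mult_right kos_kos
        mult.assoc algebra_simps)
next
  fix V V' i \<xi> assume *: "opn G V" "V \<subseteq> U" "opn G V'" "V' \<subseteq> V" "\<xi> \<in> sec G V i"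
  then show "res G V V' (vf_smul G U f X V \<xi>) = vf_smul G U f X V' (res G V V' \<xi>)"
    using res_mult[OF *(1,3,4) res_sec[OF U *(1,2) f] vf_sec[OF X *(1,2,5)]]
      res_res[OF U *(1,3,4,2) f]
    by (simp add: vf_smul_def vf_res[OF X *])
qed

lemma vf_smul_restrict:
  assumes X: "X \<in> vector_fields G U j" and f: "f \<in> sec G U c" and U: "opn G U"
    and V: "opn G V" "V \<subseteq> U"
  shows "vf_restrict V (vf_smul G U f X) = vf_smul G V (res G U V f) (vf_restrict V X)"
proof (intro ext)
  fix W \<xi>
  show "vf_restrict V (vf_smul G U f X) W \<xi> = vf_smul G V (res G U V f) (vf_restrict V X) W \<xi>"
    using vf_supp[OF X, of W \<xi>] res_res[OF U V(1) _ _ V(2) f, of W]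
    by (cases "opn G W") (auto simp: vf_restrict_def vf_smul_def)
qed

lemma vf_kos_mem:
  assumes "X \<in> vector_fields G U j" "opn G U"
  shows "kos n X \<in> vector_fields G U j"
proof -
  have "- X \<in> vector_fields G U j"
  proof (rule vector_fieldsI, goal_cases)
    case (1 V \<xi>)
    then show ?case using vf_suppD[OF assms(1), of V \<xi>] by simp
  next
    case 2
    then show ?case by (simp add: sec_minus vf_sec[OF assms(1)])
  next
    case 3
    then show ?case by (simp add: vf_lin[OF assms(1)])
  next
    case 4
    then show ?case by (simp add: vf_leibniz[OF assms(1)] kos_minus)
  next
    case 5
    then show ?case
      using res_minus[OF _ _ _ vf_sec[OF assms(1)]] by (simp add: vf_res[OF assms(1)])
  qed
  then show ?thesis
    using assms by (simp add: kos_def)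
qed

text \<open>Both fields commute with restriction, so their values at a section over \<open>W\<close>
  are compared on the pieces \<open>W \<inter> V\<close> of a cover of \<open>W\<close>.\<close>

lemma vf_eqI:
  assumes X: "X \<in> vector_fields G U j" and Y: "Y \<in> vector_fields G U j"
    and loc: "\<And>p. p \<in> U \<Longrightarrow>
      \<exists>V. opn G V \<and> p \<in> V \<and> V \<subseteq> U \<and> vf_restrict V X = vf_restrict V Y"
  shows "X = Y"
proof (intro ext)
  fix W \<xi>
  show "X W \<xi> = Y W \<xi>"
  proof (cases "opn G W \<and> W \<subseteq> U \<and> (\<exists>i. \<xi> \<in> sec G W i)")
    case False
    then show ?thesis
      using vf_supp[OF X] vf_supp[OF Y] by metis
  next
    case True
    then obtain i where W: "opn G W" "W \<subseteq> U" and \<xi>: "\<xi> \<in> sec G W i"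
      by blast
    show ?thesis
    proof (rule sec_eqI[OF W(1) vf_sec[OF X W \<xi>] vf_sec[OF Y W \<xi>]])
      fix p assume "p \<in> W"
      then obtain V where V: "opn G V" "p \<in> V" "V \<subseteq> U" "vf_restrict V X = vf_restrict V Y"
        using loc W by blast
      \<comment> \<open>Equal restrictions to \<open>V\<close> mean equal values over all open
        subsets of \<open>V\<close>, of which \<open>W \<inter> V\<close> is the one to use.\<close>
      have "vf_restrict V X (W \<inter> V) = vf_restrict V Y (W \<inter> V)"
        using V by simp
      then have "X (W \<inter> V) = Y (W \<inter> V)"
        by (auto simp: vf_restrict_def fun_eq_iff)
      then show "\<exists>V. opn G V \<and> p \<in> V \<and> V \<subseteq> W \<and> res G W V (X W \<xi>) = res G W V (Y W \<xi>)"
        using V W \<open>p \<in> W\<close>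
        by (intro exI[of _ "W \<inter> V"])
          (auto simp: opn_Int vf_res[OF X W _ _ \<xi>] vf_res[OF Y W _ _ \<xi>])
    qed
  qed
qed

text \<open>Once \<open>X\<close> maps sections to sections and commutes with restriction, linearity
  and the Leibniz rule are equations between sections and can be checked on a cover. This serves
  families given by a global formula whose derivation property is visible only in a local
  description.\<close>

lemma vf_localI:
  assumes supp: "\<And>V \<xi>. X V \<xi> \<noteq> 0 \<Longrightarrow> opn G V \<and> V \<subseteq> U \<and> (\<exists>i. \<xi> \<in> sec G V i)"
    and sec: "\<And>V i \<xi>. opn G V \<Longrightarrow> V \<subseteq> U \<Longrightarrow> \<xi> \<in> sec G V i \<Longrightarrow> X V \<xi> \<in> sec G V (i + j)"
    and res: "\<And>V W i \<xi>. opn G V \<Longrightarrow> V \<subseteq> U \<Longrightarrow> opn G W \<Longrightarrow> W \<subseteq> V \<Longrightarrow> \<xi> \<in> sec G V i \<Longrightarrow>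
      res G V W (X V \<xi>) = X W (res G V W \<xi>)"
    and loc: "\<And>p. p \<in> U \<Longrightarrow>
      \<exists>V. opn G V \<and> p \<in> V \<and> V \<subseteq> U \<and> vf_restrict V X \<in> vector_fields G V j"
  shows "X \<in> vector_fields G U j"
proof (rule vector_fieldsI[OF supp sec _ _ res])
  fix W i \<xi> \<zeta> c assume W: "opn G W" "W \<subseteq> U" and x: "\<xi> \<in> sec G W i" "\<zeta> \<in> sec G W i"
  show "X W (c *\<^sub>R \<xi> + \<zeta>) = c *\<^sub>R X W \<xi> + X W \<zeta>"
  proof (rule sec_eqI[OF W(1)])
    show "X W (c *\<^sub>R \<xi> + \<zeta>) \<in> sec G W (i + j)" "c *\<^sub>R X W \<xi> + X W \<zeta> \<in> sec G W (i + j)"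
      using W x by (auto intro!: sec sec_add sec_scaleR)
    fix p assume "p \<in> W"
    then obtain V where V: "opn G V" "p \<in> V" "V \<subseteq> U" "vf_restrict V X \<in> vector_fields G V j"
      using loc W by blast
    let ?V = "W \<inter> V"
    have o: "opn G ?V" "?V \<subseteq> W" "?V \<subseteq> V"
      using V W by (auto simp: opn_Int)
    have "X ?V (res G W ?V (c *\<^sub>R \<xi> + \<zeta>)) = c *\<^sub>R X ?V (res G W ?V \<xi>) + X ?V (res G W ?V \<zeta>)"
      using vf_lin[OF V(4) o(1,3) res_sec[OF W(1) o(1,2) x(1)] res_sec[OF W(1) o(1,2) x(2)]]
        res_lin[OF W(1) o(1,2) x] by (simp add: vf_restrict_def)
    moreover have "res G W ?V (c *\<^sub>R X W \<xi> + X W \<zeta>) = c *\<^sub>R X ?V (res G W ?V \<xi>) + X ?V (res G W ?V \<zeta>)"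
      using res_lin[OF W(1) o(1,2) sec[OF W x(1)] sec[OF W x(2)]] res[OF W o(1,2)] x by simp
    moreover have "c *\<^sub>R \<xi> + \<zeta> \<in> sec G W i"
      using W x by (auto intro!: sec_add sec_scaleR)
    ultimately have "res G W ?V (X W (c *\<^sub>R \<xi> + \<zeta>)) = res G W ?V (c *\<^sub>R X W \<xi> + X W \<zeta>)"
      using res[OF W o(1,2)] by simp
    then show "\<exists>V. opn G V \<and> p \<in> V \<and> V \<subseteq> W \<and>
        res G W V (X W (c *\<^sub>R \<xi> + \<zeta>)) = res G W V (c *\<^sub>R X W \<xi> + X W \<zeta>)"
      using o V(2) \<open>p \<in> W\<close> by blast
  qed
next
  fix W i i' \<xi> \<zeta> assume W: "opn G W" "W \<subseteq> U" and x: "\<xi> \<in> sec G W i" "\<zeta> \<in> sec G W i'"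
  have m: "X W \<xi> * \<zeta> \<in> sec G W (i + i' + j)" "\<xi> * X W \<zeta> \<in> sec G W (i + i' + j)"
    using sec_mult[OF W(1) sec[OF W x(1)] x(2)] sec_mult[OF W(1) x(1) sec[OF W x(2)]]
    by (simp_all add: algebra_simps)
  show "X W (\<xi> * \<zeta>) = X W \<xi> * \<zeta> + kos (j * i) (\<xi> * X W \<zeta>)"
  proof (rule sec_eqI[OF W(1)])
    show "X W (\<xi> * \<zeta>) \<in> sec G W (i + i' + j)"
      using W x by (auto intro!: sec sec_mult)
    show "X W \<xi> * \<zeta> + kos (j * i) (\<xi> * X W \<zeta>) \<in> sec G W (i + i' + j)"
      using W m by (simp add: sec_add sec_kos)
    fix p assume "p \<in> W"
    then obtain V where V: "opn G V" "p \<in> V" "V \<subseteq> U" "vf_restrict V X \<in> vector_fields G V j"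
      using loc W by blast
    let ?V = "W \<inter> V"
    have o: "opn G ?V" "?V \<subseteq> W" "?V \<subseteq> V"
      using V W by (auto simp: opn_Int)
    have "X ?V (res G W ?V (\<xi> * \<zeta>)) = X ?V (res G W ?V \<xi>) * res G W ?V \<zeta> +
        kos (j * i) (res G W ?V \<xi> * X ?V (res G W ?V \<zeta>))"
      using vf_leibniz[OF V(4) o(1,3) res_sec[OF W(1) o(1,2) x(1)] res_sec[OF W(1) o(1,2) x(2)]]
        res_mult[OF W(1) o(1,2) x] by (simp add: vf_restrict_def)
    moreover have "res G W ?V (X W \<xi> * \<zeta> + kos (j * i) (\<xi> * X W \<zeta>)) =
        X ?V (res G W ?V \<xi>) * res G W ?V \<zeta> +
        kos (j * i) (res G W ?V \<xi> * X ?V (res G W ?V \<zeta>))"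
      using res_add[OF W(1) o(1,2) m(1) sec_kos[OF W(1) m(2)], of "j * i"]
        res_kos[OF W(1) o(1,2) m(2)]
        res_mult[OF W(1) o(1,2) sec[OF W x(1)] x(2)] res_mult[OF W(1) o(1,2) x(1) sec[OF W x(2)]]
        res[OF W o(1,2) x(1)] res[OF W o(1,2) x(2)] by simp
    ultimately have "res G W ?V (X W (\<xi> * \<zeta>)) =
        res G W ?V (X W \<xi> * \<zeta> + kos (j * i) (\<xi> * X W \<zeta>))"
      using res[OF W o(1,2) sec_mult[OF W(1) x]] by simp
    then show "\<exists>V. opn G V \<and> p \<in> V \<and> V \<subseteq> W \<and>
        res G W V (X W (\<xi> * \<zeta>)) = res G W V (X W \<xi> * \<zeta> + kos (j * i) (\<xi> * X W \<zeta>))"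
      using o V(2) \<open>p \<in> W\<close> by blast
  qed
qed

section \<open>One-forms\<close>

context
  fixes \<eta> U e
  assumes \<eta>: "\<eta> \<in> one_forms G U e"
begin

lemma form_suppD: "\<eta> V j X \<noteq> 0 \<Longrightarrow> opn G V \<and> V \<subseteq> U \<and> X \<in> vector_fields G V j"
  by (rule \<eta>[unfolded one_forms_def mem_Collect_eq, THEN conjunct1, rule_format])

lemma form_supp: "\<not> (opn G V \<and> V \<subseteq> U \<and> X \<in> vector_fields G V j) \<Longrightarrow> \<eta> V j X = 0"
  using form_suppD by blast

lemma form_sec:
  "opn G V \<Longrightarrow> V \<subseteq> U \<Longrightarrow> X \<in> vector_fields G V j \<Longrightarrow> \<eta> V j X \<in> sec G V (e + j)"
  by (rule \<eta>[unfolded one_forms_def mem_Collect_eq, THEN conjunct2, THEN conjunct1, rule_format,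
      OF conjI, THEN conjunct1])

lemma form_res:
  "opn G V \<Longrightarrow> V \<subseteq> U \<Longrightarrow> X \<in> vector_fields G V j \<Longrightarrow> opn G W \<Longrightarrow> W \<subseteq> V \<Longrightarrow>
    res G V W (\<eta> V j X) = \<eta> W j (vf_restrict W X)"
  by (rule \<eta>[unfolded one_forms_def mem_Collect_eq, THEN conjunct2, THEN conjunct1, rule_format,
      OF conjI, THEN conjunct2, rule_format, OF _ _ _ conjI])

lemma form_rep:
  "p \<in> U \<Longrightarrow> \<exists>V n a f z. opn G V \<and> p \<in> V \<and> V \<subseteq> U \<and> form_terms G V e n a f z \<and>
      form_restrict V \<eta> = form_comb G V n a f z"
  by (rule \<eta>[unfolded one_forms_def mem_Collect_eq, THEN conjunct2, THEN conjunct2, rule_format])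

end

lemma one_formsI:
  assumes "\<And>V j X. \<eta> V j X \<noteq> 0 \<Longrightarrow> opn G V \<and> V \<subseteq> U \<and> X \<in> vector_fields G V j"
    and "\<And>V j X. opn G V \<Longrightarrow> V \<subseteq> U \<Longrightarrow> X \<in> vector_fields G V j \<Longrightarrow> \<eta> V j X \<in> sec G V (e + j)"
    and "\<And>V W j X. opn G V \<Longrightarrow> V \<subseteq> U \<Longrightarrow> X \<in> vector_fields G V j \<Longrightarrow> opn G W \<Longrightarrow> W \<subseteq> V \<Longrightarrow>
      res G V W (\<eta> V j X) = \<eta> W j (vf_restrict W X)"
    and "\<And>p. p \<in> U \<Longrightarrow> \<exists>V n a f z. opn G V \<and> p \<in> V \<and> V \<subseteq> U \<and> form_terms G V e n a f z \<and>
      form_restrict V \<eta> = form_comb G V n a f z"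
  shows "\<eta> \<in> one_forms G U e"
  unfolding one_forms_def mem_Collect_eq
proof (intro conjI allI impI ballI)
  show "opn G V" "V \<subseteq> U" "X \<in> vector_fields G V j" if "\<eta> V j X \<noteq> 0" for V j X
    using assms(1)[OF that] by blast+
qed (use assms(2-) in \<open>(elim conjE)?; simp only:\<close>)+

lemma form_comb_apply:
  assumes "opn G W" "W \<subseteq> V" "X \<in> vector_fields G W j"
  shows "form_comb G V n a f z W j X =
    (\<Sum>l<n. kos (a l * (j + 1)) (res G V W (f l) * X W (res G V W (z l))))"
  using assms by (simp add: form_comb_def sum_apply1 form_smul_def dform_def)

lemma form_comb_supp:
  assumes "\<not> (opn G W \<and> W \<subseteq> V \<and> X \<in> vector_fields G W j)"
  shows "form_comb G V n a f z W j X = 0"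
proof -
  have "dform G V (z l) W j X = 0" for l
    using assms by (simp only: dform_def if_False)
  then show ?thesis
    by (simp add: form_comb_def sum_apply1 form_smul_def)
qed

lemma form_termsD:
  assumes "form_terms G V e n a f z" "l < n"
  shows "f l \<in> sec G V (a l)" "z l \<in> sec G V (e - a l)"
  using assms by (simp_all add: form_terms_def)

lemma form_terms_restrict:
  assumes "form_terms G V e n a f z" "opn G V" "opn G W" "W \<subseteq> V"
  shows "form_terms G W e n a (\<lambda>l. res G V W (f l)) (\<lambda>l. res G V W (z l))"
  using assms by (simp add: form_terms_def res_sec)

lemma form_comb_restrict:
  assumes t: "form_terms G V e n a f z" and V: "opn G V" and W: "opn G W" "W \<subseteq> V"
  shows "form_restrict W (form_comb G V n a f z) =
    form_comb G W n a (\<lambda>l. res G V W (f l)) (\<lambda>l. res G V W (z l))"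
proof (intro ext)
  fix W' j X
  show "form_restrict W (form_comb G V n a f z) W' j X =
    form_comb G W n a (\<lambda>l. res G V W (f l)) (\<lambda>l. res G V W (z l)) W' j X"
  proof (cases "opn G W' \<and> W' \<subseteq> W \<and> X \<in> vector_fields G W' j")
    case True
    then show ?thesis
      using W res_res[OF V W(1) _ _ W(2) form_termsD(1)[OF t], of W']
        res_res[OF V W(1) _ _ W(2) form_termsD(2)[OF t], of W']
      by (auto simp: form_comb_apply form_restrict_def intro!: sum.cong)
  next
    case False
    then show ?thesis
      using W by (auto simp: form_restrict_def form_comb_supp)
  qed
qed

lemma form_restrict_restrict:
  "V \<subseteq> W \<Longrightarrow> form_restrict V (form_restrict W \<eta>) = form_restrict V \<eta>"
  by (auto simp: form_restrict_def fun_eq_iff)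

text \<open>A form comes with presentations on neighbourhoods that cannot be prescribed;
  intersecting with \<open>W\<close> and restricting all coefficients makes them as small as
  desired.\<close>

lemma form_rep_within:
  assumes \<eta>: "\<eta> \<in> one_forms G U e" and W: "opn G W" "W \<subseteq> U" "p \<in> W"
  obtains V n a f z where "opn G V" "p \<in> V" "V \<subseteq> W" "form_terms G V e n a f z"
    "form_restrict V \<eta> = form_comb G V n a f z"
proof -
  obtain V n a f z where V: "opn G V" "p \<in> V" "V \<subseteq> U" "form_terms G V e n a f z"
    "form_restrict V \<eta> = form_comb G V n a f z"
    using form_rep[OF \<eta>] W by blast
  have i: "opn G (V \<inter> W)" "V \<inter> W \<subseteq> V"
    using V W by (auto simp: opn_Int)
  show thesis
    using that[OF i(1) _ _ form_terms_restrict[OF V(4,1) i]]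
      form_comb_restrict[OF V(4,1) i] form_restrict_restrict[OF i(2), of \<eta>] V(2,5) W(3) by simp
qed

text \<open>A presentation over \<open>V\<close> determines the contractions over every open
  \<open>W\<close> inside \<open>V\<close>; this is how presentations are exploited below.\<close>

lemma form_restrict_eval:
  assumes "form_restrict V \<eta> = form_comb G V n a f z"
    and "opn G W" "W \<subseteq> V" "X \<in> vector_fields G W j"
  shows "\<eta> W j X = (\<Sum>l<n. kos (a l * (j + 1)) (res G V W (f l) * X W (res G V W (z l))))"
proof -
  have "\<eta> W j X = form_restrict V \<eta> W j X"
    using assms(3) by (simp add: form_restrict_def)
  then show ?thesis
    unfolding assms(1) form_comb_apply[OF assms(2-4)] .
qed

lemma form_restrict_mem:
  assumes \<eta>: "\<eta> \<in> one_forms G U e" and W: "opn G W" "W \<subseteq> U"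
  shows "form_restrict W \<eta> \<in> one_forms G W e"
proof (rule one_formsI)
  fix V j X assume "form_restrict W \<eta> V j X \<noteq> 0"
  then show "opn G V \<and> V \<subseteq> W \<and> X \<in> vector_fields G V j"
    using form_suppD[OF \<eta>, of V j X] by (simp add: form_restrict_def split: if_splits)
next
  fix V j X assume "opn G V" "V \<subseteq> W" "X \<in> vector_fields G V j"
  then show "form_restrict W \<eta> V j X \<in> sec G V (e + j)"
    using form_sec[OF \<eta>, of V X j] W by (simp add: form_restrict_def)
next
  fix V V' j X
  assume "opn G V" "V \<subseteq> W" "X \<in> vector_fields G V j" "opn G V'" "V' \<subseteq> V"
  then show "res G V V' (form_restrict W \<eta> V j X) = form_restrict W \<eta> V' j (vf_restrict V' X)"
    using form_res[OF \<eta>, of V X j V'] W by (auto simp: form_restrict_def)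
next
  fix p assume "p \<in> W"
  with \<eta> W obtain V n a f z where "opn G V" "p \<in> V" "V \<subseteq> W" "form_terms G V e n a f z"
    "form_restrict V \<eta> = form_comb G V n a f z"
    by (rule form_rep_within)
  then show "\<exists>V n a f z. opn G V \<and> p \<in> V \<and> V \<subseteq> W \<and> form_terms G V e n a f z \<and>
      form_restrict V (form_restrict W \<eta>) = form_comb G V n a f z"
    by (metis form_restrict_restrict)
qed

lemma form_eqI:
  assumes \<eta>: "\<eta> \<in> one_forms G U e" and \<theta>: "\<theta> \<in> one_forms G U e"
    and loc: "\<And>p. p \<in> U \<Longrightarrow>
      \<exists>V. opn G V \<and> p \<in> V \<and> V \<subseteq> U \<and> form_restrict V \<eta> = form_restrict V \<theta>"
  shows "\<eta> = \<theta>"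
proof (intro ext)
  fix W j X
  show "\<eta> W j X = \<theta> W j X"
  proof (cases "opn G W \<and> W \<subseteq> U \<and> X \<in> vector_fields G W j")
    case False
    then show ?thesis
      by (simp only: form_supp[OF \<eta> False] form_supp[OF \<theta> False])
  next
    case True
    then have W: "opn G W" "W \<subseteq> U" and X: "X \<in> vector_fields G W j"
      by blast+
    show ?thesis
    proof (rule sec_eqI[OF W(1) form_sec[OF \<eta> W X] form_sec[OF \<theta> W X]])
      fix p assume "p \<in> W"
      then obtain V where V: "opn G V" "p \<in> V" "V \<subseteq> U" "form_restrict V \<eta> = form_restrict V \<theta>"
        using loc W by blast
      have "form_restrict V \<eta> (W \<inter> V) = form_restrict V \<theta> (W \<inter> V)"
        using V by simp
      then have "\<eta> (W \<inter> V) = \<theta> (W \<inter> V)"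
        by (auto simp: form_restrict_def fun_eq_iff)
      then show "\<exists>V. opn G V \<and> p \<in> V \<and> V \<subseteq> W \<and> res G W V (\<eta> W j X) = res G W V (\<theta> W j X)"
        using V W \<open>p \<in> W\<close>
        by (intro exI[of _ "W \<inter> V"])
          (auto simp: opn_Int form_res[OF \<eta> W X] form_res[OF \<theta> W X])
    qed
  qed
qed

text \<open>No sign appears: the contraction with a vector field stands to the left of the form.\<close>

lemma form_vf_smul:
  assumes \<eta>: "\<eta> \<in> one_forms G U e" and W: "opn G W" "W \<subseteq> U"
    and X: "X \<in> vector_fields G W j" and h: "h \<in> sec G W c"
  shows "\<eta> W (c + j) (vf_smul G W h X) = h * \<eta> W j X"
proof (rule sec_eqI[OF W(1)])
  have hX: "vf_smul G W h X \<in> vector_fields G W (c + j)"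
    using vf_smul_mem[OF X h W(1)] .
  show "\<eta> W (c + j) (vf_smul G W h X) \<in> sec G W (e + (c + j))"
    using form_sec[OF \<eta> W hX] .
  show "h * \<eta> W j X \<in> sec G W (e + (c + j))"
    using sec_mult[OF W(1) h form_sec[OF \<eta> W X]] by (simp add: algebra_simps)
  fix p assume p: "p \<in> W"
  obtain V n a f z where V: "opn G V" "p \<in> V" "V \<subseteq> W" and t: "form_terms G V e n a f z"
    and r: "form_restrict V \<eta> = form_comb G V n a f z"
    using form_rep_within[OF \<eta> W p] .
  define h' where "h' = res G W V h"
  define Y where "Y = vf_restrict V X"
  have h': "h' \<in> sec G V c"
    using res_sec[OF W(1) V(1,3) h] by (simp add: h'_def)
  have Y: "Y \<in> vector_fields G V j"
    unfolding Y_def using vf_restrict_mem[OF X V(3)] .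
  have "res G W V (\<eta> W (c + j) (vf_smul G W h X)) = \<eta> V (c + j) (vf_smul G V h' Y)"
    using form_res[OF \<eta> W hX V(1,3)] vf_smul_restrict[OF X h W(1) V(1,3)]
    by (simp add: h'_def Y_def)
  also have "\<dots> = (\<Sum>l<n. kos (a l * (c + j + 1)) (f l * (h' * Y V (z l))))"
    unfolding form_restrict_eval[OF r V(1) subset_refl vf_smul_mem[OF Y h' V(1)]]
    by (rule sum.cong) (auto simp: vf_smul_def res_id[OF V(1)] h' form_termsD[OF t]
        res_id[OF V(1) form_termsD(1)[OF t]] res_id[OF V(1) form_termsD(2)[OF t]] res_id[OF V(1) h'])
  also have "\<dots> = (\<Sum>l<n. h' * kos (a l * (j + 1)) (f l * Y V (z l)))"
  proof (rule sum.cong[OF refl])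
    fix l assume "l \<in> {..<n}"
    then have fl: "f l \<in> sec G V (a l)"
      using form_termsD[OF t] by simp
    \<comment> \<open>Moving \<open>h'\<close> to the front past \<open>f l\<close> produces the
      exponent \<open>a l * c\<close>, which is exactly the difference between the sign for a field
      of degree c + j and that for one of degree j.\<close>
    have "f l * (h' * Y V (z l)) = kos (a l * c) (h' * (f l * Y V (z l)))"
      using sec_comm[OF V(1) fl h'] by (simp add: kos_mult_left flip: mult.assoc)
    then show "kos (a l * (c + j + 1)) (f l * (h' * Y V (z l))) =
        h' * kos (a l * (j + 1)) (f l * Y V (z l))"
      by (simp add: kos_mult_right kos_kos) (rule kos_cong, simp add: algebra_simps)
  qed
  also have "\<dots> = h' * \<eta> V j Y"
    unfolding form_restrict_eval[OF r V(1) subset_refl Y] sum_distrib_left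
    by (rule sum.cong)
      (auto simp: res_id[OF V(1) form_termsD(1)[OF t]] res_id[OF V(1) form_termsD(2)[OF t]])
  also have "\<dots> = res G W V (h * \<eta> W j X)"
    using res_mult[OF W(1) V(1,3) h form_sec[OF \<eta> W X]] form_res[OF \<eta> W X V(1,3)]
    by (simp add: h'_def Y_def)
  finally show "\<exists>V. opn G V \<and> p \<in> V \<and> V \<subseteq> W \<and>
      res G W V (\<eta> W (c + j) (vf_smul G W h X)) = res G W V (h * \<eta> W j X)"
    using V by blast
qed

text \<open>Additivity is not built into the encoding of forms as functions of vector fields. It is
  inherited from the local presentations, in which the field enters only through its values at the
  \<open>z l\<close>.\<close>

lemma form_vf_add:
  assumes \<eta>: "\<eta> \<in> one_forms G U e" and W: "opn G W" "W \<subseteq> U"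
    and X: "X \<in> vector_fields G W j" and Y: "Y \<in> vector_fields G W j"
  shows "\<eta> W j (X + Y) = \<eta> W j X + \<eta> W j Y"
proof (rule sec_eqI[OF W(1)])
  note XY = vf_add_mem[OF X Y]
  show "\<eta> W j (X + Y) \<in> sec G W (e + j)" "\<eta> W j X + \<eta> W j Y \<in> sec G W (e + j)"
    using form_sec[OF \<eta> W] X Y XY by (simp_all add: sec_add W)
  fix p assume p: "p \<in> W"
  obtain V n a f z where V: "opn G V" "p \<in> V" "V \<subseteq> W" and t: "form_terms G V e n a f z"
    and r: "form_restrict V \<eta> = form_comb G V n a f z"
    using form_rep_within[OF \<eta> W p] .
  note X' = vf_restrict_mem[OF X V(3)] and Y' = vf_restrict_mem[OF Y V(3)]
  have "\<eta> V j (vf_restrict V X + vf_restrict V Y) =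
      \<eta> V j (vf_restrict V X) + \<eta> V j (vf_restrict V Y)"
    unfolding form_restrict_eval[OF r V(1) subset_refl vf_add_mem[OF X' Y']]
      form_restrict_eval[OF r V(1) subset_refl X'] form_restrict_eval[OF r V(1) subset_refl Y']
    by (simp add: distrib_left kos_add sum.distrib)
  then show "\<exists>V. opn G V \<and> p \<in> V \<and> V \<subseteq> W \<and>
      res G W V (\<eta> W j (X + Y)) = res G W V (\<eta> W j X + \<eta> W j Y)"
    using V res_add[OF W(1) V(1,3) form_sec[OF \<eta> W X] form_sec[OF \<eta> W Y]]
      form_res[OF \<eta> W XY V(1,3)] form_res[OF \<eta> W X V(1,3)] form_res[OF \<eta> W Y V(1,3)]
    by (intro exI[of _ V]) (simp add: vf_restrict_add)
qed

lemma form_vf_zero: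
  assumes \<eta>: "\<eta> \<in> one_forms G U e"
  shows "\<eta> W j 0 = 0"
proof (cases "opn G W \<and> W \<subseteq> U")
  case True
  then show ?thesis
    using form_vf_add[OF \<eta> _ _ vf_zero_mem vf_zero_mem, of W j] by simp
next
  case False
  then show ?thesis
    using form_supp[OF \<eta>, of W] by blast
qed

lemma form_vf_sum:
  assumes \<eta>: "\<eta> \<in> one_forms G U e" and W: "opn G W" "W \<subseteq> U"
    and F: "\<And>l. l \<in> A \<Longrightarrow> F l \<in> vector_fields G W j"
  shows "\<eta> W j (sum F A) = (\<Sum>l\<in>A. \<eta> W j (F l))"
  using F
proof (induction A rule: infinite_finite_induct)
  case (insert x A)
  then show ?case
    using form_vf_add[OF \<eta> W, of "F x" j "sum F A"] vf_sum_mem[of A F W j]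
    by (simp only: sum.insert insert_iff simp_thms)
qed (simp_all add: form_vf_zero[OF \<eta>])

section \<open>The sheaf of one-forms as a graded module\<close>

text \<open>Concatenation of the two lists of terms. Membership in \<open>one_forms\<close> asks for
  a single presentation near each point, so sums of forms need their presentations merged.\<close>

lemma form_comb_add:
  assumes "form_terms G V e n a f z" "form_terms G V e n' a' f' z'"
  shows "\<exists>m b g y. form_terms G V e m b g y \<and>
    form_comb G V m b g y = form_comb G V n a f z + form_comb G V n' a' f' z'"
proof (intro exI conjI)
  let ?b = "\<lambda>l. if l < n then a l else a' (l - n)"
  let ?g = "\<lambda>l. if l < n then f l else f' (l - n)"
  let ?y = "\<lambda>l. if l < n then z l else z' (l - n)"
  show "form_terms G V e (n + n') ?b ?g ?y"
    using assms by (auto simp: form_terms_def)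
  have "(\<Sum>l<n + n'. form_smul G V (?b l) (?g l) (dform G V (?y l))) =
      (\<Sum>l<n. form_smul G V (?b l) (?g l) (dform G V (?y l))) +
      (\<Sum>l<n'. form_smul G V (?b (l + n)) (?g (l + n)) (dform G V (?y (l + n))))"
    using sum.atLeastLessThan_concat[of 0 n "n + n'" "\<lambda>l. form_smul G V (?b l) (?g l) (dform G V (?y l))"]
      sum.shift_bounds_nat_ivl[of "\<lambda>l. form_smul G V (?b l) (?g l) (dform G V (?y l))" 0 n n']
    by (simp add: lessThan_atLeast0 add.commute)
  then show "form_comb G V (n + n') ?b ?g ?y = form_comb G V n a f z + form_comb G V n' a' f' z'"
    by (simp add: form_comb_def)
qed

lemma form_add_mem:
  assumes \<eta>: "\<eta> \<in> one_forms G U e" and \<theta>: "\<theta> \<in> one_forms G U e"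
  shows "\<eta> + \<theta> \<in> one_forms G U e"
proof (rule one_formsI)
  fix V j X assume "(\<eta> + \<theta>) V j X \<noteq> 0"
  then show "opn G V \<and> V \<subseteq> U \<and> X \<in> vector_fields G V j"
    using form_suppD[OF \<eta>, of V j X] form_suppD[OF \<theta>, of V j X]
    by (cases "\<eta> V j X = 0") simp_all
next
  fix V j X assume "opn G V" "V \<subseteq> U" "X \<in> vector_fields G V j"
  then show "(\<eta> + \<theta>) V j X \<in> sec G V (e + j)"
    using form_sec[OF \<eta>, of V X j] form_sec[OF \<theta>, of V X j] by (simp add: sec_add)
next
  fix V V' j X
  assume *: "opn G V" "V \<subseteq> U" "X \<in> vector_fields G V j" "opn G V'" "V' \<subseteq> V"
  show "res G V V' ((\<eta> + \<theta>) V j X) = (\<eta> + \<theta>) V' j (vf_restrict V' X)"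
    using form_res[OF \<eta> *] form_res[OF \<theta> *]
      res_add[OF *(1,4,5) form_sec[OF \<eta> *(1-3)] form_sec[OF \<theta> *(1-3)]] by simp
next
  fix p assume "p \<in> U"
  then obtain V n a f z where V: "opn G V" "p \<in> V" "V \<subseteq> U" "form_terms G V e n a f z"
    "form_restrict V \<eta> = form_comb G V n a f z"
    using form_rep[OF \<eta>] by blast
  \<comment> \<open>The second presentation is chosen inside the domain of the first, so only the
    first has to be restricted.\<close>
  obtain W n' a' f' z' where W: "opn G W" "p \<in> W" "W \<subseteq> V" "form_terms G W e n' a' f' z'"
    "form_restrict W \<theta> = form_comb G W n' a' f' z'"
    using form_rep_within[OF \<theta> V(1,3,2)] .
  let ?f = "\<lambda>l. res G V W (f l)" and ?z = "\<lambda>l. res G V W (z l)"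
  have t: "form_terms G W e n a ?f ?z"
    using form_terms_restrict[OF V(4,1) W(1,3)] .
  have "form_restrict W \<eta> = form_comb G W n a ?f ?z"
    using form_comb_restrict[OF V(4,1) W(1,3)] form_restrict_restrict[OF W(3), of \<eta>] V(5) by simp
  moreover have "form_restrict W (\<eta> + \<theta>) = form_restrict W \<eta> + form_restrict W \<theta>"
    by (auto simp: form_restrict_def fun_eq_iff)
  ultimately show "\<exists>V n a f z. opn G V \<and> p \<in> V \<and> V \<subseteq> U \<and> form_terms G V e n a f z \<and>
      form_restrict V (\<eta> + \<theta>) = form_comb G V n a f z"
    using form_comb_add[OF t W(4)] W V(3) by (metis subset_trans)
qed

text \<open>The exponents add up, i (j + 1) + a (j + 1) = (i + a)(j + 1), so the coefficients are
  simply multiplied by \<open>h\<close> and no sign has to be corrected.\<close>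

lemma form_smul_comb:
  assumes t: "form_terms G V e n a f z" and V: "opn G V" and h: "h \<in> sec G V i"
  shows "form_terms G V (i + e) n (\<lambda>l. i + a l) (\<lambda>l. h * f l) z \<and>
    form_smul G V i h (form_comb G V n a f z) = form_comb G V n (\<lambda>l. i + a l) (\<lambda>l. h * f l) z"
proof
  show "form_terms G V (i + e) n (\<lambda>l. i + a l) (\<lambda>l. h * f l) z"
    using t h V by (simp add: form_terms_def sec_mult)
  show "form_smul G V i h (form_comb G V n a f z) = form_comb G V n (\<lambda>l. i + a l) (\<lambda>l. h * f l) z"
  proof (intro ext)
    fix W j X
    show "form_smul G V i h (form_comb G V n a f z) W j X =
        form_comb G V n (\<lambda>l. i + a l) (\<lambda>l. h * f l) z W j X"
    proof (cases "opn G W \<and> W \<subseteq> V \<and> X \<in> vector_fields G W j")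
      case True
      then show ?thesis
        using res_mult[OF V _ _ h form_termsD(1)[OF t], of W]
        by (auto simp: form_smul_def form_comb_apply kos_sum sum_distrib_left kos_mult_right kos_kos
            mult.assoc algebra_simps intro!: sum.cong)
    next
      case False
      then show ?thesis
        by (simp add: form_smul_def form_comb_supp)
    qed
  qed
qed

lemma form_smul_restrict:
  assumes \<eta>: "\<eta> \<in> one_forms G U e" and h: "h \<in> sec G U i" and U: "opn G U"
    and V: "opn G V" "V \<subseteq> U"
  shows "form_restrict V (form_smul G U i h \<eta>) = form_smul G V i (res G U V h) (form_restrict V \<eta>)"
proof (intro ext)
  fix W j X
  show "form_restrict V (form_smul G U i h \<eta>) W j X =
      form_smul G V i (res G U V h) (form_restrict V \<eta>) W j X"
    using form_supp[OF \<eta>, of W X j] res_res[OF U V(1) _ _ V(2) h, of W]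
    by (cases "opn G W") (auto simp: form_restrict_def form_smul_def)
qed

lemma form_smul_mem:
  assumes \<eta>: "\<eta> \<in> one_forms G U e" and h: "h \<in> sec G U i" and U: "opn G U"
  shows "form_smul G U i h \<eta> \<in> one_forms G U (i + e)"
proof (rule one_formsI)
  fix V j X assume "form_smul G U i h \<eta> V j X \<noteq> 0"
  then show "opn G V \<and> V \<subseteq> U \<and> X \<in> vector_fields G V j"
    using form_suppD[OF \<eta>, of V j X] by (cases "\<eta> V j X = 0") (simp_all add: form_smul_def)
next
  fix V j X assume *: "opn G V" "V \<subseteq> U" "X \<in> vector_fields G V j"
  show "form_smul G U i h \<eta> V j X \<in> sec G V (i + e + j)"
    using sec_mult[OF *(1) res_sec[OF U *(1,2) h] form_sec[OF \<eta> *]] *(1)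
    by (simp add: form_smul_def sec_kos add.assoc)
next
  fix V V' j X
  assume *: "opn G V" "V \<subseteq> U" "X \<in> vector_fields G V j" "opn G V'" "V' \<subseteq> V"
  show "res G V V' (form_smul G U i h \<eta> V j X) = form_smul G U i h \<eta> V' j (vf_restrict V' X)"
    using form_res[OF \<eta> *] res_mult[OF *(1,4,5) res_sec[OF U *(1,2) h] form_sec[OF \<eta> *(1-3)]]
      res_kos[OF *(1,4,5) sec_mult[OF *(1) res_sec[OF U *(1,2) h] form_sec[OF \<eta> *(1-3)]]]
      res_res[OF U *(1,4,5,2) h]
    by (simp add: form_smul_def)
next
  fix p assume "p \<in> U"
  then obtain V n a f z where V: "opn G V" "p \<in> V" "V \<subseteq> U" "form_terms G V e n a f z"
    "form_restrict V \<eta> = form_comb G V n a f z"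
    using form_rep[OF \<eta>] by blast
  then show "\<exists>V n a f z. opn G V \<and> p \<in> V \<and> V \<subseteq> U \<and> form_terms G V (i + e) n a f z \<and>
      form_restrict V (form_smul G U i h \<eta>) = form_comb G V n a f z"
    using form_smul_comb[OF V(4,1) res_sec[OF U V(1,3) h]]
      form_smul_restrict[OF \<eta> h U V(1,3)] by metis
qed

lemma form_restrict_comb_self: "form_restrict U (form_comb G U n a f z) = form_comb G U n a f z"
  using form_comb_supp by (fastforce simp: form_restrict_def fun_eq_iff)

lemma form_comb_mem:
  assumes t: "form_terms G U e n a f z" and U: "opn G U"
  shows "form_comb G U n a f z \<in> one_forms G U e"
proof (rule one_formsI)
  fix V j X assume "form_comb G U n a f z V j X \<noteq> 0"
  then show "opn G V \<and> V \<subseteq> U \<and> X \<in> vector_fields G V j"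
    using form_comb_supp by blast
next
  fix V j X assume *: "opn G V" "V \<subseteq> U" "X \<in> vector_fields G V j"
  show "form_comb G U n a f z V j X \<in> sec G V (e + j)"
    unfolding form_comb_apply[OF *]
  proof (intro sec_sum sec_kos *(1))
    fix l assume "l \<in> {..<n}"
    then have "l < n" by simp
    then show "res G U V (f l) * X V (res G U V (z l)) \<in> sec G V (e + j)"
      using sec_mult[OF *(1) res_sec[OF U *(1,2) form_termsD(1)[OF t, of l]]
          vf_sec[OF *(3,1) subset_refl res_sec[OF U *(1,2) form_termsD(2)[OF t, of l]]]]
      by (simp add: algebra_simps)
  qed
next
  fix V V' j X
  assume *: "opn G V" "V \<subseteq> U" "X \<in> vector_fields G V j" "opn G V'" "V' \<subseteq> V"
  have m: "res G U V (f l) * X V (res G U V (z l)) \<in> sec G V (e + j)" if "l < n" for l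
    using sec_mult[OF *(1) res_sec[OF U *(1,2) form_termsD(1)[OF t that]]
          vf_sec[OF *(3,1) subset_refl res_sec[OF U *(1,2) form_termsD(2)[OF t that]]]]
    by (simp add: algebra_simps)
  have "res G V V' (form_comb G U n a f z V j X) =
     (\<Sum>l<n. res G V V' (kos (a l * (j + 1)) (res G U V (f l) * X V (res G U V (z l)))))"
    unfolding form_comb_apply[OF *(1-3)]
    by (rule res_sum[OF *(1,4,5), of _ _ "e + j"]) (simp add: sec_kos * m)
  also have "\<dots> = form_comb G U n a f z V' j (vf_restrict V' X)"
    unfolding form_comb_apply[OF *(4) subset_trans[OF *(5,2)] vf_restrict_mem[OF *(3,5)]]
  proof (rule sum.cong[OF refl])
    fix l assume "l \<in> {..<n}"
    then have l: "l < n" by simp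
    note f = res_sec[OF U *(1,2) form_termsD(1)[OF t l]]
    note z = res_sec[OF U *(1,2) form_termsD(2)[OF t l]]
    show "res G V V' (kos (a l * (j + 1)) (res G U V (f l) * X V (res G U V (z l)))) =
        kos (a l * (j + 1)) (res G U V' (f l) * vf_restrict V' X V' (res G U V' (z l)))"
      using res_kos[OF *(1,4,5) m[OF l]] vf_res[OF *(3,1) subset_refl *(4,5) z]
        res_mult[OF *(1,4,5) f vf_sec[OF *(3,1) subset_refl z]]
        res_res[OF U *(1,4,5,2) form_termsD(1)[OF t l]]
        res_res[OF U *(1,4,5,2) form_termsD(2)[OF t l]]
      by (simp add: vf_restrict_def)
  qed
  finally show "res G V V' (form_comb G U n a f z V j X) =
    form_comb G U n a f z V' j (vf_restrict V' X)" .
next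
  fix p assume "p \<in> U"
  then show "\<exists>V n' a' f' z'. opn G V \<and> p \<in> V \<and> V \<subseteq> U \<and> form_terms G V e n' a' f' z' \<and>
      form_restrict V (form_comb G U n a f z) = form_comb G V n' a' f' z'"
    using t U \<open>p \<in> U\<close> form_restrict_comb_self by blast
qed

lemma form_kos_mem:
  assumes \<eta>: "\<eta> \<in> one_forms G U e"
  shows "kos n \<eta> \<in> one_forms G U e"
proof (rule one_formsI)
  fix V j X assume "kos n \<eta> V j X \<noteq> 0"
  then show "opn G V \<and> V \<subseteq> U \<and> X \<in> vector_fields G V j"
    using form_suppD[OF \<eta>, of V j X] by (simp add: kos_def split: if_splits)
next
  fix V j X assume "opn G V" "V \<subseteq> U" "X \<in> vector_fields G V j"
  then show "kos n \<eta> V j X \<in> sec G V (e + j)"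
    using form_sec[OF \<eta>] by (simp add: kos_apply sec_kos)
next
  fix V W j X assume *: "opn G V" "V \<subseteq> U" "X \<in> vector_fields G V j" "opn G W" "W \<subseteq> V"
  show "res G V W (kos n \<eta> V j X) = kos n \<eta> W j (vf_restrict W X)"
    using res_kos[OF *(1,4,5) form_sec[OF \<eta> *(1-3)]] form_res[OF \<eta> *] by (simp add: kos_apply)
next
  fix p assume p: "p \<in> U"
  obtain V m a f z where V: "opn G V" "p \<in> V" "V \<subseteq> U" and t: "form_terms G V e m a f z"
    and r: "form_restrict V \<eta> = form_comb G V m a f z"
    using form_rep[OF \<eta> p] by blast
  \<comment> \<open>The sign is absorbed into the coefficients, which leaves all degrees
    unchanged.\<close>
  have t': "form_terms G V e m a (\<lambda>l. kos n (f l)) z"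
    using t V(1) by (simp add: form_terms_def sec_kos)
  have "form_restrict V (kos n \<eta>) = kos n (form_restrict V \<eta>)"
    by (auto simp: form_restrict_def kos_apply fun_eq_iff)
  also have "\<dots> = kos n (form_comb G V m a f z)"
    by (simp only: r)
  also have "\<dots> = form_comb G V m a (\<lambda>l. kos n (f l)) z"
  proof (intro ext)
    fix W j X
    show "kos n (form_comb G V m a f z) W j X = form_comb G V m a (\<lambda>l. kos n (f l)) z W j X"
    proof (cases "opn G W \<and> W \<subseteq> V \<and> X \<in> vector_fields G W j")
      case True
      then show ?thesis
        using res_kos[OF V(1) _ _ form_termsD(1)[OF t], of W]
        by (auto simp: form_comb_apply kos_apply kos_sum kos_kos kos_mult_left add.commute
            intro!: sum.cong)
    next
      case False
      then show ?thesis
        by (simp add: kos_apply form_comb_supp)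
    qed
  qed
  finally show "\<exists>V m a f z. opn G V \<and> p \<in> V \<and> V \<subseteq> U \<and> form_terms G V e m a f z \<and>
      form_restrict V (kos n \<eta>) = form_comb G V m a f z"
    using V t' by blast
qed

lemma form_minus_mem: "\<eta> \<in> one_forms G U e \<Longrightarrow> - \<eta> \<in> one_forms G U e"
  using form_kos_mem[of \<eta> U e 1] by (simp add: kos_def)

lemma form_smul_minus: "form_smul G U i f (- \<eta>) = - form_smul G U i f \<eta>"
  by (simp add: form_smul_def fun_eq_iff kos_minus)

section \<open>Gluing of one-forms\<close>

lemma sheaf_glue:
  assumes C: "\<And>V. V \<in> C \<Longrightarrow> opn G V" and s: "\<And>V. V \<in> C \<Longrightarrow> s V \<in> sec G V d"
    and ov: "\<And>V W. V \<in> C \<Longrightarrow> W \<in> C \<Longrightarrow> res G V (V \<inter> W) (s V) = res G W (V \<inter> W) (s W)"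
  shows "\<exists>x\<in>sec G (\<Union> C) d. \<forall>V\<in>C. res G (\<Union> C) V x = s V"
  by (rule glue[unfolded sheaf_gluing_def, rule_format, OF C, THEN conjunct2, rule_format])
    (use s ov in blast)+

text \<open>Since a form is the family of its contractions, gluing forms reduces to gluing sections
  separately for each \<open>W\<close> and \<open>X\<close>. Uniqueness of glued sections makes the
  resulting values compatible with restriction, and near each point a presentation is taken over
  from the given piece.\<close>

lemma form_glue:
  assumes V: "\<And>p. p \<in> U \<Longrightarrow> opn G (V p) \<and> p \<in> V p \<and> V p \<subseteq> U"
    and \<eta>: "\<And>p. p \<in> U \<Longrightarrow> \<eta> p \<in> one_forms G (V p) e"
    and ov: "\<And>p q. p \<in> U \<Longrightarrow> q \<in> U \<Longrightarrow>
      form_restrict (V p \<inter> V q) (\<eta> p) = form_restrict (V p \<inter> V q) (\<eta> q)"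
  obtains \<theta> where "\<theta> \<in> one_forms G U e" "\<And>p. p \<in> U \<Longrightarrow> form_restrict (V p) \<theta> = \<eta> p"
proof -
  \<comment> \<open>The property that singles out the glued contraction with \<open>X\<close> over
    \<open>W\<close>.\<close>
  define P where "P W j X x \<longleftrightarrow> x \<in> sec G W (e + j) \<and>
    (\<forall>p\<in>U. res G W (W \<inter> V p) x = \<eta> p (W \<inter> V p) j (vf_restrict (W \<inter> V p) X))" for W j X x
  have agree: "\<eta> p W = \<eta> q W" if "p \<in> U" "q \<in> U" "W \<subseteq> V p" "W \<subseteq> V q" for p q W
    using fun_cong[OF ov[OF that(1,2)], of W] that by (auto simp: form_restrict_def fun_eq_iff)
  have ex: "\<exists>x. P W j X x" if W: "opn G W" "W \<subseteq> U" and X: "X \<in> vector_fields G W j" for W j X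
  proof -
    \<comment> \<open>The gluing axiom takes families indexed by open sets, not by points, so each
      piece \<open>A\<close> of the cover gets one point from which it arises. By
      \<open>agree\<close> the choice has no influence on the values.\<close>
    define c where "c A = (SOME p. p \<in> U \<and> A = W \<inter> V p)" for A
    let ?C = "(\<lambda>p. W \<inter> V p) ` U"
    let ?s = "\<lambda>A. \<eta> (c A) A j (vf_restrict A X)"
    have c: "c A \<in> U \<and> A = W \<inter> V (c A)" if "A \<in> ?C" for A
      unfolding c_def by (rule someI_ex) (use that in blast)
    have UC: "\<Union> ?C = W"
      using V W by blast
    have oA: "opn G A" "A \<subseteq> W" if "A \<in> ?C" for A
      using that V W by (auto simp: opn_Int)
    have eta_A: "\<eta> (c A) \<in> one_forms G (V (c A)) e" "A \<subseteq> V (c A)" "c A \<in> U" if "A \<in> ?C" for A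
      using c[OF that] \<eta> by blast+
    have "\<exists>x\<in>sec G (\<Union> ?C) (e + j). \<forall>A\<in>?C. res G (\<Union> ?C) A x = ?s A"
    proof (rule sheaf_glue)
      show "opn G A" if "A \<in> ?C" for A
        using oA[OF that] by simp
      show "?s A \<in> sec G A (e + j)" if "A \<in> ?C" for A
        using form_sec[OF eta_A(1)[OF that] oA(1)[OF that] eta_A(2)[OF that]
            vf_restrict_mem[OF X oA(2)[OF that]]] .
      fix A A' assume A: "A \<in> ?C" and A': "A' \<in> ?C"
      have o: "opn G (A \<inter> A')"
        using oA A A' by (simp add: opn_Int)
      have "res G A (A \<inter> A') (?s A) = \<eta> (c A) (A \<inter> A') j (vf_restrict (A \<inter> A') X)"
        using form_res[OF eta_A(1)[OF A] oA(1)[OF A] eta_A(2)[OF A]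
            vf_restrict_mem[OF X oA(2)[OF A]] o Int_lower1]
          vf_restrict_restrict[of "A \<inter> A'" A X] by simp
      moreover have "res G A' (A \<inter> A') (?s A') = \<eta> (c A') (A \<inter> A') j (vf_restrict (A \<inter> A') X)"
        using form_res[OF eta_A(1)[OF A'] oA(1)[OF A'] eta_A(2)[OF A']
            vf_restrict_mem[OF X oA(2)[OF A']] o Int_lower2]
          vf_restrict_restrict[of "A \<inter> A'" A' X] by simp
      moreover have "\<eta> (c A) (A \<inter> A') = \<eta> (c A') (A \<inter> A')"
        using eta_A[OF A] eta_A[OF A'] by (intro agree) auto
      ultimately show "res G A (A \<inter> A') (?s A) = res G A' (A \<inter> A') (?s A')"
        by simp
    qed
    then obtain x where x: "x \<in> sec G W (e + j)" "\<And>A. A \<in> ?C \<Longrightarrow> res G W A x = ?s A"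
      unfolding UC by blast
    have "res G W (W \<inter> V p) x = \<eta> p (W \<inter> V p) j (vf_restrict (W \<inter> V p) X)" if p: "p \<in> U" for p
    proof -
      have A: "W \<inter> V p \<in> ?C"
        using p by blast
      have "\<eta> (c (W \<inter> V p)) (W \<inter> V p) = \<eta> p (W \<inter> V p)"
        using eta_A[OF A] p by (intro agree) auto
      then show ?thesis
        using x(2)[OF A] by simp
    qed
    then show ?thesis
      using x(1) unfolding P_def by blast
  qed
  have uniq: "x = y" if W: "opn G W" "W \<subseteq> U" and P: "P W j X x" "P W j X y" for W j X x y
  proof (rule sec_eqI[OF W(1)])
    show "x \<in> sec G W (e + j)" "y \<in> sec G W (e + j)"
      using P by (simp_all add: P_def)
    fix p assume p: "p \<in> W"
    then show "\<exists>V. opn G V \<and> p \<in> V \<and> V \<subseteq> W \<and> res G W V x = res G W V y"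
      using P V[of p] W unfolding P_def
      by (intro exI[of _ "W \<inter> V p"]) (auto simp: opn_Int)
  qed
  define \<theta> where "\<theta> = (\<lambda>W j X. if opn G W \<and> W \<subseteq> U \<and> X \<in> vector_fields G W j
    then SOME x. P W j X x else 0)"
  have \<theta>: "P W j X (\<theta> W j X)" if "opn G W" "W \<subseteq> U" "X \<in> vector_fields G W j" for W j X
    using that someI_ex[OF ex[OF that]] by (simp add: \<theta>_def)
  have restr: "form_restrict (V p) \<theta> = \<eta> p" if p: "p \<in> U" for p
  proof (intro ext)
    fix W j X
    show "form_restrict (V p) \<theta> W j X = \<eta> p W j X"
    proof (cases "opn G W \<and> W \<subseteq> V p \<and> X \<in> vector_fields G W j")
      case False
      then show ?thesis
        using form_supp[OF \<eta>[OF p] False] V[OF p] by (auto simp: form_restrict_def \<theta>_def)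
    next
      case True
      then have W: "opn G W" "W \<subseteq> V p" "X \<in> vector_fields G W j"
        by blast+
      then have P: "P W j X (\<theta> W j X)"
        using \<theta> V[OF p] by blast
      have "W \<inter> V p = W"
        using W by blast
      then have "res G W W (\<theta> W j X) = \<eta> p W j (vf_restrict W X)"
        using P p unfolding P_def by metis
      moreover have "res G W W (\<theta> W j X) = \<theta> W j X"
        using P res_id[OF W(1)] unfolding P_def by blast
      ultimately show ?thesis
        using W(2) vf_restrict_self[OF W(3)] by (simp add: form_restrict_def)
    qed
  qed
  have "\<theta> \<in> one_forms G U e"
  proof (rule one_formsI)
    fix W j X assume "\<theta> W j X \<noteq> 0"
    then show "opn G W \<and> W \<subseteq> U \<and> X \<in> vector_fields G W j"
      unfolding \<theta>_def by (simp split: if_splits)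
  next
    fix W j X assume "opn G W" "W \<subseteq> U" "X \<in> vector_fields G W j"
    then show "\<theta> W j X \<in> sec G W (e + j)"
      using \<theta> unfolding P_def by blast
  next
    fix W W' j X assume *: "opn G W" "W \<subseteq> U" "X \<in> vector_fields G W j" "opn G W'" "W' \<subseteq> W"
    have W'U: "W' \<subseteq> U"
      using * by blast
    show "res G W W' (\<theta> W j X) = \<theta> W' j (vf_restrict W' X)"
    \<comment> \<open>By uniqueness it suffices that the restricted section has the property that
      characterises the value over \<open>W'\<close>.\<close>
    proof (rule uniq[OF *(4) W'U _ \<theta>[OF *(4) W'U vf_restrict_mem[OF *(3,5)]]])
      have s: "\<theta> W j X \<in> sec G W (e + j)"
        using \<theta>[OF *(1-3)] unfolding P_def by blast
      have "res G W' (W' \<inter> V p) (res G W W' (\<theta> W j X)) =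
          \<eta> p (W' \<inter> V p) j (vf_restrict (W' \<inter> V p) (vf_restrict W' X))" if p: "p \<in> U" for p
      proof -
        have o: "opn G (W \<inter> V p)" "opn G (W' \<inter> V p)"
          using * V[OF p] by (auto simp: opn_Int)
        have i: "W' \<inter> V p \<subseteq> W \<inter> V p" "W \<inter> V p \<subseteq> V p" "W \<inter> V p \<subseteq> W"
          using * by blast+
        \<comment> \<open>Restricting from \<open>W\<close> to \<open>W' \<inter> V p\<close>
          through \<open>W'\<close> or through \<open>W \<inter> V p\<close> gives the same result,
          and the value over \<open>W \<inter> V p\<close> is known.\<close>
        have "res G W' (W' \<inter> V p) (res G W W' (\<theta> W j X)) =
            res G (W \<inter> V p) (W' \<inter> V p) (res G W (W \<inter> V p) (\<theta> W j X))"
          using res_res[OF *(1,4) o(2) _ *(5) s] res_res[OF *(1) o i(1,3) s] by simp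
        also have "\<dots> = \<eta> p (W' \<inter> V p) j (vf_restrict (W' \<inter> V p) (vf_restrict (W \<inter> V p) X))"
          using \<theta>[OF *(1-3)] p form_res[OF \<eta>[OF p] o(1) i(2) vf_restrict_mem[OF *(3) i(3)] o(2) i(1)]
          unfolding P_def by metis
        finally show ?thesis
          using vf_restrict_restrict[OF i(1), of X] vf_restrict_restrict[of "W' \<inter> V p" W' X] by simp
      qed
      then show "P W' j (vf_restrict W' X) (res G W W' (\<theta> W j X))"
        using res_sec[OF *(1,4,5) s] unfolding P_def by blast
    qed
  next
    fix p assume p: "p \<in> U"
    obtain W n a f z where W: "opn G W" "p \<in> W" "W \<subseteq> V p" "form_terms G W e n a f z"
      "form_restrict W (\<eta> p) = form_comb G W n a f z"
      using form_rep[OF \<eta>[OF p]] V[OF p] by blast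
    have "form_restrict W \<theta> = form_comb G W n a f z"
      using restr[OF p] form_restrict_restrict[OF W(3), of \<theta>] W(5) by simp
    then show "\<exists>V n a f z. opn G V \<and> p \<in> V \<and> V \<subseteq> U \<and> form_terms G V e n a f z \<and>
        form_restrict V \<theta> = form_comb G V n a f z"
      using W V[OF p] by blast
  qed
  then show thesis
    using restr that by blast
qed

end

section \<open>Poisson brackets\<close>

locale poisson_sheaf = graded_sheaf G
  for G :: "('m, 'a::real_algebra) gmfd" +
  fixes k :: int and B :: "'m set \<Rightarrow> 'a \<Rightarrow> 'a \<Rightarrow> 'a"
  assumes poisson: "poisson_bracket G k B"
begin

context
  fixes U
  assumes U: "opn G U"
begin

lemma pb_sec: "\<xi> \<in> sec G U i \<Longrightarrow> \<zeta> \<in> sec G U j \<Longrightarrow> B U \<xi> \<zeta> \<in> sec G U (i + j + k)"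
  by (rule poisson[unfolded poisson_bracket_def, rule_format, OF U, THEN conjunct1, rule_format])

lemma pb_lin:
  "\<xi> \<in> sec G U i \<Longrightarrow> \<zeta> \<in> sec G U j \<Longrightarrow> \<zeta>' \<in> sec G U j \<Longrightarrow>
    B U \<xi> (c *\<^sub>R \<zeta> + \<zeta>') = c *\<^sub>R B U \<xi> \<zeta> + B U \<xi> \<zeta>'"
  by (rule poisson[unfolded poisson_bracket_def, rule_format, OF U, THEN conjunct2,
      THEN conjunct2, THEN conjunct1, rule_format])

lemma pb_res:
  "opn G V \<Longrightarrow> V \<subseteq> U \<Longrightarrow> \<xi> \<in> sec G U i \<Longrightarrow> \<zeta> \<in> sec G U j \<Longrightarrow>
    res G U V (B U \<xi> \<zeta>) = B V (res G U V \<xi>) (res G U V \<zeta>)"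
  by (rule poisson[unfolded poisson_bracket_def, rule_format, OF U, THEN conjunct2,
      THEN conjunct2, THEN conjunct2, THEN conjunct1, rule_format, OF conjI])

lemma pb_skew:
  "\<xi> \<in> sec G U i \<Longrightarrow> \<zeta> \<in> sec G U j \<Longrightarrow> B U \<xi> \<zeta> = - kos ((i + k) * (j + k)) (B U \<zeta> \<xi>)"
  by (rule poisson[unfolded poisson_bracket_def, rule_format, OF U, THEN conjunct2,
      THEN conjunct2, THEN conjunct2, THEN conjunct2, THEN conjunct1, rule_format])

lemma pb_leibniz:
  "\<xi>\<^sub>1 \<in> sec G U i\<^sub>1 \<Longrightarrow> \<xi>\<^sub>2 \<in> sec G U i\<^sub>2 \<Longrightarrow> \<xi>\<^sub>3 \<in> sec G U i\<^sub>3 \<Longrightarrow>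
    B U \<xi>\<^sub>1 (\<xi>\<^sub>2 * \<xi>\<^sub>3) = B U \<xi>\<^sub>1 \<xi>\<^sub>2 * \<xi>\<^sub>3 + kos ((i\<^sub>1 + k) * i\<^sub>2) (\<xi>\<^sub>2 * B U \<xi>\<^sub>1 \<xi>\<^sub>3)"
  by (rule poisson[unfolded poisson_bracket_def, rule_format, OF U, THEN conjunct2,
      THEN conjunct2, THEN conjunct2, THEN conjunct2, THEN conjunct2, THEN conjunct1, rule_format])

end

section \<open>Hamiltonian vector fields\<close>

lemma hamiltonian_apply:
  "opn G V \<Longrightarrow> V \<subseteq> U \<Longrightarrow> \<zeta> \<in> sec G V i \<Longrightarrow> hamiltonian G B U \<xi> V \<zeta> = B V (res G U V \<xi>) \<zeta>"
  unfolding hamiltonian_def by (rule if_P) (intro conjI exI)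

lemma hamiltonian_mem:
  assumes U: "opn G U" and \<xi>: "\<xi> \<in> sec G U i"
  shows "hamiltonian G B U \<xi> \<in> vector_fields G U (i + k)"
proof (rule vector_fieldsI)
  fix V \<zeta> assume "hamiltonian G B U \<xi> V \<zeta> \<noteq> 0"
  then show "opn G V \<and> V \<subseteq> U \<and> (\<exists>i. \<zeta> \<in> sec G V i)"
    unfolding hamiltonian_def by presburger
next
  fix V m \<zeta> assume *: "opn G V" "V \<subseteq> U" "\<zeta> \<in> sec G V m"
  then show "hamiltonian G B U \<xi> V \<zeta> \<in> sec G V (m + (i + k))"
    using pb_sec[OF *(1) res_sec[OF U *(1,2) \<xi>] *(3)]
    by (simp add: hamiltonian_apply[OF *] algebra_simps)
next
  fix V m \<zeta> \<zeta>' c assume *: "opn G V" "V \<subseteq> U" "\<zeta> \<in> sec G V m" "\<zeta>' \<in> sec G V m"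
  have "c *\<^sub>R \<zeta> + \<zeta>' \<in> sec G V m"
    using * by (simp add: sec_add sec_scaleR)
  then show "hamiltonian G B U \<xi> V (c *\<^sub>R \<zeta> + \<zeta>') =
      c *\<^sub>R hamiltonian G B U \<xi> V \<zeta> + hamiltonian G B U \<xi> V \<zeta>'"
    using pb_lin[OF *(1) res_sec[OF U *(1,2) \<xi>] *(3,4)]
    by (simp add: hamiltonian_apply[OF *(1,2,3)] hamiltonian_apply[OF *(1,2,4)]
        hamiltonian_apply[OF *(1,2)])
next
  fix V m m' \<zeta> \<zeta>' assume *: "opn G V" "V \<subseteq> U" "\<zeta> \<in> sec G V m" "\<zeta>' \<in> sec G V m'"
  then show "hamiltonian G B U \<xi> V (\<zeta> * \<zeta>') =
      hamiltonian G B U \<xi> V \<zeta> * \<zeta>' + kos ((i + k) * m) (\<zeta> * hamiltonian G B U \<xi> V \<zeta>')"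
    using pb_leibniz[OF *(1) res_sec[OF U *(1,2) \<xi>] *(3,4)]
      hamiltonian_apply[OF *(1,2) sec_mult[OF *(1,3,4)]]
    by (simp add: hamiltonian_apply[OF *(1,2)])
next
  fix V V' m \<zeta> assume *: "opn G V" "V \<subseteq> U" "opn G V'" "V' \<subseteq> V" "\<zeta> \<in> sec G V m"
  show "res G V V' (hamiltonian G B U \<xi> V \<zeta>) = hamiltonian G B U \<xi> V' (res G V V' \<zeta>)"
    using pb_res[OF *(1,3,4) res_sec[OF U *(1,2) \<xi>] *(5)]
      hamiltonian_apply[OF *(1,2,5)] res_res[OF U *(1,3,4,2) \<xi>]
      hamiltonian_apply[OF *(3) subset_trans[OF *(4,2)] res_sec[OF *(1,3,4,5)]]
    by simp
qed

lemma hamiltonian_restrict: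
  assumes U: "opn G U" and \<xi>: "\<xi> \<in> sec G U i" and V: "opn G V" "V \<subseteq> U"
  shows "vf_restrict V (hamiltonian G B U \<xi>) = hamiltonian G B V (res G U V \<xi>)"
proof (intro ext)
  fix W \<zeta>
  show "vf_restrict V (hamiltonian G B U \<xi>) W \<zeta> = hamiltonian G B V (res G U V \<xi>) W \<zeta>"
    using res_res[OF U V(1) _ _ V(2) \<xi>, of W] V(2)
    by (cases "opn G W \<and> W \<subseteq> V") (auto simp: vf_restrict_def hamiltonian_def)
qed

text \<open>Skew symmetry moves the 0 into the second argument, where linearity applies. The zero
  section has every degree, and this lemma makes formulas in terms of Hamiltonian fields insensitive
  to which one is assigned to it.\<close>

lemma hamiltonian_zero:
  assumes "opn G U"
  shows "hamiltonian G B U 0 = 0"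
proof (intro ext)
  fix V \<zeta>
  show "hamiltonian G B U 0 V \<zeta> = 0 V \<zeta>"
  proof (cases "opn G V \<and> V \<subseteq> U \<and> (\<exists>i. \<zeta> \<in> sec G V i)")
    case True
    then obtain i where V: "opn G V" "V \<subseteq> U" "\<zeta> \<in> sec G V i"
      by blast
    have "B V \<zeta> 0 = 0"
      using pb_lin[OF V(1,3) sec_zero[OF V(1)] sec_zero[OF V(1)], of 1] by simp
    then show ?thesis
      using pb_skew[OF V(1) sec_zero[OF V(1)] V(3)] hamiltonian_apply[OF V, of 0]
        res_zero[OF assms V(1,2)] by simp
  next
    case False
    then show ?thesis
      unfolding hamiltonian_def if_not_P[OF False] by simp
  qed
qed

text \<open>By skew symmetry, the contraction of \<open>d\<xi>\<close> with the Hamiltonian vector field of \<open>\<zeta>\<close> is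
  \<open>\<pm> {\<xi>, \<zeta>}\<close>; this gives \<open>\<pi>\<^sup>\<sharp> \<eta>\<close> without reference to a presentation of \<open>\<eta>\<close>.  The degree of
  \<open>\<zeta>\<close> is unique unless \<open>\<zeta> = 0\<close>, in which case the value is \<open>0\<close> anyway.\<close>

definition pi_vf :: "'m set \<Rightarrow> int \<Rightarrow> ('m, 'a) form \<Rightarrow> ('m, 'a) vf"
  where "pi_vf U e \<eta> = (\<lambda>V \<zeta>. if opn G V \<and> V \<subseteq> U \<and> (\<exists>i. \<zeta> \<in> sec G V i) then
    (let i = SOME i. \<zeta> \<in> sec G V i in
      - kos ((e + k) * (i + k)) (\<eta> V (i + k) (hamiltonian G B V \<zeta>))) else 0)"

lemma pi_vf_suppD:
  "pi_vf U e \<eta> V \<zeta> \<noteq> 0 \<Longrightarrow> opn G V \<and> V \<subseteq> U \<and> (\<exists>i. \<zeta> \<in> sec G V i)"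
  unfolding pi_vf_def by presburger

lemma pi_vf_apply:
  assumes \<eta>: "\<eta> \<in> one_forms G U e" and V: "opn G V" "V \<subseteq> U" and \<zeta>: "\<zeta> \<in> sec G V i"
  shows "pi_vf U e \<eta> V \<zeta> = - kos ((e + k) * (i + k)) (\<eta> V (i + k) (hamiltonian G B V \<zeta>))"
proof -
  let ?i = "SOME i. \<zeta> \<in> sec G V i"
  have i: "\<zeta> \<in> sec G V ?i"
    using \<zeta> by (rule someI)
  have c: "opn G V \<and> V \<subseteq> U \<and> (\<exists>i. \<zeta> \<in> sec G V i)"
    using V \<zeta> by blast
  have eq: "pi_vf U e \<eta> V \<zeta> = - kos ((e + k) * (?i + k)) (\<eta> V (?i + k) (hamiltonian G B V \<zeta>))"
    unfolding pi_vf_def Let_def if_P[OF c] ..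
  show ?thesis
  proof (cases "\<zeta> = 0")
    case True
    then show ?thesis
      using eq form_vf_zero[OF \<eta>] hamiltonian_zero[OF V(1)] by simp
  next
    case False
    then have "?i = i"
      using sec_degree_unique[OF V(1) i \<zeta>] by simp
    then show ?thesis
      using eq by simp
  qed
qed

text \<open>The link between the closed formula and the rule that defines \<open>pi_sharp\<close>.
  The left-hand side does not depend on the presentation, so this also proves that the right-hand
  side does not.\<close>

lemma pi_vf_comb:
  assumes \<eta>: "\<eta> \<in> one_forms G U e" and V: "opn G V" "V \<subseteq> U"
    and t: "form_terms G V e n a f z" and r: "form_restrict V \<eta> = form_comb G V n a f z"
  shows "vf_restrict V (pi_vf U e \<eta>) =
    (\<Sum>l<n. kos (a l) (vf_smul G V (f l) (hamiltonian G B V (z l))))"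
proof (intro ext)
  fix W \<zeta>
  let ?S = "\<Sum>l<n. kos (a l) (vf_smul G V (f l) (hamiltonian G B V (z l)))"
  have S: "?S W \<zeta> = (\<Sum>l<n. kos (a l) (res G V W (f l) * hamiltonian G B V (z l) W \<zeta>))"
    by (simp add: sum_apply1 kos_apply vf_smul_def)
  show "vf_restrict V (pi_vf U e \<eta>) W \<zeta> = ?S W \<zeta>"
  proof (cases "opn G W \<and> W \<subseteq> V \<and> (\<exists>i. \<zeta> \<in> sec G W i)")
    case False
    have "hamiltonian G B V (z l) W \<zeta> = 0" for l
      unfolding hamiltonian_def if_not_P[OF False] ..
    moreover have "vf_restrict V (pi_vf U e \<eta>) W \<zeta> = 0"
      using False pi_vf_suppD[of U e \<eta> W \<zeta>] by (auto simp: vf_restrict_def)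
    ultimately show ?thesis
      unfolding S by simp
  next
    case True
    then obtain i where W: "opn G W" "W \<subseteq> V" and \<zeta>: "\<zeta> \<in> sec G W i"
      by blast
    have "vf_restrict V (pi_vf U e \<eta>) W \<zeta> =
        - kos ((e + k) * (i + k)) (\<eta> W (i + k) (hamiltonian G B W \<zeta>))"
      using pi_vf_apply[OF \<eta> W(1) subset_trans[OF W(2) V(2)] \<zeta>] W by (simp add: vf_restrict_def)
    also have "\<dots> = (\<Sum>l<n. - kos ((e + k) * (i + k)) (kos (a l * (i + k + 1))
        (res G V W (f l) * hamiltonian G B W \<zeta> W (res G V W (z l)))))"
      unfolding form_restrict_eval[OF r W hamiltonian_mem[OF W(1) \<zeta>]] kos_sum sum_negf ..
    also have "\<dots> = ?S W \<zeta>"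
      unfolding S
    proof (rule sum.cong[OF refl])
      fix l assume "l \<in> {..<n}"
      then have l: "l < n" by simp
      have z: "res G V W (z l) \<in> sec G W (e - a l)"
        using res_sec[OF V(1) W form_termsD(2)[OF t l]] .
      have h: "hamiltonian G B W \<zeta> W (res G V W (z l)) = B W \<zeta> (res G V W (z l))"
        using hamiltonian_apply[OF W(1) subset_refl z] res_id[OF W(1) \<zeta>] by simp
      have h': "hamiltonian G B V (z l) W \<zeta> =
          - kos ((e - a l + k) * (i + k)) (B W \<zeta> (res G V W (z l)))"
        using hamiltonian_apply[OF W \<zeta>] pb_skew[OF W(1) z \<zeta>] by simp
      \<comment> \<open>After skew symmetry the exponents (e + k)(i + k) + a (i + k + 1) and a + (e
        - a + k)(i + k) have to agree modulo 2, where a stands for \<open>a l\<close>.\<close>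
      show "- kos ((e + k) * (i + k)) (kos (a l * (i + k + 1))
          (res G V W (f l) * hamiltonian G B W \<zeta> W (res G V W (z l)))) =
          kos (a l) (res G V W (f l) * hamiltonian G B V (z l) W \<zeta>)"
        unfolding h h'
        by (cases "even (a l)"; cases "even e"; cases "even i"; cases "even k")
          (simp_all add: kos_def)
    qed
    finally show ?thesis .
  qed
qed

text \<open>Degree and compatibility with restriction can be read off the formula, but not the
  Leibniz rule, as \<zeta> enters through its Hamiltonian field. Locally the field is a combination
  of Hamiltonian fields of the \<open>z l\<close>, which is a derivation.\<close>

lemma pi_vf_mem:
  assumes \<eta>: "\<eta> \<in> one_forms G U e" and U: "opn G U"
  shows "pi_vf U e \<eta> \<in> vector_fields G U (e + k)"
proof (rule vf_localI)
  fix V i \<zeta> assume *: "opn G V" "V \<subseteq> U" "\<zeta> \<in> sec G V i"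
  show "pi_vf U e \<eta> V \<zeta> \<in> sec G V (i + (e + k))"
    using form_sec[OF \<eta> *(1,2) hamiltonian_mem[OF *(1,3)]] *(1)
    by (simp add: pi_vf_apply[OF \<eta> *] sec_minus sec_kos algebra_simps)
next
  fix V W i \<zeta> assume *: "opn G V" "V \<subseteq> U" "opn G W" "W \<subseteq> V" "\<zeta> \<in> sec G V i"
  note H = hamiltonian_mem[OF *(1,5)]
  show "res G V W (pi_vf U e \<eta> V \<zeta>) = pi_vf U e \<eta> W (res G V W \<zeta>)"
    using form_res[OF \<eta> *(1,2) H *(3,4)] hamiltonian_restrict[OF *(1,5,3,4)]
      res_minus[OF *(1,3,4) sec_kos[OF *(1) form_sec[OF \<eta> *(1,2) H]]]
      res_kos[OF *(1,3,4) form_sec[OF \<eta> *(1,2) H]]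
      pi_vf_apply[OF \<eta> *(1,2,5)]
      pi_vf_apply[OF \<eta> *(3) subset_trans[OF *(4,2)] res_sec[OF *(1,3,4,5)]]
    by simp
next
  fix p assume "p \<in> U"
  then obtain V n a f z where V: "opn G V" "p \<in> V" "V \<subseteq> U" and t: "form_terms G V e n a f z"
    and r: "form_restrict V \<eta> = form_comb G V n a f z"
    using form_rep[OF \<eta>] by blast
  have "(\<Sum>l<n. kos (a l) (vf_smul G V (f l) (hamiltonian G B V (z l))))
      \<in> vector_fields G V (e + k)"
  proof (intro vf_sum_mem vf_kos_mem V(1))
    fix l assume "l \<in> {..<n}"
    then show "vf_smul G V (f l) (hamiltonian G B V (z l)) \<in> vector_fields G V (e + k)"
      using vf_smul_mem[OF hamiltonian_mem[OF V(1) form_termsD(2)[OF t, of l]]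
          form_termsD(1)[OF t, of l] V(1)]
      by (simp add: algebra_simps)
  qed
  then show "\<exists>V. opn G V \<and> p \<in> V \<and> V \<subseteq> U \<and>
      vf_restrict V (pi_vf U e \<eta>) \<in> vector_fields G V (e + k)"
    using V pi_vf_comb[OF \<eta> V(1,3) t r] by metis
qed (rule pi_vf_suppD)

text \<open>Existence in the description is \<open>pi_vf_comb\<close>. Uniqueness holds because
  every point has a neighbourhood with a presentation, where any two candidates coincide.\<close>

lemma pi_sharp_eq:
  assumes \<eta>: "\<eta> \<in> one_forms G U e" and U: "opn G U"
  shows "pi_sharp G k B U e \<eta> = pi_vf U e \<eta>"
  unfolding pi_sharp_def
proof (rule the_equality)
  show "pi_vf U e \<eta> \<in> vector_fields G U (e + k) \<and>
    (\<forall>V n a f z. opn G V \<and> V \<subseteq> U \<and> form_terms G V e n a f z \<and>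
        form_restrict V \<eta> = form_comb G V n a f z \<longrightarrow>
      vf_restrict V (pi_vf U e \<eta>) =
        (\<Sum>l<n. kos (a l) (vf_smul G V (f l) (hamiltonian G B V (z l)))))"
    using pi_vf_mem[OF \<eta> U] pi_vf_comb[OF \<eta>] by blast
  fix X assume X: "X \<in> vector_fields G U (e + k) \<and>
    (\<forall>V n a f z. opn G V \<and> V \<subseteq> U \<and> form_terms G V e n a f z \<and>
        form_restrict V \<eta> = form_comb G V n a f z \<longrightarrow>
      vf_restrict V X = (\<Sum>l<n. kos (a l) (vf_smul G V (f l) (hamiltonian G B V (z l)))))"
  show "X = pi_vf U e \<eta>"
  proof (rule vf_eqI[OF X[THEN conjunct1] pi_vf_mem[OF \<eta> U]])
    fix p assume "p \<in> U"
    then obtain V n a f z where V: "opn G V" "p \<in> V" "V \<subseteq> U" and t: "form_terms G V e n a f z"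
      and r: "form_restrict V \<eta> = form_comb G V n a f z"
      using form_rep[OF \<eta>] by blast
    have "vf_restrict V X = vf_restrict V (pi_vf U e \<eta>)"
      using X[THEN conjunct2, rule_format, OF conjI[OF V(1) conjI[OF V(3) conjI[OF t r]]]]
        pi_vf_comb[OF \<eta> V(1,3) t r] by simp
    then show "\<exists>V. opn G V \<and> p \<in> V \<and> V \<subseteq> U \<and> vf_restrict V X = vf_restrict V (pi_vf U e \<eta>)"
      using V by blast
  qed
qed

lemma pi_vf_restrict:
  assumes \<eta>: "\<eta> \<in> one_forms G U e" and V: "opn G V" "V \<subseteq> U"
  shows "vf_restrict V (pi_vf U e \<eta>) = pi_vf V e (form_restrict V \<eta>)"
  using V by (auto simp: vf_restrict_def pi_vf_def form_restrict_def fun_eq_iff)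

lemma pi_vf_ext:
  assumes X: "X \<in> vector_fields G U j" and \<eta>: "\<eta> \<in> one_forms G U e"
    and eq: "\<And>V i \<zeta>. opn G V \<Longrightarrow> V \<subseteq> U \<Longrightarrow> \<zeta> \<in> sec G V i \<Longrightarrow>
      - kos ((e + k) * (i + k)) (\<eta> V (i + k) (hamiltonian G B V \<zeta>)) = X V \<zeta>"
  shows "pi_vf U e \<eta> = X"
proof (intro ext)
  fix V \<zeta>
  show "pi_vf U e \<eta> V \<zeta> = X V \<zeta>"
  proof (cases "opn G V \<and> V \<subseteq> U \<and> (\<exists>i. \<zeta> \<in> sec G V i)")
    case True
    then show ?thesis
      using pi_vf_apply[OF \<eta>] eq by metis
  next
    case False
    then show ?thesis
      using vf_suppD[OF X, of V \<zeta>] pi_vf_suppD[of U e \<eta> V \<zeta>] by metis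
  qed
qed

lemma pi_vf_add:
  assumes \<eta>: "\<eta> \<in> one_forms G U e" and \<theta>: "\<theta> \<in> one_forms G U e" and U: "opn G U"
  shows "pi_vf U e (\<eta> + \<theta>) = pi_vf U e \<eta> + pi_vf U e \<theta>"
  by (rule pi_vf_ext[OF vf_add_mem[OF pi_vf_mem[OF \<eta> U] pi_vf_mem[OF \<theta> U]]
        form_add_mem[OF \<eta> \<theta>]])
    (simp add: pi_vf_apply[OF \<eta>] pi_vf_apply[OF \<theta>] kos_add)

text \<open>The factor \<open>h\<close> raises the degree of the form and so adds c (i + k) to the
  exponent; multiplication by \<open>h\<close> adds c (i + k + 1) when contracting with a field of
  degree i + k. Together they leave the sign (-1)^c.\<close>

lemma pi_vf_smul:
  assumes \<eta>: "\<eta> \<in> one_forms G U e" and h: "h \<in> sec G U c" and U: "opn G U"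
  shows "pi_vf U (c + e) (form_smul G U c h \<eta>) = kos c (vf_smul G U h (pi_vf U e \<eta>))"
proof (rule pi_vf_ext[OF vf_kos_mem[OF vf_smul_mem[OF pi_vf_mem[OF \<eta> U] h U] U]
      form_smul_mem[OF \<eta> h U]])
  fix V i \<zeta> assume *: "opn G V" "V \<subseteq> U" "\<zeta> \<in> sec G V i"
  show "- kos ((c + e + k) * (i + k)) (form_smul G U c h \<eta> V (i + k) (hamiltonian G B V \<zeta>)) =
      kos c (vf_smul G U h (pi_vf U e \<eta>)) V \<zeta>"
    unfolding kos_apply vf_smul_def form_smul_def pi_vf_apply[OF \<eta> *]
    by (cases "even c"; cases "even e"; cases "even i"; cases "even k") (simp_all add: kos_def)
qed

section \<open>Symplectic brackets and bijectivity\<close>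

text \<open>Besides injectivity this yields uniqueness of preimages over any smaller open set, which
  is the overlap condition needed for gluing local preimages.\<close>

lemma form_eq_of_pi_vf_eq:
  assumes s: "symplectic_bracket G k B"
    and \<eta>: "\<eta> \<in> one_forms G U e" and \<theta>: "\<theta> \<in> one_forms G U e"
    and eq: "pi_vf U e \<eta> = pi_vf U e \<theta>"
  shows "\<eta> = \<theta>"
proof (intro ext)
  fix V j X
  show "\<eta> V j X = \<theta> V j X"
  proof (cases "opn G V \<and> V \<subseteq> U \<and> X \<in> vector_fields G V j")
    case False
    then show ?thesis
      by (simp only: form_supp[OF \<eta> False] form_supp[OF \<theta> False])
  next
    case True
    then have V: "opn G V" "V \<subseteq> U" and X: "X \<in> vector_fields G V j"
      by blast+
    show ?thesis
    proof (rule sec_eqI[OF V(1) form_sec[OF \<eta> V X] form_sec[OF \<theta> V X]])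
      fix p assume "p \<in> V"
      \<comment> \<open>Generation is applied to \<open>X\<close> over \<open>V\<close> itself,
        since a field over \<open>V\<close> need not extend to \<open>U\<close>.\<close>
      then obtain W n a f z where W: "opn G W" "p \<in> W" "W \<subseteq> V"
        and t: "\<forall>l<n. f l \<in> sec G W (a l) \<and> z l \<in> sec G W (j - a l - k)"
        and r: "vf_restrict W X = (\<Sum>l<(n::nat). vf_smul G W (f l) (hamiltonian G B W (z l)))"
        using s[unfolded symplectic_bracket_def, rule_format, OF V(1) X] by blast
      have WU: "W \<subseteq> U"
        using W V by blast
      have H: "hamiltonian G B W (z l) \<in> vector_fields G W (j - a l)" if "l < n" for l
        using hamiltonian_mem[OF W(1), of "z l" "j - a l - k"] t that by simp
      have fH: "vf_smul G W (f l) (hamiltonian G B W (z l)) \<in> vector_fields G W j" if "l < n" for l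
        using vf_smul_mem[OF H[OF that], of "f l" "a l"] t that W(1) by simp
      have ev: "\<omega> W j (vf_restrict W X) = (\<Sum>l<n. f l * \<omega> W (j - a l) (hamiltonian G B W (z l)))"
        if \<omega>: "\<omega> \<in> one_forms G U e" for \<omega>
      proof -
        have "\<omega> W j (vf_restrict W X) =
            (\<Sum>l<n. \<omega> W j (vf_smul G W (f l) (hamiltonian G B W (z l))))"
          unfolding r using fH by (intro form_vf_sum[OF \<omega> W(1) WU]) simp
        also have "\<dots> = (\<Sum>l<n. f l * \<omega> W (j - a l) (hamiltonian G B W (z l)))"
        proof (rule sum.cong[OF refl])
          fix l assume "l \<in> {..<n}"
          then have l: "l < n" by simp
          show "\<omega> W j (vf_smul G W (f l) (hamiltonian G B W (z l))) =
              f l * \<omega> W (j - a l) (hamiltonian G B W (z l))"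
            using form_vf_smul[OF \<omega> W(1) WU H[OF l], of "f l" "a l"] t l by simp
        qed
        finally show ?thesis .
      qed
      have hz: "\<eta> W (j - a l) (hamiltonian G B W (z l)) = \<theta> W (j - a l) (hamiltonian G B W (z l))"
        if "l < n" for l
      proof -
        have z: "z l \<in> sec G W (j - a l - k)"
          using t that by blast
        \<comment> \<open>The Hamiltonian field of \<open>z l\<close> has degree j - a l, so the
          same sign stands on both sides and can be cancelled.\<close>
        have "kos ((e + k) * (j - a l)) (\<eta> W (j - a l) (hamiltonian G B W (z l))) =
            kos ((e + k) * (j - a l)) (\<theta> W (j - a l) (hamiltonian G B W (z l)))"
          using pi_vf_apply[OF \<eta> W(1) WU z] pi_vf_apply[OF \<theta> W(1) WU z] eq by simp
        then show ?thesis
          by (simp add: kos_def split: if_splits)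
      qed
      have "\<eta> W j (vf_restrict W X) = \<theta> W j (vf_restrict W X)"
        unfolding ev[OF \<eta>] ev[OF \<theta>] using hz by (auto intro!: sum.cong)
      then show "\<exists>W. opn G W \<and> p \<in> W \<and> W \<subseteq> V \<and> res G V W (\<eta> V j X) = res G V W (\<theta> V j X)"
        using W form_res[OF \<eta> V X W(1,3)] form_res[OF \<theta> V X W(1,3)] by metis
    qed
  qed
qed

text \<open>Combinations in \<open>symplectic_bracket\<close> carry no signs while those in
  \<open>pi_sharp\<close> carry (-1)^|f|; this translates between them by moving the sign into the
  coefficient.\<close>

lemma vf_smul_kos:
  assumes "opn G V" "f \<in> sec G V a"
  shows "vf_smul G V (kos n f) (hamiltonian G B V \<xi>) = kos n (vf_smul G V f (hamiltonian G B V \<xi>))"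
proof (intro ext)
  fix W \<zeta>
  show "vf_smul G V (kos n f) (hamiltonian G B V \<xi>) W \<zeta> =
      kos n (vf_smul G V f (hamiltonian G B V \<xi>)) W \<zeta>"
    using res_kos[OF assms(1) _ _ assms(2), of W n]
    by (cases "opn G W \<and> W \<subseteq> V") (auto simp: vf_smul_def kos_apply kos_mult_left hamiltonian_def)
qed

lemma pi_vf_bij:
  assumes s: "symplectic_bracket G k B" and U: "opn G U"
  shows "bij_betw (pi_vf U e) (one_forms G U e) (vector_fields G U (e + k))"
proof (rule bij_betw_imageI)
  show "inj_on (pi_vf U e) (one_forms G U e)"
    using form_eq_of_pi_vf_eq[OF s] by (intro inj_onI)
  have "X \<in> pi_vf U e ` one_forms G U e" if X: "X \<in> vector_fields G U (e + k)" for X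
  proof -
    have "\<exists>V \<eta>. (opn G V \<and> p \<in> V \<and> V \<subseteq> U) \<and> \<eta> \<in> one_forms G V e \<and> pi_vf V e \<eta> = vf_restrict V X"
      if p: "p \<in> U" for p
    proof -
      obtain V n a f z where V: "opn G V" "p \<in> V" "V \<subseteq> U"
        and t: "\<forall>l<n. f l \<in> sec G V (a l) \<and> z l \<in> sec G V (e + k - a l - k)"
        and r: "vf_restrict V X = (\<Sum>l<(n::nat). vf_smul G V (f l) (hamiltonian G B V (z l)))"
        using s[unfolded symplectic_bracket_def, rule_format, OF U X p] by blast
      \<comment> \<open>The sign (-1)^(a l) in the coefficients compensates the one that
        \<open>pi_sharp\<close> introduces.\<close>
      let ?f = "\<lambda>l. kos (a l) (f l)"
      have ft: "form_terms G V e n a ?f z"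
        using t V(1) by (simp add: form_terms_def sec_kos)
      note m = form_comb_mem[OF ft V(1)]
      have "pi_vf V e (form_comb G V n a ?f z) =
          (\<Sum>l<n. kos (a l) (vf_smul G V (?f l) (hamiltonian G B V (z l))))"
        using pi_vf_comb[OF m V(1) subset_refl ft form_restrict_comb_self]
          vf_restrict_self[OF pi_vf_mem[OF m V(1)]] by simp
      also have "\<dots> = vf_restrict V X"
        unfolding r
      proof (rule sum.cong[OF refl])
        fix l assume "l \<in> {..<n}"
        then show "kos (a l) (vf_smul G V (?f l) (hamiltonian G B V (z l))) =
            vf_smul G V (f l) (hamiltonian G B V (z l))"
          using t vf_smul_kos[OF V(1), of "f l" "a l" "a l" "z l"] by (simp add: kos_kos kos_even)
      qed
      finally show ?thesis
        using V m by blast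
    qed
    then obtain V \<eta> where V: "\<And>p. p \<in> U \<Longrightarrow> opn G (V p) \<and> p \<in> V p \<and> V p \<subseteq> U"
      and \<eta>: "\<And>p. p \<in> U \<Longrightarrow> \<eta> p \<in> one_forms G (V p) e"
      and pi: "\<And>p. p \<in> U \<Longrightarrow> pi_vf (V p) e (\<eta> p) = vf_restrict (V p) X"
      by metis
    have pi_restr: "pi_vf W e (form_restrict W (\<eta> p)) = vf_restrict W X"
      if "p \<in> U" "opn G W" "W \<subseteq> V p" for p W
      using pi_vf_restrict[OF \<eta>[OF that(1)] that(2,3)] pi[OF that(1)]
        vf_restrict_restrict[OF that(3), of X] by simp
    \<comment> \<open>Over the overlap both local preimages are sent to the restriction of
      \<open>X\<close>, so injectivity there identifies them.\<close>
    have "form_restrict (V p \<inter> V q) (\<eta> p) = form_restrict (V p \<inter> V q) (\<eta> q)"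
      if p: "p \<in> U" and q: "q \<in> U" for p q
    proof (rule form_eq_of_pi_vf_eq[OF s])
      have o: "opn G (V p \<inter> V q)"
        using V p q by (simp add: opn_Int)
      show "form_restrict (V p \<inter> V q) (\<eta> p) \<in> one_forms G (V p \<inter> V q) e"
        "form_restrict (V p \<inter> V q) (\<eta> q) \<in> one_forms G (V p \<inter> V q) e"
        using form_restrict_mem[OF \<eta>[OF p] o] form_restrict_mem[OF \<eta>[OF q] o] by auto
      show "pi_vf (V p \<inter> V q) e (form_restrict (V p \<inter> V q) (\<eta> p)) =
          pi_vf (V p \<inter> V q) e (form_restrict (V p \<inter> V q) (\<eta> q))"
        using pi_restr[OF p o] pi_restr[OF q o] by simp
    qed
    then obtain \<theta> where \<theta>: "\<theta> \<in> one_forms G U e" "\<And>p. p \<in> U \<Longrightarrow> form_restrict (V p) \<theta> = \<eta> p"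
      using form_glue[of U V \<eta> e] V \<eta> by blast
    have "pi_vf U e \<theta> = X"
    proof (rule vf_eqI[OF pi_vf_mem[OF \<theta>(1) U] X])
      fix p assume p: "p \<in> U"
      then show "\<exists>V. opn G V \<and> p \<in> V \<and> V \<subseteq> U \<and> vf_restrict V (pi_vf U e \<theta>) = vf_restrict V X"
        using V[OF p] pi_vf_restrict[OF \<theta>(1)] \<theta>(2)[OF p] pi[OF p]
        by (intro exI[of _ "V p"]) simp
    qed
    then show ?thesis
      using \<theta>(1) by blast
  qed
  then show "pi_vf U e ` one_forms G U e = vector_fields G U (e + k)"
    using pi_vf_mem[OF _ U] by blast
qed

text \<open>One-forms are by definition local combinations of differentials, and their images are
  the corresponding combinations of Hamiltonian fields up to signs in the coefficients.\<close>

lemma symplectic_of_pi_vf_surj: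
  assumes "\<And>U e. opn G U \<Longrightarrow> vector_fields G U (e + k) \<subseteq> pi_vf U e ` one_forms G U e"
  shows "symplectic_bracket G k B"
  unfolding symplectic_bracket_def
proof (intro allI impI ballI)
  fix U j X p assume U: "opn G U" and X: "X \<in> vector_fields G U j" and p: "p \<in> U"
  \<comment> \<open>The map has degree k, so a field of degree j has its preimages in degree j -
    k.\<close>
  obtain \<eta> where \<eta>: "\<eta> \<in> one_forms G U (j - k)" and X_eq: "X = pi_vf U (j - k) \<eta>"
    using assms[OF U, of "j - k"] X by auto
  obtain V n a f z where V: "opn G V" "p \<in> V" "V \<subseteq> U" and t: "form_terms G V (j - k) n a f z"
    and r: "form_restrict V \<eta> = form_comb G V n a f z"
    using form_rep[OF \<eta> p] by blast
  have c: "vf_restrict V X = (\<Sum>l<n. vf_smul G V (kos (a l) (f l)) (hamiltonian G B V (z l)))"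
    unfolding X_eq pi_vf_comb[OF \<eta> V(1,3) t r]
    using vf_smul_kos[OF V(1) form_termsD(1)[OF t]] by (auto intro!: sum.cong)
  have t': "\<forall>l<n. kos (a l) (f l) \<in> sec G V (a l) \<and> z l \<in> sec G V (j - a l - k)"
    using form_termsD[OF t] V(1) by (auto simp: sec_kos algebra_simps)
  show "\<exists>V n a f z. opn G V \<and> p \<in> V \<and> V \<subseteq> U \<and>
      (\<forall>l<n. f l \<in> sec G V (a l) \<and> z l \<in> sec G V (j - a l - k)) \<and>
      vf_restrict V X = (\<Sum>l<(n::nat). vf_smul G V (f l) (hamiltonian G B V (z l)))"
    by (rule exI[of _ V], rule exI[of _ n], rule exI[of _ a],
        rule exI[of _ "\<lambda>l. kos (a l) (f l)"], rule exI[of _ z], intro conjI V t' c)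
qed

end

section \<open>The Lie derivative along a homological vector field\<close>

locale homological_sheaf = graded_sheaf G
  for G :: "('m, 'a::real_algebra) gmfd" +
  fixes Q :: "('m, 'a) vf"
  assumes hom: "homological G Q"
begin

lemma Q_vf: "Q \<in> vector_fields G (topspace (base G)) 1"
  using hom by (simp add: homological_def)

lemma opn_topspace: "opn G U \<Longrightarrow> U \<subseteq> topspace (base G)"
  by (simp add: opn_def openin_subset)

lemma Q_sq: "opn G U \<Longrightarrow> \<xi> \<in> sec G U i \<Longrightarrow> Q U (Q U \<xi>) = 0"
  by (rule hom[unfolded homological_def, THEN conjunct2, rule_format])

context
  fixes U
  assumes U: "opn G U"
begin

lemmas Q_sec = vf_sec[OF Q_vf U opn_topspace[OF U]]
lemmas Q_lin = vf_lin[OF Q_vf U opn_topspace[OF U]]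
lemmas Q_add = vf_add[OF Q_vf U opn_topspace[OF U]]
lemmas Q_diff = vf_diff[OF Q_vf U opn_topspace[OF U]]
lemmas Q_kos = vf_kos[OF Q_vf U opn_topspace[OF U]]
lemmas Q_sum = vf_sum[OF Q_vf U opn_topspace[OF U]]
lemmas Q_res = vf_res[OF Q_vf U opn_topspace[OF U]]
lemmas Q_leibniz = vf_leibniz[OF Q_vf U opn_topspace[OF U], unfolded mult_1]

end

lemmas Q_zero = vf_zero[OF Q_vf]

lemma lie_vf_apply: "lie_vf Q U j X V \<xi> = Q V (X V \<xi>) - kos j (X V (Q V \<xi>))"
  by (simp add: lie_vf_def vf_bracket_def)

lemma lie_vf_mem:
  assumes X: "X \<in> vector_fields G U j"
  shows "lie_vf Q U j X \<in> vector_fields G U (j + 1)"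
proof (rule vector_fieldsI)
  fix V \<xi> assume "lie_vf Q U j X V \<xi> \<noteq> 0"
  \<comment> \<open>In the second case \<open>Q V \<xi>\<close> is nonzero because \<open>X\<close>
    sends 0 to 0, and then \<xi> is a section by the support of \<open>Q\<close>.\<close>
  then have "X V \<xi> \<noteq> 0 \<or> X V (Q V \<xi>) \<noteq> 0"
    by (auto simp: lie_vf_apply Q_zero)
  then show "opn G V \<and> V \<subseteq> U \<and> (\<exists>i. \<xi> \<in> sec G V i)"
    using vf_suppD[OF X, of V] vf_suppD[OF Q_vf, of V \<xi>] vf_zero[OF X, of V] by metis
next
  fix V i \<xi> assume *: "opn G V" "V \<subseteq> U" "\<xi> \<in> sec G V i"
  show "lie_vf Q U j X V \<xi> \<in> sec G V (i + (j + 1))"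
    using Q_sec[OF *(1) vf_sec[OF X *]] vf_sec[OF X *(1,2) Q_sec[OF *(1,3)]] *(1)
    by (simp add: lie_vf_apply sec_diff sec_kos algebra_simps)
next
  fix V i \<xi> \<zeta> c assume *: "opn G V" "V \<subseteq> U" "\<xi> \<in> sec G V i" "\<zeta> \<in> sec G V i"
  show "lie_vf Q U j X V (c *\<^sub>R \<xi> + \<zeta>) = c *\<^sub>R lie_vf Q U j X V \<xi> + lie_vf Q U j X V \<zeta>"
    unfolding lie_vf_apply vf_lin[OF X *] Q_lin[OF *(1,3,4)]
      Q_lin[OF *(1) vf_sec[OF X *(1-3)] vf_sec[OF X *(1,2,4)]]
      vf_lin[OF X *(1,2) Q_sec[OF *(1,3)] Q_sec[OF *(1,4)]]
    by (simp add: kos_add kos_scaleR scaleR_diff_right)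
next
  fix V i i' \<xi> \<zeta> assume *: "opn G V" "V \<subseteq> U" "\<xi> \<in> sec G V i" "\<zeta> \<in> sec G V i'"
  note x = vf_sec[OF X *(1-3)] and z = vf_sec[OF X *(1,2,4)]
  note qx = Q_sec[OF *(1,3)] and qz = Q_sec[OF *(1,4)]
  have xz: "X V \<xi> * \<zeta> \<in> sec G V (i + i' + j)" "\<xi> * X V \<zeta> \<in> sec G V (i + i' + j)"
    "Q V \<xi> * \<zeta> \<in> sec G V (i + i' + 1)" "\<xi> * Q V \<zeta> \<in> sec G V (i + i' + 1)"
    using sec_mult[OF *(1) x *(4)] sec_mult[OF *(1,3) z] sec_mult[OF *(1) qx *(4)]
      sec_mult[OF *(1,3) qz] by (simp_all add: algebra_simps)
  have QX: "Q V (X V (\<xi> * \<zeta>)) = Q V (X V \<xi>) * \<zeta> + kos (i + j) (X V \<xi> * Q V \<zeta>) +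
      kos (j * i) (Q V \<xi> * X V \<zeta> + kos i (\<xi> * Q V (X V \<zeta>)))"
    unfolding vf_leibniz[OF X *] Q_add[OF *(1) xz(1) sec_kos[OF *(1) xz(2)]] Q_kos[OF *(1) xz(2)]
      Q_leibniz[OF *(1) x *(4)] Q_leibniz[OF *(1,3) z] ..
  have XQ: "X V (Q V (\<xi> * \<zeta>)) = X V (Q V \<xi>) * \<zeta> + kos (j * (i + 1)) (Q V \<xi> * X V \<zeta>) +
      kos i (X V \<xi> * Q V \<zeta> + kos (j * i) (\<xi> * X V (Q V \<zeta>)))"
    unfolding Q_leibniz[OF *(1,3,4)] vf_add[OF X *(1,2) xz(3) sec_kos[OF *(1) xz(4)]]
      vf_kos[OF X *(1,2) xz(4)] vf_leibniz[OF X *(1,2) qx *(4)] vf_leibniz[OF X *(1-3) qz] ..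
  \<comment> \<open>The mixed products \<open>X V \<xi> * Q V \<zeta>\<close> and
    \<open>Q V \<xi> * X V \<zeta>\<close> occur in both compositions, with exponents i + j and i j
    once the sign of the commutator is included, and cancel.\<close>
  show "lie_vf Q U j X V (\<xi> * \<zeta>) =
      lie_vf Q U j X V \<xi> * \<zeta> + kos ((j + 1) * i) (\<xi> * lie_vf Q U j X V \<zeta>)"
    unfolding lie_vf_apply QX XQ
    by (cases "even i"; cases "even j") (simp_all add: kos_def algebra_simps)
next
  fix V V' i \<xi> assume *: "opn G V" "V \<subseteq> U" "opn G V'" "V' \<subseteq> V" "\<xi> \<in> sec G V i"
  note x = vf_sec[OF X *(1,2,5)] and qx = Q_sec[OF *(1,5)]
  have d: "Q V (X V \<xi>) \<in> sec G V (i + j + 1)" "X V (Q V \<xi>) \<in> sec G V (i + j + 1)"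
    using Q_sec[OF *(1) x] vf_sec[OF X *(1,2) qx] by (simp_all add: algebra_simps)
  show "res G V V' (lie_vf Q U j X V \<xi>) = lie_vf Q U j X V' (res G V V' \<xi>)"
    using res_diff[OF *(1,3,4) d(1) sec_kos[OF *(1) d(2)], of j] res_kos[OF *(1,3,4) d(2)]
      Q_res[OF *(1,3,4) x] Q_res[OF *(1,3,4,5)] vf_res[OF X *] vf_res[OF X *(1-4) qx]
    by (simp add: lie_vf_apply)
qed

lemma lie_vf_restrict: "vf_restrict V (lie_vf Q U j X) = lie_vf Q V j (vf_restrict V X)"
  by (auto simp: vf_restrict_def lie_vf_apply Q_zero fun_eq_iff)

text \<open>The outer terms contain \<open>Q\<close> applied twice, and the two copies of Q X Q
  cancel because the degrees j and j + 1 have opposite parity.\<close>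

lemma lie_vf_sq:
  assumes X: "X \<in> vector_fields G U j"
  shows "lie_vf Q U (j + 1) (lie_vf Q U j X) = 0"
proof (intro ext)
  fix V \<xi>
  show "lie_vf Q U (j + 1) (lie_vf Q U j X) V \<xi> = 0 V \<xi>"
  proof (cases "opn G V \<and> V \<subseteq> U \<and> (\<exists>i. \<xi> \<in> sec G V i)")
    case True
    then obtain i where V: "opn G V" "V \<subseteq> U" "\<xi> \<in> sec G V i"
      by blast
    note x = vf_sec[OF X V] and qx = Q_sec[OF V(1,3)]
    have d: "Q V (X V \<xi>) \<in> sec G V (i + j + 1)" "X V (Q V \<xi>) \<in> sec G V (i + j + 1)"
      using Q_sec[OF V(1) x] vf_sec[OF X V(1,2) qx] by (simp_all add: algebra_simps)
    show ?thesis
      unfolding lie_vf_apply Q_diff[OF V(1) d(1) sec_kos[OF V(1) d(2)]] Q_kos[OF V(1) d(2)]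
        Q_sq[OF V(1,3)] Q_sq[OF V(1) x] vf_zero[OF X]
      by (simp add: kos_def)
  next
    case False
    then show ?thesis
      using vf_suppD[OF lie_vf_mem[OF lie_vf_mem[OF X]], of V \<xi>] by auto
  qed
qed

lemma lie_vf_add:
  assumes X: "X \<in> vector_fields G U j" and Y: "Y \<in> vector_fields G U j"
  shows "lie_vf Q U j (X + Y) = lie_vf Q U j X + lie_vf Q U j Y"
proof (intro ext)
  fix V \<xi>
  show "lie_vf Q U j (X + Y) V \<xi> = (lie_vf Q U j X + lie_vf Q U j Y) V \<xi>"
  proof (cases "opn G V \<and> V \<subseteq> U \<and> (\<exists>i. \<xi> \<in> sec G V i)")
    case True
    then obtain i where V: "opn G V" "V \<subseteq> U" "\<xi> \<in> sec G V i"
      by blast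
    show ?thesis
      using Q_add[OF V(1) vf_sec[OF X V] vf_sec[OF Y V]] by (simp add: lie_vf_apply kos_add)
  next
    case False
    then show ?thesis
      using vf_supp[OF lie_vf_mem[OF vf_add_mem[OF X Y]] False]
        vf_supp[OF lie_vf_mem[OF X] False] vf_supp[OF lie_vf_mem[OF Y] False] by simp
  qed
qed

lemma lie_vf_smul:
  assumes X: "X \<in> vector_fields G U j" and h: "h \<in> sec G U c" and U: "opn G U"
  shows "lie_vf Q U (c + j) (vf_smul G U h X) =
    vf_smul G U (Q U h) X + kos c (vf_smul G U h (lie_vf Q U j X))"
proof (intro ext)
  fix V \<xi>
  show "lie_vf Q U (c + j) (vf_smul G U h X) V \<xi> =
    (vf_smul G U (Q U h) X + kos c (vf_smul G U h (lie_vf Q U j X))) V \<xi>"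
  proof (cases "opn G V \<and> V \<subseteq> U \<and> (\<exists>i. \<xi> \<in> sec G V i)")
    case True
    then obtain i where V: "opn G V" "V \<subseteq> U" "\<xi> \<in> sec G V i"
      by blast
    show ?thesis
      using Q_leibniz[OF V(1) res_sec[OF U V(1,2) h] vf_sec[OF X V]] Q_res[OF U V(1,2) h]
      by (cases "even c"; cases "even j")
        (simp_all add: lie_vf_apply kos_apply vf_smul_def kos_def algebra_simps)
  next
    case False
    then show ?thesis
      using vf_supp[OF lie_vf_mem[OF vf_smul_mem[OF X h U]] False]
        vf_supp[OF lie_vf_mem[OF X] False] vf_supp[OF X False]
      by (simp add: vf_smul_def kos_apply)
  qed
qed

section \<open>Cartan's formula for the Lie derivative of one-forms\<close>

text \<open>The exact form d\<zeta> explains the sign: its contractions turn the formula into (-1)^j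
  ((Q X - (-1)^j X Q) \<zeta> - Q X \<zeta>) = - X(Q \<zeta>), the contraction of - d(Q
  \<zeta>).\<close>

definition lie_contraction :: "'m set \<Rightarrow> ('m, 'a) form \<Rightarrow> ('m, 'a) form"
  where "lie_contraction U \<eta> = (\<lambda>V j X. if opn G V \<and> V \<subseteq> U \<and> X \<in> vector_fields G V j
    then kos j (\<eta> V (j + 1) (lie_vf Q V j X) - Q V (\<eta> V j X)) else 0)"

lemma lie_contraction_apply:
  "opn G V \<Longrightarrow> V \<subseteq> U \<Longrightarrow> X \<in> vector_fields G V j \<Longrightarrow>
    lie_contraction U \<eta> V j X = kos j (\<eta> V (j + 1) (lie_vf Q V j X) - Q V (\<eta> V j X))"
  by (simp add: lie_contraction_def)

lemma lie_contraction_supp: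
  "\<not> (opn G V \<and> V \<subseteq> U \<and> X \<in> vector_fields G V j) \<Longrightarrow> lie_contraction U \<eta> V j X = 0"
  unfolding lie_contraction_def by (rule if_not_P)

text \<open>In every term the part f Q(X(z)) from the commutator cancels against the second summand
  of the Leibniz rule for Q(f X(z)). What remains contains \<open>Q\<close> only on the coefficient
  or on \<open>z\<close>.\<close>

lemma lie_contraction_eval:
  assumes V: "opn G V" "V \<subseteq> U"
    and t: "form_terms G V e n a f z" and r: "form_restrict V \<eta> = form_comb G V n a f z"
    and W: "opn G W" "W \<subseteq> V" and X: "X \<in> vector_fields G W j"
  shows "lie_contraction U \<eta> W j X =
    (\<Sum>l<n. kos ((a l + 1) * (j + 1)) (res G V W (Q V (f l)) * X W (res G V W (z l))) -
      kos (a l * j) (res G V W (f l) * X W (res G V W (Q V (z l)))))"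
proof -
  have WU: "W \<subseteq> U"
    using W V by blast
  let ?f = "\<lambda>l. res G V W (f l)" and ?z = "\<lambda>l. res G V W (z l)"
  have f: "?f l \<in> sec G W (a l)" and z: "?z l \<in> sec G W (e - a l)" if "l < n" for l
    using res_sec[OF V(1) W] form_termsD[OF t that] by blast+
  have fX: "?f l * X W (?z l) \<in> sec G W (e + j)" if "l < n" for l
    using sec_mult[OF W(1) f[OF that] vf_sec[OF X W(1) subset_refl z[OF that]]]
    by (simp add: algebra_simps)
  have "Q W (\<eta> W j X) = (\<Sum>l<n. Q W (kos (a l * (j + 1)) (?f l * X W (?z l))))"
    unfolding form_restrict_eval[OF r W X]
    by (rule Q_sum[OF W(1), of _ _ "e + j"]) (simp add: sec_kos W(1) fX)
  then have "lie_contraction U \<eta> W j X =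
      (\<Sum>l<n. kos j (kos (a l * (j + 1 + 1)) (?f l * lie_vf Q W j X W (?z l)) -
        Q W (kos (a l * (j + 1)) (?f l * X W (?z l)))))"
    unfolding lie_contraction_apply[OF W(1) WU X] form_restrict_eval[OF r W lie_vf_mem[OF X]]
    by (simp add: kos_diff kos_sum sum_subtractf)
  also have "\<dots> = (\<Sum>l<n. kos ((a l + 1) * (j + 1)) (res G V W (Q V (f l)) * X W (?z l)) -
      kos (a l * j) (?f l * X W (res G V W (Q V (z l)))))"
  proof (rule sum.cong[OF refl])
    fix l assume "l \<in> {..<n}"
    then have l: "l < n" by simp
    show "kos j (kos (a l * (j + 1 + 1)) (?f l * lie_vf Q W j X W (?z l)) -
          Q W (kos (a l * (j + 1)) (?f l * X W (?z l)))) =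
        kos ((a l + 1) * (j + 1)) (res G V W (Q V (f l)) * X W (?z l)) -
        kos (a l * j) (?f l * X W (res G V W (Q V (z l))))"
      unfolding Q_kos[OF W(1) fX[OF l]] lie_vf_apply
        Q_leibniz[OF W(1) f[OF l] vf_sec[OF X W(1) subset_refl z[OF l]]]
        Q_res[OF V(1) W form_termsD(1)[OF t l]] Q_res[OF V(1) W form_termsD(2)[OF t l]]
      by (cases "even (a l)"; cases "even j") (simp_all add: kos_def algebra_simps)
  qed
  finally show ?thesis .
qed

lemma lie_contraction_restrict:
  assumes "V \<subseteq> U"
  shows "form_restrict V (lie_contraction U \<eta>) = lie_contraction V (form_restrict V \<eta>)"
  using assms by (auto simp: form_restrict_def lie_contraction_def fun_eq_iff)

lemma lie_contraction_comb:
  assumes V: "opn G V" "V \<subseteq> U"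
    and t: "form_terms G V e n a f z" and r: "form_restrict V \<eta> = form_comb G V n a f z"
  shows "form_restrict V (lie_contraction U \<eta>) =
    (\<Sum>l<n. form_smul G V (a l + 1) (Q V (f l)) (dform G V (z l)) +
        kos (a l) (form_smul G V (a l) (f l) (- dform G V (Q V (z l)))))"
proof (intro ext)
  fix W j X
  let ?S = "\<Sum>l<n. form_smul G V (a l + 1) (Q V (f l)) (dform G V (z l)) +
        kos (a l) (form_smul G V (a l) (f l) (- dform G V (Q V (z l))))"
  have S: "?S W j X = (\<Sum>l<n. kos ((a l + 1) * (j + 1)) (res G V W (Q V (f l)) * dform G V (z l) W j X) -
      kos (a l * j) (res G V W (f l) * dform G V (Q V (z l)) W j X))"
    unfolding sum_apply1
    by (rule sum.cong[OF refl])
      (auto simp: form_smul_def kos_apply kos_kos kos_minus algebra_simps intro!: kos_cong)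
  show "form_restrict V (lie_contraction U \<eta>) W j X = ?S W j X"
  proof (cases "opn G W \<and> W \<subseteq> V \<and> X \<in> vector_fields G W j")
    case True
    then show ?thesis
      using lie_contraction_eval[OF V t r, of W X j] unfolding S
      by (simp add: form_restrict_def dform_def)
  next
    case False
    have "dform G V y W j X = 0" for y
      unfolding dform_def by (rule if_not_P[OF False])
    moreover have "form_restrict V (lie_contraction U \<eta>) W j X = 0"
      using lie_contraction_restrict[OF V(2)] lie_contraction_supp[OF False] by simp
    ultimately show ?thesis
      unfolding S by simp
  qed
qed

text \<open>Applying the rule to a presentation gives two of them, one with \<open>Q\<close> on the
  coefficients and one with \<open>Q\<close> under the differentials; their concatenation presents
  the result.\<close>

lemma lie_contraction_mem:
  assumes \<eta>: "\<eta> \<in> one_forms G U e"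
  shows "lie_contraction U \<eta> \<in> one_forms G U (e + 1)"
proof (rule one_formsI)
  fix V j X assume "lie_contraction U \<eta> V j X \<noteq> 0"
  then show "opn G V \<and> V \<subseteq> U \<and> X \<in> vector_fields G V j"
    using lie_contraction_supp by blast
next
  fix V j X assume *: "opn G V" "V \<subseteq> U" "X \<in> vector_fields G V j"
  show "lie_contraction U \<eta> V j X \<in> sec G V (e + 1 + j)"
    using form_sec[OF \<eta> *(1,2) lie_vf_mem[OF *(3)]] Q_sec[OF *(1) form_sec[OF \<eta> *]] *(1)
    by (simp add: lie_contraction_apply[OF *] sec_kos sec_diff algebra_simps)
next
  fix V W j X
  assume *: "opn G V" "V \<subseteq> U" "X \<in> vector_fields G V j" "opn G W" "W \<subseteq> V"
  note l = lie_vf_mem[OF *(3)]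
  have d: "\<eta> V (j + 1) (lie_vf Q V j X) \<in> sec G V (e + j + 1)"
    "Q V (\<eta> V j X) \<in> sec G V (e + j + 1)"
    using form_sec[OF \<eta> *(1,2) l] Q_sec[OF *(1) form_sec[OF \<eta> *(1-3)]]
    by (simp_all add: algebra_simps)
  show "res G V W (lie_contraction U \<eta> V j X) = lie_contraction U \<eta> W j (vf_restrict W X)"
    unfolding lie_contraction_apply[OF *(1-3)]
      lie_contraction_apply[OF *(4) subset_trans[OF *(5,2)] vf_restrict_mem[OF *(3,5)]]
      res_kos[OF *(1,4,5) sec_diff[OF *(1) d]] res_diff[OF *(1,4,5) d]
      form_res[OF \<eta> *(1,2) l *(4,5)] Q_res[OF *(1,4,5) form_sec[OF \<eta> *(1-3)]] form_res[OF \<eta> *]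
      lie_vf_restrict ..
next
  fix p assume p: "p \<in> U"
  obtain V n a f z where V: "opn G V" "p \<in> V" "V \<subseteq> U" and t: "form_terms G V e n a f z"
    and r: "form_restrict V \<eta> = form_comb G V n a f z"
    using form_rep[OF \<eta> p] by blast
  have t1: "form_terms G V (e + 1) n (\<lambda>l. a l + 1) (\<lambda>l. Q V (f l)) z"
    using t Q_sec[OF V(1)] by (auto simp: form_terms_def)
  \<comment> \<open>The minus in - d(Q z) and the sign (-1)^(a l) are moved under the differential,
    so that the terms have the shape f dy with the old coefficients.\<close>
  have t2: "form_terms G V (e + 1) n a f (\<lambda>l. - kos (a l) (Q V (z l)))"
    unfolding form_terms_def
  proof (intro allI impI conjI)
    fix l assume l: "l < n"
    show "f l \<in> sec G V (a l)"
      using form_termsD[OF t l] by simp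
    show "- kos (a l) (Q V (z l)) \<in> sec G V (e + 1 - a l)"
      using Q_sec[OF V(1) form_termsD(2)[OF t l]] V(1) by (simp add: sec_minus sec_kos algebra_simps)
  qed
  have "form_restrict V (lie_contraction U \<eta>) =
      form_comb G V n (\<lambda>l. a l + 1) (\<lambda>l. Q V (f l)) z +
      form_comb G V n a f (\<lambda>l. - kos (a l) (Q V (z l)))" (is "_ = ?c1 + ?c2")
  proof (intro ext)
    fix W j X
    show "form_restrict V (lie_contraction U \<eta>) W j X = (?c1 + ?c2) W j X"
    proof (cases "opn G W \<and> W \<subseteq> V \<and> X \<in> vector_fields G W j")
      case False
      then show ?thesis
        using lie_contraction_restrict[OF V(3)] lie_contraction_supp[OF False]
          form_comb_supp[OF False] by simp
    next
      case True
      then have W: "opn G W" "W \<subseteq> V" and X: "X \<in> vector_fields G W j"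
        by blast+
      have "X W (res G V W (- kos (a l) (Q V (z l)))) = - kos (a l) (X W (res G V W (Q V (z l))))"
        if l: "l < n" for l
      proof -
        note q = Q_sec[OF V(1) form_termsD(2)[OF t l]]
        show ?thesis
          using res_minus[OF V(1) W sec_kos[OF V(1) q]] res_kos[OF V(1) W q]
            vf_minus[OF X W(1) subset_refl sec_kos[OF W(1) res_sec[OF V(1) W q]]]
            vf_kos[OF X W(1) subset_refl res_sec[OF V(1) W q]] by simp
      qed
      then have "?c2 W j X = (\<Sum>l<n. - kos (a l * j) (res G V W (f l) * X W (res G V W (Q V (z l)))))"
        unfolding form_comb_apply[OF W X]
        by (intro sum.cong) (auto simp: kos_def algebra_simps)
      then show ?thesis
        using lie_contraction_eval[OF V(1,3) t r W X] form_comb_apply[OF W X, of n] W(2)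
        by (simp add: form_restrict_def sum_subtractf sum_negf)
    qed
  qed
  then show "\<exists>V n a f z. opn G V \<and> p \<in> V \<and> V \<subseteq> U \<and> form_terms G V (e + 1) n a f z \<and>
      form_restrict V (lie_contraction U \<eta>) = form_comb G V n a f z"
    using form_comb_add[OF t1 t2] V by metis
qed

text \<open>As for \<open>pi_sharp_eq\<close>: the contraction formula satisfies the rule for all
  presentations at once, and local presentations leave no second candidate.\<close>

lemma lie_form_eq:
  assumes \<eta>: "\<eta> \<in> one_forms G U e"
  shows "lie_form G Q U e \<eta> = lie_contraction U \<eta>"
  unfolding lie_form_def
proof (rule the_equality)
  show "lie_contraction U \<eta> \<in> one_forms G U (e + 1) \<and>
    (\<forall>V n a f z. opn G V \<and> V \<subseteq> U \<and> form_terms G V e n a f z \<and>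
        form_restrict V \<eta> = form_comb G V n a f z \<longrightarrow>
      form_restrict V (lie_contraction U \<eta>) =
        (\<Sum>l<n. form_smul G V (a l + 1) (Q V (f l)) (dform G V (z l)) +
          kos (a l) (form_smul G V (a l) (f l) (- dform G V (Q V (z l))))))"
    using lie_contraction_mem[OF \<eta>] lie_contraction_comb by blast
  fix \<theta> assume \<theta>: "\<theta> \<in> one_forms G U (e + 1) \<and>
    (\<forall>V n a f z. opn G V \<and> V \<subseteq> U \<and> form_terms G V e n a f z \<and>
        form_restrict V \<eta> = form_comb G V n a f z \<longrightarrow>
      form_restrict V \<theta> =
        (\<Sum>l<n. form_smul G V (a l + 1) (Q V (f l)) (dform G V (z l)) +
          kos (a l) (form_smul G V (a l) (f l) (- dform G V (Q V (z l))))))"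
  show "\<theta> = lie_contraction U \<eta>"
  proof (rule form_eqI[OF \<theta>[THEN conjunct1] lie_contraction_mem[OF \<eta>]])
    fix p assume "p \<in> U"
    then obtain V n a f z where V: "opn G V" "p \<in> V" "V \<subseteq> U" and t: "form_terms G V e n a f z"
      and r: "form_restrict V \<eta> = form_comb G V n a f z"
      using form_rep[OF \<eta>] by blast
    have "form_restrict V \<theta> = form_restrict V (lie_contraction U \<eta>)"
      unfolding \<theta>[THEN conjunct2, rule_format, OF conjI[OF V(1) conjI[OF V(3) conjI[OF t r]]]]
        lie_contraction_comb[OF V(1,3) t r] ..
    then show "\<exists>V. opn G V \<and> p \<in> V \<and> V \<subseteq> U \<and>
        form_restrict V \<theta> = form_restrict V (lie_contraction U \<eta>)"
      using V by blast
  qed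
qed

lemma lie_contraction_ext:
  assumes \<theta>: "\<theta> \<in> one_forms G U e"
    and eq: "\<And>V j X. opn G V \<Longrightarrow> V \<subseteq> U \<Longrightarrow> X \<in> vector_fields G V j \<Longrightarrow>
      kos j (\<eta> V (j + 1) (lie_vf Q V j X) - Q V (\<eta> V j X)) = \<theta> V j X"
  shows "lie_contraction U \<eta> = \<theta>"
proof (intro ext)
  fix V j X
  show "lie_contraction U \<eta> V j X = \<theta> V j X"
  proof (cases "opn G V \<and> V \<subseteq> U \<and> X \<in> vector_fields G V j")
    case True
    then show ?thesis
      using eq lie_contraction_apply by metis
  next
    case False
    then show ?thesis
      using lie_contraction_supp[OF False] form_supp[OF \<theta> False] by simp
  qed
qed

lemma lie_contraction_add:
  assumes \<eta>: "\<eta> \<in> one_forms G U e" and \<theta>: "\<theta> \<in> one_forms G U e"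
  shows "lie_contraction U (\<eta> + \<theta>) = lie_contraction U \<eta> + lie_contraction U \<theta>"
proof (rule lie_contraction_ext
    [OF form_add_mem[OF lie_contraction_mem[OF \<eta>] lie_contraction_mem[OF \<theta>]]])
  fix V j X assume *: "opn G V" "V \<subseteq> U" "X \<in> vector_fields G V j"
  show "kos j ((\<eta> + \<theta>) V (j + 1) (lie_vf Q V j X) - Q V ((\<eta> + \<theta>) V j X)) =
      (lie_contraction U \<eta> + lie_contraction U \<theta>) V j X"
    using Q_add[OF *(1) form_sec[OF \<eta> *] form_sec[OF \<theta> *]]
    by (simp add: lie_contraction_apply[OF *] kos_diff kos_add)
qed

lemma lie_contraction_minus:
  assumes \<eta>: "\<eta> \<in> one_forms G U e"
  shows "lie_contraction U (- \<eta>) = - lie_contraction U \<eta>"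
proof (intro ext)
  fix V j X
  show "lie_contraction U (- \<eta>) V j X = (- lie_contraction U \<eta>) V j X"
  proof (cases "opn G V \<and> V \<subseteq> U \<and> X \<in> vector_fields G V j")
    case True
    then have V: "opn G V" "V \<subseteq> U" "X \<in> vector_fields G V j"
      by blast+
    show ?thesis
      using vf_minus[OF Q_vf V(1) opn_topspace[OF V(1)] form_sec[OF \<eta> V]]
      by (simp add: lie_contraction_apply[OF V] kos_diff kos_minus)
  next
    case False
    show ?thesis
      using lie_contraction_supp[OF False] by simp
  qed
qed

lemma lie_contraction_smul:
  assumes \<eta>: "\<eta> \<in> one_forms G U e" and h: "h \<in> sec G U c" and U: "opn G U"
  shows "lie_contraction U (form_smul G U c h \<eta>) =
    form_smul G U (c + 1) (Q U h) \<eta> + kos c (form_smul G U c h (lie_contraction U \<eta>))"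
proof (intro ext)
  fix V j X
  show "lie_contraction U (form_smul G U c h \<eta>) V j X =
    (form_smul G U (c + 1) (Q U h) \<eta> + kos c (form_smul G U c h (lie_contraction U \<eta>))) V j X"
  proof (cases "opn G V \<and> V \<subseteq> U \<and> X \<in> vector_fields G V j")
    case True
    then have V: "opn G V" "V \<subseteq> U" "X \<in> vector_fields G V j"
      by blast+
    note h' = res_sec[OF U V(1,2) h]
    show ?thesis
      unfolding lie_contraction_apply[OF V] form_smul_def plus_fun_apply kos_apply
        Q_kos[OF V(1) sec_mult[OF V(1) h' form_sec[OF \<eta> V]]]
        Q_leibniz[OF V(1) h' form_sec[OF \<eta> V]] Q_res[OF U V(1,2) h]
      by (cases "even c"; cases "even j")
        (simp_all add: lie_contraction_apply[OF V] kos_def algebra_simps)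
  next
    case False
    show ?thesis
      using lie_contraction_supp[OF False] form_supp[OF \<eta> False]
      by (simp add: form_smul_def kos_apply)
  qed
qed

text \<open>The contraction with [Q, [Q, X]] and the double application of \<open>Q\<close> vanish.
  The remaining two terms are both Q(\<eta>([Q, X])), with signs belonging to j and j + 1, and
  cancel.\<close>

lemma lie_contraction_sq:
  assumes \<eta>: "\<eta> \<in> one_forms G U e"
  shows "lie_contraction U (lie_contraction U \<eta>) = 0"
proof (intro ext)
  fix V j X
  show "lie_contraction U (lie_contraction U \<eta>) V j X = 0 V j X"
  proof (cases "opn G V \<and> V \<subseteq> U \<and> X \<in> vector_fields G V j")
    case True
    then have V: "opn G V" "V \<subseteq> U" and X: "X \<in> vector_fields G V j"
      by blast+
    note l = lie_vf_mem[OF X]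
    have d: "\<eta> V (j + 1) (lie_vf Q V j X) \<in> sec G V (e + j + 1)"
      "Q V (\<eta> V j X) \<in> sec G V (e + j + 1)"
      using form_sec[OF \<eta> V l] Q_sec[OF V(1) form_sec[OF \<eta> V X]]
      by (simp_all add: algebra_simps)
    show ?thesis
      unfolding lie_contraction_apply[OF V X] lie_contraction_apply[OF V l] lie_vf_sq[OF X]
        form_vf_zero[OF \<eta>] Q_kos[OF V(1) sec_diff[OF V(1) d]] Q_diff[OF V(1) d]
        Q_sq[OF V(1) form_sec[OF \<eta> V X]]
      by (simp add: kos_def)
  next
    case False
    show ?thesis
      using lie_contraction_supp[OF False] by simp
  qed
qed

section \<open>Differential graded module structures\<close>

text \<open>This rests on \<open>Q\<close> alone. Hence the module conditions inside the two notions
  of isomorphism hold whether or not \<open>Q\<close> and the bracket are compatible.\<close>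

lemma left_dg_module_form: "left_dg_module G Q (form_module G) (lie_form G Q)"
  unfolding left_dg_module_def differential_def form_module_def gmodule.simps
proof (intro conjI allI impI ballI; (elim conjE)?)
  fix U e \<eta> \<theta> assume U: "opn G U" and \<eta>: "\<eta> \<in> one_forms G U e"
  note L = lie_form_eq[OF \<eta>] and mem = lie_contraction_mem[OF \<eta>]
  show "lie_form G Q U e \<eta> \<in> one_forms G U (e + 1)"
    using L mem by simp
  show "lie_form G Q U (e + 1) (lie_form G Q U e \<eta>) = 0"
    using L lie_form_eq[OF mem] lie_contraction_sq[OF \<eta>] by simp
  show "lie_form G Q U e (\<eta> + \<theta>) = lie_form G Q U e \<eta> + lie_form G Q U e \<theta>"
    if \<theta>: "\<theta> \<in> one_forms G U e"
    unfolding L lie_form_eq[OF \<theta>] lie_form_eq[OF form_add_mem[OF \<eta> \<theta>]]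
    by (rule lie_contraction_add[OF \<eta> \<theta>])
  show "form_restrict V (lie_form G Q U e \<eta>) = lie_form G Q V e (form_restrict V \<eta>)"
    if V: "opn G V" "V \<subseteq> U" for V
    unfolding L lie_form_eq[OF form_restrict_mem[OF \<eta> V]] by (rule lie_contraction_restrict[OF V(2)])
  show "lie_form G Q U (i + e) (form_smul G U i f \<eta>) =
      form_smul G U (i + 1) (Q U f) \<eta> + kos i (form_smul G U i f (lie_form G Q U e \<eta>))"
    if f: "f \<in> sec G U i" for f i
    unfolding L lie_form_eq[OF form_smul_mem[OF \<eta> f U]] by (rule lie_contraction_smul[OF \<eta> f U])
qed

lemma left_dg_module_vf: "left_dg_module G Q (vf_module G k) (lie_vf Q)"
  unfolding left_dg_module_def differential_def vf_module_def gmodule.simps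
  by (intro conjI allI impI ballI; (elim conjE)?)
    (simp_all only: lie_vf_mem lie_vf_add lie_vf_restrict lie_vf_sq lie_vf_smul)

lemma lie_contraction_kos:
  "\<eta> \<in> one_forms G U e \<Longrightarrow> lie_contraction U (kos n \<eta>) = kos n (lie_contraction U \<eta>)"
  by (simp add: kos_def lie_contraction_minus)

lemma lie_vf_minus:
  assumes X: "X \<in> vector_fields G U j"
  shows "lie_vf Q U j (- X) = - lie_vf Q U j X"
proof (intro ext)
  fix V \<xi>
  show "lie_vf Q U j (- X) V \<xi> = (- lie_vf Q U j X) V \<xi>"
  proof (cases "opn G V \<and> V \<subseteq> U \<and> (\<exists>i. \<xi> \<in> sec G V i)")
    case True
    then obtain i where V: "opn G V" "V \<subseteq> U" "\<xi> \<in> sec G V i"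
      by blast
    show ?thesis
      using vf_minus[OF Q_vf V(1) opn_topspace[OF V(1)] vf_sec[OF X V]]
      by (simp add: lie_vf_apply kos_minus)
  next
    case False
    have "X V (Q V \<xi>) = 0" "X V \<xi> = 0"
      using False vf_suppD[OF X, of V] vf_suppD[OF Q_vf, of V \<xi>] vf_zero[OF X, of V] by metis+
    then show ?thesis
      by (simp add: lie_vf_apply Q_zero)
  qed
qed

lemma lie_vf_kos: "X \<in> vector_fields G U j \<Longrightarrow> lie_vf Q U j (kos n X) = kos n (lie_vf Q U j X)"
  by (simp add: kos_def lie_vf_minus)

text \<open>Rewritten with right multiplication, the left Leibniz rule for the Lie derivative L
  reads L(\<eta> f) = L(\<eta>) f - (-1)^e \<eta> Q(f). Passing to - L turns it into the right
  Leibniz rule with shift 0.\<close>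

lemma right_dg_module_form:
  "right_dg_module G Q 0 (form_module G) (\<lambda>U e \<eta>. - lie_form G Q U e \<eta>)"
  unfolding right_dg_module_def differential_def form_module_def gmodule.simps
proof (intro conjI allI impI ballI; (elim conjE)?)
  fix U e \<eta> \<theta> assume U: "opn G U" and \<eta>: "\<eta> \<in> one_forms G U e"
  note L = lie_form_eq[OF \<eta>] and mem = lie_contraction_mem[OF \<eta>]
  show "- lie_form G Q U e \<eta> \<in> one_forms G U (e + 1)"
    using L form_minus_mem[OF mem] by simp
  show "- lie_form G Q U (e + 1) (- lie_form G Q U e \<eta>) = 0"
    unfolding L lie_form_eq[OF form_minus_mem[OF mem]] lie_contraction_minus[OF mem]
      lie_contraction_sq[OF \<eta>] by simp
  show "- lie_form G Q U e (\<eta> + \<theta>) = - lie_form G Q U e \<eta> + - lie_form G Q U e \<theta>"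
    if \<theta>: "\<theta> \<in> one_forms G U e"
    unfolding L lie_form_eq[OF \<theta>] lie_form_eq[OF form_add_mem[OF \<eta> \<theta>]]
      lie_contraction_add[OF \<eta> \<theta>] by simp
  show "form_restrict V (- lie_form G Q U e \<eta>) = - lie_form G Q V e (form_restrict V \<eta>)"
    if V: "opn G V" "V \<subseteq> U" for V
    unfolding L lie_form_eq[OF form_restrict_mem[OF \<eta> V]] lie_contraction_restrict[OF V(2), symmetric]
    by (auto simp: form_restrict_def fun_eq_iff)
  show "- lie_form G Q U (e + i) (kos ((e + 1) * i) (form_smul G U i f \<eta>)) =
      kos ((e + 1 + 1) * i) (form_smul G U i f (- lie_form G Q U e \<eta>)) +
      kos (e + 0) (kos ((e + 1) * (i + 1)) (form_smul G U (i + 1) (Q U f) \<eta>))"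
    if f: "f \<in> sec G U i" for f i
  proof -
    note m = form_smul_mem[OF \<eta> f U]
    have "kos ((e + 1) * i) (form_smul G U i f \<eta>) \<in> one_forms G U (e + i)"
      using form_kos_mem[OF m] by (simp add: add.commute)
    note L' = lie_form_eq[OF this]
    show ?thesis
      unfolding L L' lie_contraction_kos[OF m] lie_contraction_smul[OF \<eta> f U] form_smul_minus
      by (cases "even e"; cases "even i") (simp_all add: kos_def)
  qed
qed

text \<open>The shift comes from the right multiplication, whose exponent is |f| (|X| + 1 - k):
  replacing \<open>f\<close> by \<open>Q U f\<close> raises |f| by 1 and so adds |X| + 1 -
  k.\<close>

lemma right_dg_module_vf: "right_dg_module G Q (1 - k) (vf_module G k) (lie_vf Q)"
  unfolding right_dg_module_def
proof (intro conjI allI impI ballI)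
  show "differential G (vf_module G k) (lie_vf Q)"
    using left_dg_module_vf by (simp add: left_dg_module_def)
  fix U i j f X assume U: "opn G U" and f: "f \<in> sec G U i" and "X \<in> msec (vf_module G k) U j"
  then have X: "X \<in> vector_fields G U j"
    by (simp add: vf_module_def)
  show "lie_vf Q U (j + i) (rmul (vf_module G k) U j i X f) =
      rmul (vf_module G k) U (j + 1) i (lie_vf Q U j X) f +
      kos (j + (1 - k)) (rmul (vf_module G k) U j (i + 1) X (Q U f))"
    unfolding vf_module_def gmodule.simps add.commute[of j i] lie_vf_kos[OF vf_smul_mem[OF X f U]]
      lie_vf_smul[OF X f U]
    by (cases "even i"; cases "even j"; cases "even k") (simp_all add: kos_def)
qed

end

section \<open>Compatibility of the bracket with the homological vector field\<close>

locale poisson_homological = poisson_sheaf G k B + homological_sheaf G Q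
  for G :: "('m, 'a::real_algebra) gmfd" and k B Q
begin

text \<open>Inserting both closed formulas, the terms Q(\<eta>(X_\<zeta>)) appear on both sides and
  cancel. The other terms carry one common sign, which is why an equivalence and not just an
  implication results.\<close>

lemma pi_vf_lie_apply:
  assumes \<eta>: "\<eta> \<in> one_forms G U e" and W: "opn G W" "W \<subseteq> U" and \<zeta>: "\<zeta> \<in> sec G W i"
  shows "pi_vf U (e + 1) (lie_contraction U \<eta>) W \<zeta> = (- lie_vf Q U (e + k) (pi_vf U e \<eta>)) W \<zeta> \<longleftrightarrow>
    \<eta> W (i + k + 1) (lie_vf Q W (i + k) (hamiltonian G B W \<zeta>)) =
    \<eta> W (i + k + 1) (hamiltonian G B W (Q W \<zeta>))"
proof -
  note H = hamiltonian_mem[OF W(1) \<zeta>]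
  \<comment> \<open>A form takes the degree of the field as an argument, so the degree of the
    Hamiltonian field of \<open>Q W \<zeta>\<close> has to be brought to the same shape as that of
    the Lie derivative.\<close>
  have d: "i + 1 + k = i + k + 1"
    by simp
  note q = pi_vf_apply[OF \<eta> W Q_sec[OF W(1) \<zeta>], unfolded d]
  have "Q W (- kos ((e + k) * (i + k)) (\<eta> W (i + k) (hamiltonian G B W \<zeta>))) =
      - kos ((e + k) * (i + k)) (Q W (\<eta> W (i + k) (hamiltonian G B W \<zeta>)))"
    using vf_minus[OF Q_vf W(1) opn_topspace[OF W(1)] sec_kos[OF W(1) form_sec[OF \<eta> W H]]]
      Q_kos[OF W(1) form_sec[OF \<eta> W H]] by simp
  then show ?thesis
    unfolding pi_vf_apply[OF lie_contraction_mem[OF \<eta>] W \<zeta>] lie_contraction_apply[OF W H]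
      fun_Compl_def lie_vf_apply q pi_vf_apply[OF \<eta> W \<zeta>]
    by (cases "even e"; cases "even i"; cases "even k") (auto simp: kos_def algebra_simps)
qed

text \<open>The Hamiltonian field of \<xi> has degree i + k, so the sign of the commutator is the
  one in the compatibility condition; evaluated at \<zeta>, the two equations are the same.\<close>

lemma lie_hamiltonian:
  assumes PQ: "\<And>U i j \<xi> \<zeta>. opn G U \<Longrightarrow> \<xi> \<in> sec G U i \<Longrightarrow> \<zeta> \<in> sec G U j \<Longrightarrow>
      Q U (B U \<xi> \<zeta>) = B U (Q U \<xi>) \<zeta> + kos (i + k) (B U \<xi> (Q U \<zeta>))"
    and U: "opn G U" and \<xi>: "\<xi> \<in> sec G U i"
  shows "lie_vf Q U (i + k) (hamiltonian G B U \<xi>) = hamiltonian G B U (Q U \<xi>)"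
proof (intro ext)
  fix V \<zeta>
  show "lie_vf Q U (i + k) (hamiltonian G B U \<xi>) V \<zeta> = hamiltonian G B U (Q U \<xi>) V \<zeta>"
  proof (cases "opn G V \<and> V \<subseteq> U \<and> (\<exists>i. \<zeta> \<in> sec G V i)")
    case True
    then obtain j where V: "opn G V" "V \<subseteq> U" "\<zeta> \<in> sec G V j"
      by blast
    show ?thesis
      using PQ[OF V(1) res_sec[OF U V(1,2) \<xi>] V(3)] Q_res[OF U V(1,2) \<xi>]
        hamiltonian_apply[OF V] hamiltonian_apply[OF V(1,2) Q_sec[OF V(1,3)]]
      by (simp add: lie_vf_apply)
  next
    case False
    show ?thesis
      using vf_supp[OF lie_vf_mem[OF hamiltonian_mem[OF U \<xi>]] False]
        vf_supp[OF hamiltonian_mem[OF U Q_sec[OF U \<xi>]] False] by simp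
  qed
qed

lemma pi_vf_lie:
  assumes PQ: "\<And>U i j \<xi> \<zeta>. opn G U \<Longrightarrow> \<xi> \<in> sec G U i \<Longrightarrow> \<zeta> \<in> sec G U j \<Longrightarrow>
      Q U (B U \<xi> \<zeta>) = B U (Q U \<xi>) \<zeta> + kos (i + k) (B U \<xi> (Q U \<zeta>))"
    and U: "opn G U" and \<eta>: "\<eta> \<in> one_forms G U e"
  shows "pi_vf U (e + 1) (lie_contraction U \<eta>) = - lie_vf Q U (e + k) (pi_vf U e \<eta>)"
proof (intro ext)
  fix V \<zeta>
  show "pi_vf U (e + 1) (lie_contraction U \<eta>) V \<zeta> = (- lie_vf Q U (e + k) (pi_vf U e \<eta>)) V \<zeta>"
  proof (cases "opn G V \<and> V \<subseteq> U \<and> (\<exists>i. \<zeta> \<in> sec G V i)")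
    case True
    then obtain i where V: "opn G V" "V \<subseteq> U" "\<zeta> \<in> sec G V i"
      by blast
    have "lie_vf Q V (i + k) (hamiltonian G B V \<zeta>) = hamiltonian G B V (Q V \<zeta>)"
      by (rule lie_hamiltonian[OF _ V(1,3)]) (rule PQ)
    then show ?thesis
      unfolding pi_vf_lie_apply[OF \<eta> V] by simp
  next
    case False
    show ?thesis
      using vf_supp[OF lie_vf_mem[OF pi_vf_mem[OF \<eta> U]] False]
        vf_supp[OF pi_vf_mem[OF lie_contraction_mem[OF \<eta>] U] False] by simp
  qed
qed

text \<open>The unit \<open>u\<close> makes \<open>d\<zeta> = u d\<zeta>\<close> a one-form; evaluating both sides of the hypothesis on it
  recovers the values of the Hamiltonian vector fields.\<close>

lemma PQ_of_pi_vf_lie: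
  assumes anti: "\<And>e \<eta>. \<eta> \<in> one_forms G U e \<Longrightarrow>
      pi_vf U (e + 1) (lie_contraction U \<eta>) = - lie_vf Q U (e + k) (pi_vf U e \<eta>)"
    and U: "opn G U" and u: "u \<in> sec G U 0" "\<And>d x. x \<in> sec G U d \<Longrightarrow> u * x = x"
    and \<xi>: "\<xi> \<in> sec G U i" and \<zeta>: "\<zeta> \<in> sec G U j"
  shows "Q U (B U \<xi> \<zeta>) = B U (Q U \<xi>) \<zeta> + kos (i + k) (B U \<xi> (Q U \<zeta>))"
proof -
  let ?\<eta> = "form_comb G U 1 (\<lambda>_. 0) (\<lambda>_. u) (\<lambda>_. \<zeta>)"
  have t: "form_terms G U j 1 (\<lambda>_. 0) (\<lambda>_. u) (\<lambda>_. \<zeta>)"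
    using u \<zeta> by (simp add: form_terms_def)
  note \<eta> = form_comb_mem[OF t U]
  have eval: "?\<eta> U m X = X U \<zeta>" if X: "X \<in> vector_fields G U m" for m X
    using form_comb_apply[OF U subset_refl X, of 1] res_id[OF U \<zeta>] res_id[OF U u(1)]
      u(2)[OF vf_sec[OF X U subset_refl \<zeta>]] by (simp add: kos_even)
  note H = hamiltonian_mem[OF U \<xi>]
  have H': "hamiltonian G B U (Q U \<xi>) \<in> vector_fields G U (i + k + 1)"
    using hamiltonian_mem[OF U Q_sec[OF U \<xi>]] by (simp add: algebra_simps)
  \<comment> \<open>Anticommutation for d\<zeta> is evaluated at \<xi>, which brings in the
    Hamiltonian field of \<xi>; contracting with d\<zeta> is evaluation at \<zeta>.\<close>
  have "lie_vf Q U (i + k) (hamiltonian G B U \<xi>) U \<zeta> = hamiltonian G B U (Q U \<xi>) U \<zeta>"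
    using pi_vf_lie_apply[OF \<eta> U subset_refl \<xi>] anti[OF \<eta>] eval[OF lie_vf_mem[OF H]] eval[OF H']
    by simp
  then show ?thesis
    using hamiltonian_apply[OF U subset_refl \<zeta>] hamiltonian_apply[OF U subset_refl Q_sec[OF U \<zeta>]]
      res_id[OF U \<xi>] res_id[OF U Q_sec[OF U \<xi>]]
    by (simp add: lie_vf_apply algebra_simps)
qed

section \<open>Linearity of \<open>pi_sharp\<close> and the equivalence over sheaves\<close>

lemma pi_sharp_graded_additive:
  "graded_additive G k (form_module G) (vf_module G k) (pi_sharp G k B)"
  unfolding graded_additive_def form_module_def vf_module_def gmodule.simps
proof (intro conjI allI impI ballI; (elim conjE)?)
  fix U e \<eta> \<theta> assume U: "opn G U" and \<eta>: "\<eta> \<in> one_forms G U e"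
  show "pi_sharp G k B U e \<eta> \<in> vector_fields G U (e + k)"
    unfolding pi_sharp_eq[OF \<eta> U] by (rule pi_vf_mem[OF \<eta> U])
  show "pi_sharp G k B U e (\<eta> + \<theta>) = pi_sharp G k B U e \<eta> + pi_sharp G k B U e \<theta>"
    if \<theta>: "\<theta> \<in> one_forms G U e"
    unfolding pi_sharp_eq[OF \<eta> U] pi_sharp_eq[OF \<theta> U] pi_sharp_eq[OF form_add_mem[OF \<eta> \<theta>] U]
    by (rule pi_vf_add[OF \<eta> \<theta> U])
  show "vf_restrict V (pi_sharp G k B U e \<eta>) = pi_sharp G k B V e (form_restrict V \<eta>)"
    if V: "opn G V" "V \<subseteq> U" for V
    unfolding pi_sharp_eq[OF \<eta> U] pi_sharp_eq[OF form_restrict_mem[OF \<eta> V] V(1)]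
    by (rule pi_vf_restrict[OF \<eta> V])
qed

lemma pi_sharp_left_linear:
  assumes U: "opn G U" and f: "f \<in> sec G U i" and \<eta>: "\<eta> \<in> one_forms G U e"
  shows "pi_sharp G k B U (i + e) (form_smul G U i f \<eta>) =
    kos i (vf_smul G U f (pi_sharp G k B U e \<eta>))"
  unfolding pi_sharp_eq[OF \<eta> U] pi_sharp_eq[OF form_smul_mem[OF \<eta> f U] U]
  by (rule pi_vf_smul[OF \<eta> f U])

lemma pi_vf_minus: "pi_vf U e (- \<eta>) = - pi_vf U e \<eta>"
  unfolding pi_vf_def Let_def
  by (intro ext) (simp only: fun_Compl_def kos_minus if_distrib[of uminus] minus_zero)

text \<open>The image of a form of degree e has degree e + k, so the exponent i (e + k + 1 - k) in
  the target equals the exponent i (e + 1) for forms. The right rule thus reduces to the left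
  one.\<close>

lemma pi_sharp_right_linear:
  assumes U: "opn G U" and f: "f \<in> sec G U i" and \<eta>: "\<eta> \<in> one_forms G U e"
  shows "pi_sharp G k B U (e + i) (kos ((e + 1) * i) (form_smul G U i f \<eta>)) =
    kos i (kos (i * (e + k + 1 - k)) (vf_smul G U f (pi_sharp G k B U e \<eta>)))"
proof -
  note m = form_smul_mem[OF \<eta> f U]
  have km: "kos n (form_smul G U i f \<eta>) \<in> one_forms G U (e + i)" for n
    using form_kos_mem[OF m] by (simp add: add.commute)
  have "pi_vf U (e + i) (kos n \<theta>) = kos n (pi_vf U (e + i) \<theta>)" for n \<theta>
    by (simp add: kos_def pi_vf_minus)
  then show ?thesis
    unfolding pi_sharp_eq[OF \<eta> U] pi_sharp_eq[OF km U]
    using pi_vf_smul[OF \<eta> f U] by (simp add: kos_kos algebra_simps)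
qed

text \<open>Units appear as a hypothesis because the sheaf locales contain no map from smooth
  functions; they provide the presentation of d\<zeta> from which compatibility is
  recovered.\<close>

lemma symplectic_iff:
  assumes unit: "\<And>U. opn G U \<Longrightarrow> \<exists>u\<in>sec G U 0. \<forall>d. \<forall>x\<in>sec G U d. u * x = x"
  shows "symplectic_bracket G k B \<and>
      (\<forall>U i j. opn G U \<longrightarrow> (\<forall>\<xi>\<in>sec G U i. \<forall>\<zeta>\<in>sec G U j.
        Q U (B U \<xi> \<zeta>) = B U (Q U \<xi>) \<zeta> + kos (i + k) (B U \<xi> (Q U \<zeta>)))) \<longleftrightarrow>
    (\<forall>U e. opn G U \<longrightarrow>
      bij_betw (pi_sharp G k B U e) (one_forms G U e) (vector_fields G U (e + k))) \<and>
    (\<forall>U e. opn G U \<longrightarrow> (\<forall>\<eta>\<in>one_forms G U e.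
      pi_sharp G k B U (e + 1) (lie_form G Q U e \<eta>) =
        - lie_vf Q U (e + k) (pi_sharp G k B U e \<eta>)))"
    (is "?s \<and> ?PQ \<longleftrightarrow> ?bij \<and> ?anti")
proof -
  \<comment> \<open>The closed formulas replace the descriptions only on one-forms over open sets,
    so the two conditions are transferred under these restrictions.\<close>
  have bij_cong: "bij_betw (pi_sharp G k B U e) (one_forms G U e) (vector_fields G U (e + k)) \<longleftrightarrow>
      bij_betw (pi_vf U e) (one_forms G U e) (vector_fields G U (e + k))" if "opn G U" for U e
    using pi_sharp_eq that by (intro bij_betw_cong) simp
  have anti_cong: "pi_sharp G k B U (e + 1) (lie_form G Q U e \<eta>) =
        - lie_vf Q U (e + k) (pi_sharp G k B U e \<eta>) \<longleftrightarrow>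
      pi_vf U (e + 1) (lie_contraction U \<eta>) = - lie_vf Q U (e + k) (pi_vf U e \<eta>)"
    if "opn G U" "\<eta> \<in> one_forms G U e" for U e \<eta>
    unfolding lie_form_eq[OF that(2)] pi_sharp_eq[OF that(2,1)]
      pi_sharp_eq[OF lie_contraction_mem[OF that(2)] that(1)] ..
  show ?thesis
  proof
    assume *: "?s \<and> ?PQ"
    then have s: ?s and PQ: "\<And>U i j \<xi> \<zeta>. opn G U \<Longrightarrow> \<xi> \<in> sec G U i \<Longrightarrow> \<zeta> \<in> sec G U j \<Longrightarrow>
      Q U (B U \<xi> \<zeta>) = B U (Q U \<xi>) \<zeta> + kos (i + k) (B U \<xi> (Q U \<zeta>))"
      by simp_all
    show "?bij \<and> ?anti"
      using bij_cong pi_vf_bij[OF s] anti_cong pi_vf_lie[OF PQ] by simp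
  next
    assume *: "?bij \<and> ?anti"
    then have bij: "\<And>U e. opn G U \<Longrightarrow>
        bij_betw (pi_vf U e) (one_forms G U e) (vector_fields G U (e + k))"
      and anti: "\<And>U e \<eta>. opn G U \<Longrightarrow> \<eta> \<in> one_forms G U e \<Longrightarrow>
        pi_vf U (e + 1) (lie_contraction U \<eta>) = - lie_vf Q U (e + k) (pi_vf U e \<eta>)"
      using bij_cong anti_cong by simp_all
    have ?s
      using bij by (intro symplectic_of_pi_vf_surj) (simp add: bij_betw_def)
    moreover have ?PQ
    proof (intro allI impI ballI)
      fix U i j \<xi> \<zeta> assume U: "opn G U" and *: "\<xi> \<in> sec G U i" "\<zeta> \<in> sec G U j"
      obtain u where u: "u \<in> sec G U 0" "\<forall>d. \<forall>x\<in>sec G U d. u * x = x"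
        using unit[OF U] by blast
      show "Q U (B U \<xi> \<zeta>) = B U (Q U \<xi>) \<zeta> + kos (i + k) (B U \<xi> (Q U \<zeta>))"
        by (rule PQ_of_pi_vf_lie[OF anti[OF U] U u(1) u(2)[rule_format] *])
    qed
    ultimately show "?s \<and> ?PQ" ..
  qed
qed

end

section \<open>Units of a graded manifold and conclusion\<close>

text \<open>The constant varies in the induction because the partial derivatives are the constant
  0.\<close>

lemma Ck_on_const: "Ck_on n k W (\<lambda>_. c)"
  by (induction k arbitrary: c) auto

lemma graded_manifold_unit:
  assumes "graded_manifold G" "opn G U"
  shows "\<exists>u\<in>sec G U 0. \<forall>d. \<forall>x\<in>sec G U d. u * x = x"
proof -
  have one: "1 \<in> smooth_fun G U"
    by (auto simp: smooth_fun_def smooth_on_def one_fun_def Ck_on_const)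
  have S: "smooth_algebra_structure G"
    using assms(1) by (simp add: graded_manifold_def)
  note S = S[unfolded smooth_algebra_structure_def, rule_format, OF assms(2)]
  show ?thesis
  proof (intro bexI allI ballI)
    show "emb G U 1 \<in> sec G U 0"
      by (rule S[THEN conjunct2, THEN conjunct2, rule_format, OF one, THEN conjunct1])
    show "emb G U 1 * x = x" if "x \<in> sec G U d" for d x
      by (rule S[THEN conjunct1, rule_format, OF that])
  qed
qed

theorem corollary5p3p2:
  fixes G :: "('m, 'a::real_algebra) gmfd"
    and Q :: "('m, 'a) vf"
    and k :: int
    and B :: "'m set \<Rightarrow> 'a \<Rightarrow> 'a \<Rightarrow> 'a"
  assumes "graded_manifold G"
    and "homological G Q"
    and "poisson_bracket G k B"
  shows "(symplectic_PQ_manifold G Q k B \<longleftrightarrow>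
        left_dg_anti_isomorphism G Q k (form_module G) (lie_form G Q) (vf_module G k) (lie_vf Q)
          (pi_sharp G k B)) \<and>
      (symplectic_PQ_manifold G Q k B \<longleftrightarrow>
        right_dg_isomorphism G Q k 0 (form_module G) (\<lambda>U e \<eta>. - lie_form G Q U e \<eta>)
          (1 - k) (vf_module G k) (lie_vf Q) (pi_sharp G k B)) \<and>
      (symplectic_PQ_manifold G Q k B \<longleftrightarrow>
        (\<forall>U e. openin (base G) U \<longrightarrow>
          bij_betw (pi_sharp G k B U e) (one_forms G U e) (vector_fields G U (e + k))) \<and>
        (\<forall>U e. openin (base G) U \<longrightarrow> (\<forall>\<eta>\<in>one_forms G U e.
          pi_sharp G k B U (e + 1) (lie_form G Q U e \<eta>) =
            - lie_vf Q U (e + k) (pi_sharp G k B U e \<eta>))))"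
proof -
  interpret poisson_homological G k B Q
    using assms by unfold_locales (simp_all add: graded_manifold_def)
  let ?bij = "\<forall>U e. opn G U \<longrightarrow>
      bij_betw (pi_sharp G k B U e) (one_forms G U e) (vector_fields G U (e + k))"
  let ?anti = "\<forall>U e. opn G U \<longrightarrow> (\<forall>\<eta>\<in>one_forms G U e.
      pi_sharp G k B U (e + 1) (lie_form G Q U e \<eta>) =
        - lie_vf Q U (e + k) (pi_sharp G k B U e \<eta>))"
  have sympl: "symplectic_PQ_manifold G Q k B \<longleftrightarrow> ?bij \<and> ?anti"
    using symplectic_iff[OF graded_manifold_unit[OF assms(1)]] assms
    unfolding symplectic_PQ_manifold_def PQ_manifold_def by blast
  have bij: "graded_bijection G k (form_module G) (vf_module G k) (pi_sharp G k B) \<longleftrightarrow> ?bij"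
    by (simp add: graded_bijection_def form_module_def vf_module_def)
  have left: "left_dg_anti_isomorphism G Q k (form_module G) (lie_form G Q) (vf_module G k)
      (lie_vf Q) (pi_sharp G k B) \<longleftrightarrow> ?bij \<and> ?anti"
    unfolding left_dg_anti_isomorphism_def bij
    using left_dg_module_form left_dg_module_vf[of k] pi_sharp_graded_additive pi_sharp_left_linear
    by (simp add: form_module_def vf_module_def)
  \<comment> \<open>With this, commuting with the negated differential of the right module of forms
    becomes anticommuting with the Lie derivative.\<close>
  have minus: "pi_sharp G k B U (e + 1) (- lie_form G Q U e \<eta>) =
      - pi_sharp G k B U (e + 1) (lie_form G Q U e \<eta>)"
    if "opn G U" "\<eta> \<in> one_forms G U e" for U e \<eta>
  proof -
    note m = lie_contraction_mem[OF that(2)]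
    show ?thesis
      unfolding lie_form_eq[OF that(2)] pi_sharp_eq[OF m that(1)]
        pi_sharp_eq[OF form_minus_mem[OF m] that(1)]
      by (rule pi_vf_minus)
  qed
  have neg_eq: "- X = Y \<longleftrightarrow> X = - Y" for X Y :: "('m, 'a) vf"
    by (metis minus_minus)
  have right: "right_dg_isomorphism G Q k 0 (form_module G) (\<lambda>U e \<eta>. - lie_form G Q U e \<eta>)
      (1 - k) (vf_module G k) (lie_vf Q) (pi_sharp G k B) \<longleftrightarrow> ?bij \<and> ?anti"
    unfolding right_dg_isomorphism_def bij
    using right_dg_module_form right_dg_module_vf[of k] pi_sharp_graded_additive
      pi_sharp_right_linear
    by (simp add: form_module_def vf_module_def minus neg_eq)
  show ?thesis
    using sympl left right by (simp add: opn_def)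
qed

end
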